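(* Let $G=(V,E)$, $c$, $(T,\mathcal{X})$ and, for each node $\alpha$, the sets $R_\alpha$ and $R'_\alpha$ be as defined in the context. Then the family $\{R'_\alpha:\alpha\in V(T)\}$ can be computed in time $n^{w+O(1)}$, and $R'_\alpha=R_\alpha$ for every node $\alpha\in V(T)$.
   Context: $G=(V,E)$ is a simple undirected graph with $n=|V|$ vertices and $c:V\to\mathbb{N}$ a capacity function. $(T,\mathcal{X})$ is a nice tree decomposition of $G$ of width $w$: a rooted tree $T$ with bags $X_\alpha\subseteq V$ forming a tree decomposition (every vertex in some bag, every edge inside some bag, the nodes containing any fixed vertex form a subtree), of width $\max_\alpha|X_\alpha|-1=w$, in which every node is either a leaf with $X_\alpha=\emptyset$; an introduce-$v$ node with one child $\alpha_1$, $v\notin X_{\alpha_1}$, $X_\alpha=X_{\alpha_1}\cup\{v\}$; a forget-$v$ node with one child $\alpha_1$, $v\notin X_\alpha$, $X_{\alpha_1}=X_\alpha\cup\{v\}$; or a join node with two children $\alpha_1,\alpha_2$ and $X_\alpha=X_{\alpha_1}=X_{\alpha_2}$. For a node $\alpha$, $V_\alpha$ is the union of the bags of the subtree rooted at $\alpha$, $Y_\alpha=V_\alpha\setminus X_\alpha$, and $G_\alpha$ is the graph with vertex set $V_\alpha$ and edge set $E[V_\alpha]\setminus E[X_\alpha]$ (edges with both endpoints in $V_\alpha$ but not both in $X_\alpha$). $N(v)$ is the neighbourhood of $v$ in $G$; for an orientation $O$, $D^+_O(v)$, $D^-_O(v)$ are out- and in-degree; for a map $d$, $d\setminus v$ is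 its restriction to the domain minus $v$. $R_\alpha$ is the set of pairs $(d,k)$ with $d:X_\alpha\to\mathbb{N}$, $k\in\mathbb{N}$, for which there is an orientation $O$ of $G_\alpha$ with: (1) $d(v)=D^+_O(v)$ for all $v\in X_\alpha$; (2) $D^-_O(v)\le c(v)$ for all $v\in Y_\alpha$; (3) $|\{v\in Y_\alpha: D^-_O(v)>0\}|\le k\le |Y_\alpha|$. $R'_\alpha$ is defined recursively: for a leaf, $R'_\alpha=\{(d_\emptyset,0)\}$ with $d_\emptyset$ the empty map. For an introduce-$v$ node, $(d,k)\in R'_\alpha$ iff $(d\setminus v,k)\in R'_{\alpha_1}$ and $d(v)=0$. For a join node, $(d,k)\in R'_\alpha$ iff there are $(d_1,k_1)\in R'_{\alpha_1}$, $(d_2,k_2)\in R'_{\alpha_2}$ with $d(u)=d_1(u)+d_2(u)$ for all $u\in X_\alpha$ and $k=k_1+k_2$. For a forget-$v$ node, $(d,k)\in R'_\alpha$ iff there is $(d_1,k_1)\in R'_{\alpha_1}$ with either (i) $k_1=k$, $d_1(v)=|N(v)\cap Y_\alpha|$ and $d_1\setminus v=d$; or (ii) $k_1=k-1$ and there exist $\Delta\subseteq N(v)\cap X_\alpha$ and an integer $A\in[\,|N(v)\cap Y_\alpha|-c(v)+|\Delta|,\ |N(v)\cap Y_\alpha|\,]$ such that $d_1(v)=A$, $d_1(u)=d(u)-1$ for $u\in\Delta$, and $d_1(u)=d(u)$ for $u\in X_{\alpha_1}\setminus(\Delta\cup\{v\})$.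
   Formalization: The running time is stated as O(|V(T)|)·n^{w+O(1)} for n ≥ 1, since the size of T is not bounded in terms of n by the definition of a nice tree decomposition; this is n^{w+O(1)} whenever |V(T)| is polynomial in n. *)

theory Defs
  imports Main
begin

section \<open>Graphs and orientations\<close>

definition simple_graph :: "'v set \<Rightarrow> 'v set set \<Rightarrow> bool" where
  "simple_graph V E \<longleftrightarrow> finite V \<and> (\<forall>e\<in>E. e \<subseteq> V \<and> card e = 2)"

definition neighbours :: "'v set set \<Rightarrow> 'v \<Rightarrow> 'v set" where
  "neighbours E v = {u. {u, v} \<in> E}"

definition induced_edges :: "'v set set \<Rightarrow> 'v set \<Rightarrow> 'v set set" where
  "induced_edges E S = {e \<in> E. e \<subseteq> S}"

text \<open>An arc \<open>(u, v)\<close> points from \<open>u\<close> to \<open>v\<close>; an orientation has exactly one arc over each edge.\<close>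

definition orientation :: "'v set set \<Rightarrow> ('v \<times> 'v) set \<Rightarrow> bool" where
  "orientation F D \<longleftrightarrow> bij_betw (\<lambda>(u, v). {u, v}) D F"

definition outdeg :: "('v \<times> 'v) set \<Rightarrow> 'v \<Rightarrow> nat" where
  "outdeg D v = card {u. (v, u) \<in> D}"

definition indeg :: "('v \<times> 'v) set \<Rightarrow> 'v \<Rightarrow> nat" where
  "indeg D v = card {u. (u, v) \<in> D}"


section \<open>Nice tree decompositions\<close>

datatype 'v rtree = Node (bag: "'v set") (children: "'v rtree list")

text \<open>A node of the tree is addressed by the sequence of child indices leading to it from the root;
  \<open>nodes\<close> lists the addresses of all nodes in preorder.\<close>

primrec nodes :: "'v rtree \<Rightarrow> nat list list" where
  "nodes (Node X ts) =
     [] # concat (map2 (\<lambda>i ps. map ((#) i) ps) [0..<length ts] (map nodes ts))"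

fun subtree_at :: "'v rtree \<Rightarrow> nat list \<Rightarrow> 'v rtree" where
  "subtree_at t [] = t"
| "subtree_at t (i # p) = subtree_at (children t ! i) p"

abbreviation bag_at :: "'v rtree \<Rightarrow> nat list \<Rightarrow> 'v set" where
  "bag_at T \<alpha> \<equiv> bag (subtree_at T \<alpha>)"

definition tree_adj :: "nat list \<Rightarrow> nat list \<Rightarrow> bool" where
  "tree_adj \<alpha> \<beta> \<longleftrightarrow> (\<exists>i. \<beta> = \<alpha> @ [i]) \<or> (\<exists>i. \<alpha> = \<beta> @ [i])"

definition connected_nodes :: "nat list set \<Rightarrow> bool" where
  "connected_nodes P \<longleftrightarrow>
     (\<forall>\<alpha>\<in>P. \<forall>\<beta>\<in>P. (\<alpha>, \<beta>) \<in> {(x, y). x \<in> P \<and> y \<in> P \<and> tree_adj x y}\<^sup>*)"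

definition tree_decomposition :: "'v set \<Rightarrow> 'v set set \<Rightarrow> 'v rtree \<Rightarrow> bool" where
  "tree_decomposition V E T \<longleftrightarrow>
     (\<forall>\<alpha>\<in>set (nodes T). bag_at T \<alpha> \<subseteq> V) \<and>
     (\<forall>v\<in>V. \<exists>\<alpha>\<in>set (nodes T). v \<in> bag_at T \<alpha>) \<and>
     (\<forall>e\<in>E. \<exists>\<alpha>\<in>set (nodes T). e \<subseteq> bag_at T \<alpha>) \<and>
     (\<forall>v\<in>V. connected_nodes {\<alpha> \<in> set (nodes T). v \<in> bag_at T \<alpha>})"

text \<open>The subtraction truncates only if all bags are empty, that is, if the graph has no vertex.\<close>

definition width :: "'v rtree \<Rightarrow> nat" where
  "width T = Max ((\<lambda>\<alpha>. card (bag_at T \<alpha>)) ` set (nodes T)) - 1"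

definition introduces :: "'v \<Rightarrow> 'v set \<Rightarrow> 'v set \<Rightarrow> bool" where
  "introduces v X X1 \<longleftrightarrow> v \<notin> X1 \<and> X = X1 \<union> {v}"

definition forgets :: "'v \<Rightarrow> 'v set \<Rightarrow> 'v set \<Rightarrow> bool" where
  "forgets v X X1 \<longleftrightarrow> v \<notin> X \<and> X1 = X \<union> {v}"

fun nice_node :: "'v rtree \<Rightarrow> bool" where
  "nice_node (Node X []) \<longleftrightarrow> X = {}"
| "nice_node (Node X [t]) \<longleftrightarrow> (\<exists>v. introduces v X (bag t) \<or> forgets v X (bag t))"
| "nice_node (Node X [t1, t2]) \<longleftrightarrow> X = bag t1 \<and> X = bag t2"
| "nice_node (Node X (_ # _ # _ # _)) \<longleftrightarrow> False"

definition nice_tree_decomposition :: "'v set \<Rightarrow> 'v set set \<Rightarrow> 'v rtree \<Rightarrow> bool" where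
  "nice_tree_decomposition V E T \<longleftrightarrow>
     tree_decomposition V E T \<and> (\<forall>\<alpha>\<in>set (nodes T). nice_node (subtree_at T \<alpha>))"


section \<open>The two families of tables\<close>

text \<open>Everything attached to a node depends only on the subtree \<open>t\<close> rooted there:
  \<open>Vset t\<close> is $V_\alpha$ and \<open>Yset t\<close> is $Y_\alpha$. A map $d : X_\alpha \to \mathbb{N}$ is a
  partial map with domain \<open>bag t\<close>.\<close>

primrec Vset :: "'v rtree \<Rightarrow> 'v set" where
  "Vset (Node X ts) = X \<union> \<Union> (set (map Vset ts))"

definition Yset :: "'v rtree \<Rightarrow> 'v set" where
  "Yset t = Vset t - bag t"

definition Gedges :: "'v set set \<Rightarrow> 'v rtree \<Rightarrow> 'v set set" where
  "Gedges E t = induced_edges E (Vset t) - induced_edges E (bag t)"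

definition R :: "'v set set \<Rightarrow> ('v \<Rightarrow> nat) \<Rightarrow> 'v rtree \<Rightarrow> (('v \<rightharpoonup> nat) \<times> nat) set" where
  "R E c t = {(d, k). dom d = bag t \<and>
     (\<exists>D. orientation (Gedges E t) D \<and>
        (\<forall>v\<in>bag t. d v = Some (outdeg D v)) \<and>
        (\<forall>v\<in>Yset t. indeg D v \<le> c v) \<and>
        card {v \<in> Yset t. indeg D v > 0} \<le> k \<and> k \<le> card (Yset t))}"

text \<open>The forget rule for a node with subtree \<open>t\<close>, with \<open>d1\<close>, \<open>k1\<close> from the table of the child,
  whose bag is \<open>X1\<close>. The bounds on \<open>A\<close> and the decrements are taken in the integers, so nothing is
  truncated.\<close>

definition forget_rule ::
  "'v set set \<Rightarrow> ('v \<Rightarrow> nat) \<Rightarrow> 'v rtree \<Rightarrow> 'v \<Rightarrow> 'v set \<Rightarrow>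
     ('v \<rightharpoonup> nat) \<Rightarrow> nat \<Rightarrow> ('v \<rightharpoonup> nat) \<Rightarrow> nat \<Rightarrow> bool" where
  "forget_rule E c t v X1 d k d1 k1 \<longleftrightarrow>
     (k1 = k \<and> d1 v = Some (card (neighbours E v \<inter> Yset t)) \<and> d1 |` (- {v}) = d) \<or>
     (int k1 = int k - 1 \<and>
      (\<exists>\<Delta> A. \<Delta> \<subseteq> neighbours E v \<inter> bag t \<and>
         A \<in> {int (card (neighbours E v \<inter> Yset t)) - int (c v) + int (card \<Delta>)
               .. int (card (neighbours E v \<inter> Yset t))} \<and>
         int (the (d1 v)) = A \<and>
         (\<forall>u\<in>\<Delta>. int (the (d1 u)) = int (the (d u)) - 1) \<and>
         (\<forall>u\<in>X1 - (\<Delta> \<union> {v}). the (d1 u) = the (d u))))"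

fun R' :: "'v set set \<Rightarrow> ('v \<Rightarrow> nat) \<Rightarrow> 'v rtree \<Rightarrow> (('v \<rightharpoonup> nat) \<times> nat) set" where
  "R' E c (Node X []) = {(Map.empty, 0)}"
| "R' E c (Node X [t1]) = {(d, k). dom d = X \<and>
     ((\<exists>v. introduces v X (bag t1) \<and> (d |` (- {v}), k) \<in> R' E c t1 \<and> d v = Some 0) \<or>
      (\<exists>v. forgets v X (bag t1) \<and>
         (\<exists>(d1, k1) \<in> R' E c t1. forget_rule E c (Node X [t1]) v (bag t1) d k d1 k1)))}"
| "R' E c (Node X [t1, t2]) = {(d, k). dom d = X \<and>
     (\<exists>(d1, k1) \<in> R' E c t1. \<exists>(d2, k2) \<in> R' E c t2.
        (\<forall>u\<in>X. the (d u) = the (d1 u) + the (d2 u)) \<and> k = k1 + k2)}"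
| "R' E c (Node X (_ # _ # _ # _)) = {}"


section \<open>Model of computation\<close>

text \<open>Algorithms are programs of a first-order functional language over binary trees, where every
  evaluation step takes unit time (in the style of N. D. Jones, \<^emph>\<open>Computability and Complexity from a
  Programming Perspective\<close>). There are no arithmetic primitives: a step builds or inspects a single
  cell or passes a number of pointers bounded in terms of the program, hence takes constant time on
  a pointer machine or a random access machine.\<close>

datatype data = Atom | Pair data data

fun left :: "data \<Rightarrow> data" where
  "left Atom = Atom"
| "left (Pair x y) = x"

fun right :: "data \<Rightarrow> data" where
  "right Atom = Atom"
| "right (Pair x y) = y"

datatype expr =
    Var nat
  | AtomE
  | PairE expr expr
  | LeftE expr
  | RightE expr
  | IfAtomE expr expr expr
  | LetE expr expr
  | CallE nat "expr list"

text \<open>A program is the list of the bodies of its (mutually recursive) functions. In a body, \<open>Var i\<close>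
  is the \<open>i\<close>-th entry of the environment, which initially consists of the arguments.
  \<open>eval p env e x t\<close>: the expression \<open>e\<close> evaluates to \<open>x\<close> in \<open>t\<close> steps.\<close>

type_synonym program = "expr list"

inductive eval :: "program \<Rightarrow> data list \<Rightarrow> expr \<Rightarrow> data \<Rightarrow> nat \<Rightarrow> bool"
  and evals :: "program \<Rightarrow> data list \<Rightarrow> expr list \<Rightarrow> data list \<Rightarrow> nat \<Rightarrow> bool"
  for p :: program where
  eval_Var: "i < length env \<Longrightarrow> eval p env (Var i) (env ! i) 1"
| eval_Atom: "eval p env AtomE Atom 1"
| eval_Pair: "eval p env e1 x1 t1 \<Longrightarrow> eval p env e2 x2 t2 \<Longrightarrow>
    eval p env (PairE e1 e2) (Pair x1 x2) (t1 + t2 + 1)"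
| eval_Left: "eval p env e x t \<Longrightarrow> eval p env (LeftE e) (left x) (t + 1)"
| eval_Right: "eval p env e x t \<Longrightarrow> eval p env (RightE e) (right x) (t + 1)"
| eval_IfAtom: "eval p env e Atom t \<Longrightarrow> eval p env e1 x1 t1 \<Longrightarrow>
    eval p env (IfAtomE e e1 e2) x1 (t + t1 + 1)"
| eval_IfPair: "eval p env e (Pair y z) t \<Longrightarrow> eval p env e2 x2 t2 \<Longrightarrow>
    eval p env (IfAtomE e e1 e2) x2 (t + t2 + 1)"
| eval_Let: "eval p env e1 x1 t1 \<Longrightarrow> eval p (x1 # env) e2 x2 t2 \<Longrightarrow>
    eval p env (LetE e1 e2) x2 (t1 + t2 + 1)"
| eval_Call: "f < length p \<Longrightarrow> evals p env es xs t1 \<Longrightarrow> eval p xs (p ! f) x t2 \<Longrightarrow>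
    eval p env (CallE f es) x (t1 + t2 + 1)"
| evals_Nil: "evals p env [] [] 0"
| evals_Cons: "eval p env e x t1 \<Longrightarrow> evals p env es xs t2 \<Longrightarrow>
    evals p env (e # es) (x # xs) (t1 + t2)"

inductive_cases eval_elims:
  "eval p env (Var i) x t" "eval p env AtomE x t" "eval p env (PairE e1 e2) x t"
  "eval p env (LeftE e) x t" "eval p env (RightE e) x t" "eval p env (IfAtomE e e1 e2) x t"
  "eval p env (LetE e1 e2) x t" "eval p env (CallE f es) x t"
  "evals p env [] xs t" "evals p env (e # es) xs t"

lemma eval_deterministic:
  shows "eval p env e x t \<Longrightarrow> eval p env e x' t' \<Longrightarrow> x' = x \<and> t' = t"
    and "evals p env es xs t \<Longrightarrow> evals p env es xs' t' \<Longrightarrow> xs' = xs \<and> t' = t"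
proof (induction arbitrary: x' t' and xs' t' rule: eval_evals.inducts)
  case (eval_Var i env)
  then show ?case by (auto elim: eval_elims(1))
next
  case (eval_Atom env)
  then show ?case by (auto elim: eval_elims(2))
next
  case (eval_Pair env e1 x1 t1 e2 x2 t2)
  from eval_Pair.prems show ?case
    by (rule eval_elims(3)) (auto dest!: eval_Pair.IH(2,4))
next
  case (eval_Left env e x t)
  from eval_Left.prems show ?case
    by (rule eval_elims(4)) (auto dest!: eval_Left.IH(2))
next
  case (eval_Right env e x t)
  from eval_Right.prems show ?case
    by (rule eval_elims(5)) (auto dest!: eval_Right.IH(2))
next
  case (eval_IfAtom env e t e1 x1 t1 e2)
  from eval_IfAtom.prems show ?case
    by (rule eval_elims(6)) (auto dest!: eval_IfAtom.IH(2,4))+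
next
  case (eval_IfPair env e y z t e2 x2 t2 e1)
  from eval_IfPair.prems show ?case
    by (rule eval_elims(6)) (auto dest!: eval_IfPair.IH(2,4))+
next
  case (eval_Let env e1 x1 t1 e2 x2 t2)
  from eval_Let.prems show ?case
    by (rule eval_elims(7)) (auto dest!: eval_Let.IH(2,4))
next
  case (eval_Call f env es xs t1 x t2)
  from eval_Call.prems show ?case
    by (rule eval_elims(8)) (auto dest!: eval_Call.IH(3,5))
next
  case (evals_Nil env)
  then show ?case by (auto elim: eval_elims(9))
next
  case (evals_Cons env e x t1 es xs t2)
  from evals_Cons.prems show ?case
    by (rule eval_elims(10)) (auto dest!: evals_Cons.IH(2,4))
qed

text \<open>Function 0 is the main function.\<close>

definition runs :: "program \<Rightarrow> data \<Rightarrow> data \<Rightarrow> nat \<Rightarrow> bool" where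
  "runs p x y t \<longleftrightarrow> eval p [x] (CallE 0 [Var 0]) y t"


section \<open>Encoding of inputs and outputs\<close>

primrec enc_nat :: "nat \<Rightarrow> data" where
  "enc_nat 0 = Atom"
| "enc_nat (Suc m) = Pair Atom (enc_nat m)"

primrec enc_list :: "data list \<Rightarrow> data" where
  "enc_list [] = Atom"
| "enc_list (x # xs) = Pair x (enc_list xs)"

definition enc_bool :: "bool \<Rightarrow> data" where
  "enc_bool b = (if b then Pair Atom Atom else Atom)"

text \<open>The vertices are presented by an enumeration \<open>vs\<close>; a vertex is encoded by its position in \<open>vs\<close>
  and the members of a bag are listed in the order of \<open>vs\<close>.\<close>

definition enc_vertex :: "'v list \<Rightarrow> 'v \<Rightarrow> data" where
  "enc_vertex vs v = enc_nat (length (takeWhile (\<lambda>u. u \<noteq> v) vs))"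

definition enum_bag :: "'v list \<Rightarrow> 'v set \<Rightarrow> 'v list" where
  "enum_bag vs X = filter (\<lambda>v. v \<in> X) vs"

primrec enc_tree :: "'v list \<Rightarrow> 'v rtree \<Rightarrow> data" where
  "enc_tree vs (Node X ts) =
     Pair (enc_list (map (enc_vertex vs) (enum_bag vs X))) (enc_list (map (enc_tree vs) ts))"

text \<open>The input consists of the adjacency matrix, the capacities and the tree decomposition. Capacities
  may be arbitrarily large compared with the number of vertices; in unary, an algorithm can truncate
  them without reading them completely, so a time bound independent of \<open>c\<close> makes sense.\<close>

definition enc_instance ::
  "'v list \<Rightarrow> 'v set set \<Rightarrow> ('v \<Rightarrow> nat) \<Rightarrow> 'v rtree \<Rightarrow> data" where
  "enc_instance vs E c T = enc_list
     [enc_list (map (\<lambda>u. enc_list (map (\<lambda>v. enc_bool ({u, v} \<in> E)) vs)) vs),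
      enc_list (map (\<lambda>v. enc_nat (c v)) vs),
      enc_tree vs T]"

text \<open>A pair \<open>(d, k)\<close> is encoded by the values of \<open>d\<close> on the bag \<open>X\<close> and by \<open>k\<close>.\<close>

definition enc_entry :: "'v list \<Rightarrow> 'v set \<Rightarrow> ('v \<rightharpoonup> nat) \<times> nat \<Rightarrow> data" where
  "enc_entry vs X = (\<lambda>(d, k).
     Pair (enc_list (map (\<lambda>v. enc_nat (the (d v))) (enum_bag vs X))) (enc_nat k))"

text \<open>\<open>y\<close> is an encoding of the family of sets \<open>S \<alpha>\<close>, with \<open>\<alpha>\<close> ranging over the nodes of \<open>T\<close> in
  preorder, where each set is given by a list of its elements in any order.\<close>

definition encodes_family ::
  "'v list \<Rightarrow> 'v rtree \<Rightarrow> (nat list \<Rightarrow> (('v \<rightharpoonup> nat) \<times> nat) set) \<Rightarrow> data \<Rightarrow> bool" where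
  "encodes_family vs T S y \<longleftrightarrow>
     (\<exists>tab. (\<forall>\<alpha>\<in>set (nodes T). set (tab \<alpha>) = S \<alpha>) \<and>
        y = enc_list (map (\<lambda>\<alpha>. enc_list (map (enc_entry vs (bag_at T \<alpha>)) (tab \<alpha>))) (nodes T)))"

end

theory Submission
  imports Defs Complex_Main "HOL-Computational_Algebra.Polynomial"
begin

text \<open>
  \<^emph>\<open>Correctness.\<close> Since the nodes containing a vertex are connected, an edge of $G_\alpha$ lies in the
  graph of exactly one child, or at a forget node joins the forgotten vertex $v$ to the bag. An
  orientation of $G_\alpha$ is therefore a combination of orientations for the children and, at a forget
  node, of the set $\Delta$ of the bag vertices whose edge to $v$ is directed towards $v$.

  \<^emph>\<open>Running time.\<close> A table has at most $(n+1)^{w+2}$ entries, so combining all pairs of entries at a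
  join node is too slow; likewise the $2^w$ sets $\Delta$ at a forget node. Both rules are
  multiplications of polynomials in one variable per bag vertex and one variable for $k$: the monomials
  of a table are its entries, and at a forget node the second factor is $z \prod_u (1 + x_u x_v)$ over
  the neighbours $u$ of $v$ in the bag, where the exponent of $x_v$ counts the arcs into $v$. Since
  $R'_\alpha = R_\alpha$, all exponents of the products are at most $n$. Hence each variable can be evaluated
  at $0, \dots, n$ in turn, and the product is recovered by Lagrange interpolation; evaluating and
  interpolating one variable at a time takes $(n+1)^{w+O(1)}$ arithmetic operations, and
  $(n+1)^w \le 3 n^w$ for $w \le n$. Only the support of the product matters, so the interpolation
  matrix may be scaled to avoid divisions, and integers modulo a sufficiently large power of two suffice.
\<close>

section \<open>Orientations along a nice tree decomposition\<close>

text \<open>A subtree is not a decomposition of the whole graph, so connectivity is turned into a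
  property of single nodes that survives induction on the tree. Interpolation at \<open>N\<close>
  points is faithful only for degrees below \<open>N\<close>. The degree bounds of the factors are
  cardinalities read off from orientations, so the running time rests on \<open>R' = R\<close>; on
  every axis the bounds of both factors must add up to at most n. This follows from disjointness of
  the forgotten parts, or of the forgotten part and the bag. At a forget node the axis of the vertex
  v holds its in-degree, which is complete after the multiplication, so the capacity is a cut-off on
  that axis. Alternative (i), where v is not counted, is the slice at in-degree 0 of the
  unmultiplied table. All coefficients are nonnegative and interpolation scales by a positive
  square, so nothing cancels. Each of at most \<open>N\<close> axes scales by at most
  \<open>N^(2*N^2)\<close>, about \<open>2*N^4\<close> bits in all; words of \<open>(N+1)^5\<close>
  bits cover this and only enlarge the O(1) in the exponent.\<close>

lemma in_nodes_iff:
  "p \<in> set (nodes (Node X ts)) \<longleftrightarrow>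
     p = [] \<or> (\<exists>i q. p = i # q \<and> i < length ts \<and> q \<in> set (nodes (ts ! i)))"
  by (auto simp: set_zip) force

lemma Nil_in_nodes [simp]: "[] \<in> set (nodes t)"
  by (cases t) simp

lemma Cons_in_nodes: "i # q \<in> set (nodes t) \<longleftrightarrow> i < length (children t) \<and> q \<in> set (nodes (children t ! i))"
  by (cases t) (simp add: in_nodes_iff del: nodes.simps)

lemma append_in_nodes: "p @ q \<in> set (nodes t) \<longleftrightarrow> p \<in> set (nodes t) \<and> q \<in> set (nodes (subtree_at t p))"
  by (induction p arbitrary: t) (auto simp: Cons_in_nodes)

lemma subtree_at_append: "subtree_at t (p @ q) = subtree_at (subtree_at t p) q"
  by (induction p arbitrary: t) auto

text \<open>Links the recursive description of the vertices below a node with addresses, in terms of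
  which connectivity is stated.\<close>

lemma Vset_conv_nodes: "Vset t = (\<Union>q\<in>set (nodes t). bag_at t q)"
proof (induction t)
  case (Node X ts)
  have "Vset (Node X ts) = X \<union> (\<Union>i<length ts. Vset (ts ! i))"
    by (auto simp: in_set_conv_nth) force
  also have "\<dots> = X \<union> (\<Union>i<length ts. \<Union>q\<in>set (nodes (ts ! i)). bag_at (ts ! i) q)"
    using Node by simp
  also have "\<dots> = (\<Union>q\<in>set (nodes (Node X ts)). bag_at (Node X ts) q)"
  proof (intro set_eqI iffI)
    fix x assume "x \<in> X \<union> (\<Union>i<length ts. \<Union>q\<in>set (nodes (ts ! i)). bag_at (ts ! i) q)"
    then consider "x \<in> X" | i q where "i < length ts" "q \<in> set (nodes (ts ! i))" "x \<in> bag_at (ts ! i) q"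
      by blast
    then show "x \<in> (\<Union>q\<in>set (nodes (Node X ts)). bag_at (Node X ts) q)"
    proof cases
      case 1
      then show ?thesis by (intro UN_I[of "[]"]) simp_all
    next
      case 2
      then show ?thesis by (intro UN_I[of "i # q"]) (simp_all add: Cons_in_nodes del: nodes.simps)
    qed
  next
    fix x assume "x \<in> (\<Union>q\<in>set (nodes (Node X ts)). bag_at (Node X ts) q)"
    then obtain q where "q \<in> set (nodes (Node X ts))" "x \<in> bag_at (Node X ts) q" by blast
    then show "x \<in> X \<union> (\<Union>i<length ts. \<Union>q\<in>set (nodes (ts ! i)). bag_at (ts ! i) q)"
      unfolding in_nodes_iff by auto
  qed
  finally show ?case .
qed

lemma bag_subset_Vset: "bag t \<subseteq> Vset t"
  by (cases t) auto

text \<open>Adjacent addresses differ by one final index, so a walk that leaves the addresses below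
  \<open>p @ [i]\<close> has to step from \<open>p @ [i]\<close> to \<open>p\<close>. Both ends of
  that step then lie in the connected set.\<close>

lemma connected_nodes_cut:
  assumes "connected_nodes P" "p @ i # q \<in> P" "\<beta> \<in> P" "\<And>q. \<beta> \<noteq> p @ i # q"
  shows "p \<in> P \<and> p @ [i] \<in> P"
proof -
  let ?r = "{(x, y). x \<in> P \<and> y \<in> P \<and> tree_adj x y}"
  have "(p @ i # q, \<beta>) \<in> ?r\<^sup>*" using assms by (auto simp: connected_nodes_def)
  then have "(\<exists>q. \<beta> = p @ i # q) \<or> p \<in> P \<and> p @ [i] \<in> P"
  proof (induction rule: rtrancl_induct)
    case (step x y)
    show ?case
    proof (cases "p \<in> P \<and> p @ [i] \<in> P")
      case False
      with step.IH obtain q where x: "x = p @ i # q" by blast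
      from step.hyps(2) have P: "x \<in> P" "y \<in> P" and "tree_adj x y" by auto
      then consider k where "y = x @ [k]" | k where "x = y @ [k]" by (auto simp: tree_adj_def)
      then show ?thesis
      proof cases
        case 1
        then show ?thesis using x by simp
      next
        case 2
        show ?thesis
        proof (cases q rule: rev_cases)
          \<comment> \<open>The crossing step: \<open>x\<close> is \<open>p @ [i]\<close> and its
            parent is \<open>p\<close>.\<close>
          case Nil
          with 2 x P show ?thesis by simp
        next
          case (snoc q' z)
          with 2 x show ?thesis by auto
        qed
      qed
    qed simp
  qed simp
  with assms(4) show ?thesis by blast
qed

text \<open>What connectivity of the decomposition means locally at a node.\<close>

definition separated :: "'v set \<Rightarrow> 'v set set \<Rightarrow> 'v rtree \<Rightarrow> bool" where
  "separated V E s \<longleftrightarrow> nice_node s \<and> Vset s \<subseteq> V \<and>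
     (\<forall>i<length (children s).
        Vset (children s ! i) \<inter> bag s \<subseteq> bag (children s ! i) \<and>
        (\<forall>y\<in>Yset (children s ! i). \<forall>x. {x, y} \<in> E \<longrightarrow> x \<in> Vset (children s ! i)) \<and>
        (\<forall>j<length (children s). i \<noteq> j \<longrightarrow> Vset (children s ! i) \<inter> Vset (children s ! j) \<subseteq> bag s))"

text \<open>The clauses on vertices and edges all rest on one fact, \<open>cut\<close>: a vertex
  that occurs below child \<open>i\<close> and also at a node elsewhere occurs in the bags at both
  ends of the tree edge to child \<open>i\<close>.\<close>

lemma separated_nodes:
  assumes T: "nice_tree_decomposition V E T" and p: "p \<in> set (nodes T)"
  shows "separated V E (subtree_at T p)"
proof -
  let ?s = "subtree_at T p"
  from T have bags: "\<And>\<alpha>. \<alpha> \<in> set (nodes T) \<Longrightarrow> bag_at T \<alpha> \<subseteq> V"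
    and edges: "\<And>e. e \<in> E \<Longrightarrow> \<exists>\<alpha>\<in>set (nodes T). e \<subseteq> bag_at T \<alpha>"
    and conn: "\<And>v. v \<in> V \<Longrightarrow> connected_nodes {\<alpha> \<in> set (nodes T). v \<in> bag_at T \<alpha>}"
    and nice: "nice_node ?s"
    using p by (auto simp: nice_tree_decomposition_def tree_decomposition_def)
  have sub: "\<exists>q. p @ i # q \<in> set (nodes T) \<and> v \<in> bag_at T (p @ i # q)"
    if "i < length (children ?s)" "v \<in> Vset (children ?s ! i)" for i v
    using that p unfolding Vset_conv_nodes
    by (auto simp: append_in_nodes Cons_in_nodes subtree_at_append)
  have Vsub: "v \<in> Vset (children ?s ! i)"
    if "i < length (children ?s)" "p @ i # q \<in> set (nodes T)" "v \<in> bag_at T (p @ i # q)" for i q v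
    using that unfolding Vset_conv_nodes
    by (auto simp: append_in_nodes Cons_in_nodes subtree_at_append)
  have child: "bag_at T (p @ [i]) = bag (children ?s ! i)" for i
    by (simp add: subtree_at_append)
  have cut: "v \<in> bag ?s \<and> v \<in> bag (children ?s ! i)"
    if i: "i < length (children ?s)" and v: "v \<in> Vset (children ?s ! i)"
      and b: "\<beta> \<in> set (nodes T)" "v \<in> bag_at T \<beta>" "\<And>q. \<beta> \<noteq> p @ i # q" for i v \<beta>
  proof -
    from sub[OF i v] obtain q where q: "p @ i # q \<in> set (nodes T)" "v \<in> bag_at T (p @ i # q)" by blast
    have "v \<in> V" using bags b by blast
    from connected_nodes_cut[OF conn[OF this], of p i q \<beta>] q b child show ?thesis by auto
  qed
  show ?thesis
    unfolding separated_def
  proof (intro conjI allI impI ballI)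
    show "nice_node ?s" by fact
    show "Vset ?s \<subseteq> V"
      unfolding Vset_conv_nodes
    proof (rule UN_least)
      fix q assume "q \<in> set (nodes ?s)"
      then show "bag_at ?s q \<subseteq> V"
        using bags[of "p @ q"] p by (simp add: append_in_nodes subtree_at_append)
    qed
  next
    fix i assume i: "i < length (children ?s)"
    show "Vset (children ?s ! i) \<inter> bag ?s \<subseteq> bag (children ?s ! i)"
      using cut[OF i _ p] by auto
  next
    fix i y x assume i: "i < length (children ?s)" and y: "y \<in> Yset (children ?s ! i)" and e: "{x, y} \<in> E"
    from edges[OF e] obtain \<beta> where b: "\<beta> \<in> set (nodes T)" "{x, y} \<subseteq> bag_at T \<beta>" by blast
    from y have "y \<in> Vset (children ?s ! i)" "y \<notin> bag (children ?s ! i)" by (auto simp: Yset_def)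
    \<comment> \<open>The bag that contains the edge lies below child \<open>i\<close>; otherwise
      \<open>cut\<close> would put \<open>y\<close> into the bag of that child.\<close>
    with cut[OF i this(1) b(1)] b obtain q where "\<beta> = p @ i # q" by blast
    with b Vsub[OF i, of q x] show "x \<in> Vset (children ?s ! i)" by auto
  next
    fix i j assume i: "i < length (children ?s)" and j: "j < length (children ?s)" and ne: "i \<noteq> j"
    show "Vset (children ?s ! i) \<inter> Vset (children ?s ! j) \<subseteq> bag ?s"
    proof safe
      fix v assume v: "v \<in> Vset (children ?s ! i)" "v \<in> Vset (children ?s ! j)"
      from sub[OF j v(2)] obtain q where "p @ j # q \<in> set (nodes T)" "v \<in> bag_at T (p @ j # q)" by blast
      with cut[OF i v(1)] ne show "v \<in> bag ?s" by auto
    qed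
  qed
qed

text \<open>Hypothesis for induction on the tree, with \<open>V\<close> and \<open>E\<close> fixed:
  a subtree need not cover all vertices and edges, but local separation passes to it.\<close>

definition all_separated :: "'v set \<Rightarrow> 'v set set \<Rightarrow> 'v rtree \<Rightarrow> bool" where
  "all_separated V E t \<longleftrightarrow> (\<forall>p\<in>set (nodes t). separated V E (subtree_at t p))"

lemma all_separated_child:
  "all_separated V E (Node X ts) \<Longrightarrow> t \<in> set ts \<Longrightarrow> all_separated V E t"
  unfolding all_separated_def
  by (metis Cons_in_nodes in_set_conv_nth rtree.sel(2) subtree_at.simps(2))

lemma all_separated_root: "all_separated V E t \<Longrightarrow> separated V E t"
  unfolding all_separated_def by (metis Nil_in_nodes subtree_at.simps(1))

lemma all_separated_subtree:
  "all_separated V E T \<Longrightarrow> p \<in> set (nodes T) \<Longrightarrow> all_separated V E (subtree_at T p)"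
  unfolding all_separated_def by (metis append_in_nodes subtree_at_append)

lemma all_separatedI: "nice_tree_decomposition V E T \<Longrightarrow> all_separated V E T"
  by (simp add: all_separated_def separated_nodes)

section \<open>Orientations as sets of arcs without opposite pairs\<close>

lemma edge_pair:
  assumes "simple_graph V E" "e \<in> E" "x \<in> e"
  obtains y where "e = {x, y}" "x \<noteq> y"
proof -
  from assms have "card e = 2" by (auto simp: simple_graph_def)
  with assms(3) that show thesis by (auto simp: card_2_iff)
qed

text \<open>Two distinct arcs over the same edge are opposite to each other, so injectivity says
  that no arc has its opposite in \<open>D\<close>. A loop would be its own opposite, but the edges
  of a simple graph have two ends.\<close>

lemma orientation_iff:
  assumes "simple_graph V E" "F \<subseteq> E"
  shows "orientation F D \<longleftrightarrow> (\<forall>(u, v)\<in>D. {u, v} \<in> F) \<and>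
     (\<forall>u v. {u, v} \<in> F \<longrightarrow> (u, v) \<in> D \<or> (v, u) \<in> D) \<and> (\<forall>u v. (u, v) \<in> D \<longrightarrow> (v, u) \<notin> D)"
    (is "_ \<longleftrightarrow> ?R")
proof
  have ne: "u \<noteq> v" if "{u, v} \<in> F" for u v
    using assms that by (force simp: simple_graph_def)
  {
    assume o: "orientation F D"
    then have inj: "inj_on (\<lambda>(u, v). {u, v}) D" and im: "(\<lambda>(u, v). {u, v}) ` D = F"
      by (auto simp: orientation_def bij_betw_def)
    have 1: "\<forall>(u, v)\<in>D. {u, v} \<in> F" using im by auto
    have 2: "(u, v) \<in> D \<or> (v, u) \<in> D" if "{u, v} \<in> F" for u v
    proof -
      from that im obtain a b where "(a, b) \<in> D" "{a, b} = {u, v}" by (auto simp: image_iff)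
      then show ?thesis by (auto simp: doubleton_eq_iff)
    qed
    have 3: "(v, u) \<notin> D" if "(u, v) \<in> D" for u v
    proof
      assume "(v, u) \<in> D"
      with that inj have "(u, v) = (v, u)" by (auto dest!: inj_onD[of _ _ "(u, v)" "(v, u)"])
      moreover have "u \<noteq> v" using that 1 ne by blast
      ultimately show False by simp
    qed
    show ?R using 1 2 3 by blast
  next
    assume r: ?R
    have "inj_on (\<lambda>(u, v). {u, v}) D"
      using r by (auto simp: inj_on_def doubleton_eq_iff)
    moreover have "(\<lambda>(u, v). {u, v}) ` D = F"
    proof
      show "(\<lambda>(u, v). {u, v}) ` D \<subseteq> F" using r by auto
      show "F \<subseteq> (\<lambda>(u, v). {u, v}) ` D"
      proof
        fix e assume e: "e \<in> F"
        with assms have "card e = 2" by (auto simp: simple_graph_def)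
        then obtain u v where uv: "e = {u, v}" by (auto simp: card_2_iff)
        with r e have "(u, v) \<in> D \<or> (v, u) \<in> D" by blast
        then show "e \<in> (\<lambda>(u, v). {u, v}) ` D" using uv by (force simp: insert_commute)
      qed
    qed
    ultimately show "orientation F D" by (simp add: orientation_def bij_betw_def)
  }
qed

lemma orientation_arc:
  "orientation F D \<Longrightarrow> (u, v) \<in> D \<Longrightarrow> {u, v} \<in> F"
  by (auto simp: orientation_def bij_betw_def)

lemma orientation_restrict:
  assumes "simple_graph V E" "F \<subseteq> E" "orientation F D" "F1 \<subseteq> F"
  shows "orientation F1 {(u, v) \<in> D. {u, v} \<in> F1}"
proof -
  have "F1 \<subseteq> E" using assms by blast
  from assms(3)[unfolded orientation_iff[OF assms(1,2)]] assms(4) show ?thesis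
    unfolding orientation_iff[OF assms(1) \<open>F1 \<subseteq> E\<close>] by (auto simp: insert_commute)
qed

lemma orientation_union:
  assumes "simple_graph V E" "F1 \<subseteq> E" "F2 \<subseteq> E" "F1 \<inter> F2 = {}" "orientation F1 D1" "orientation F2 D2"
  shows "orientation (F1 \<union> F2) (D1 \<union> D2)"
proof -
  have "F1 \<union> F2 \<subseteq> E" using assms by blast
  have "(v, u) \<notin> D2" if "(u, v) \<in> D1" for u v
    using assms(4) orientation_arc[OF assms(5) that] orientation_arc[OF assms(6), of v u] by (auto simp: insert_commute)
  moreover have "(v, u) \<notin> D1" if "(u, v) \<in> D2" for u v
    using assms(4) orientation_arc[OF assms(6) that] orientation_arc[OF assms(5), of v u] by (auto simp: insert_commute)
  ultimately show ?thesis
    using assms(5,6)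
    unfolding orientation_iff[OF assms(1) \<open>F1 \<union> F2 \<subseteq> E\<close>] orientation_iff[OF assms(1,2)] orientation_iff[OF assms(1,3)]
    by blast
qed

text \<open>The parts are recovered by sorting the arcs according to the edges they lie over.
  Splitting the edge set at a node thus splits its orientations.\<close>

lemma orientation_union_iff:
  assumes "simple_graph V E" "F1 \<subseteq> E" "F2 \<subseteq> E" "F1 \<inter> F2 = {}"
  shows "orientation (F1 \<union> F2) D \<longleftrightarrow> (\<exists>D1 D2. orientation F1 D1 \<and> orientation F2 D2 \<and> D = D1 \<union> D2)"
proof
  assume o: "orientation (F1 \<union> F2) D"
  have "F1 \<union> F2 \<subseteq> E" using assms by blast
  note r = orientation_restrict[OF assms(1) this o]
  have "D = {(u, v) \<in> D. {u, v} \<in> F1} \<union> {(u, v) \<in> D. {u, v} \<in> F2}"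
    using orientation_arc[OF o] by auto
  then show "\<exists>D1 D2. orientation F1 D1 \<and> orientation F2 D2 \<and> D = D1 \<union> D2"
    using r[of F1] r[of F2] by blast
qed (use orientation_union[OF assms] in blast)

text \<open>Additivity of degrees needs finite sets of arcs, since \<open>card\<close> of an
  infinite set is 0.\<close>

lemma orientation_finite:
  assumes "simple_graph V E" "F \<subseteq> E" "orientation F D"
  shows "finite {u. (v, u) \<in> D}" "finite {u. (u, v) \<in> D}"
proof -
  have "{u, v} \<subseteq> V" if "(u, v) \<in> D" for u v
    using assms(1,2) orientation_arc[OF assms(3) that] unfolding simple_graph_def by blast
  then have "D \<subseteq> V \<times> V" by auto
  moreover have "finite V" using assms(1) by (simp add: simple_graph_def)
  ultimately have "finite D" by (meson finite_SigmaI rev_finite_subset)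
  have "{u. (v, u) \<in> D} \<subseteq> snd ` D" "{u. (u, v) \<in> D} \<subseteq> fst ` D" by force+
  with \<open>finite D\<close> show "finite {u. (v, u) \<in> D}" "finite {u. (u, v) \<in> D}"
    by (meson finite_imageI rev_finite_subset)+
qed

section \<open>The sets R at the four kinds of nodes\<close>

definition realizes :: "'v set set \<Rightarrow> ('v \<Rightarrow> nat) \<Rightarrow> 'v rtree \<Rightarrow> ('v \<rightharpoonup> nat) \<Rightarrow> nat \<Rightarrow> ('v \<times> 'v) set \<Rightarrow> bool" where
  "realizes E c t d k D \<longleftrightarrow> orientation (Gedges E t) D \<and>
     (\<forall>v\<in>bag t. d v = Some (outdeg D v)) \<and> (\<forall>v\<in>Yset t. indeg D v \<le> c v) \<and>
     card {v \<in> Yset t. indeg D v > 0} \<le> k \<and> k \<le> card (Yset t)"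

lemma in_R_iff: "(d, k) \<in> R E c t \<longleftrightarrow> dom d = bag t \<and> (\<exists>D. realizes E c t d k D)"
  by (simp add: R_def realizes_def)

lemma Gedges_iff: "e \<in> Gedges E t \<longleftrightarrow> e \<in> E \<and> e \<subseteq> Vset t \<and> \<not> e \<subseteq> bag t"
  by (auto simp: Gedges_def induced_edges_def)

lemma Gedges_subset: "Gedges E t \<subseteq> E"
  by (auto simp: Gedges_iff)

lemma R_leaf: "simple_graph V E \<Longrightarrow> R E c (Node {} []) = {(Map.empty, 0)}"
proof -
  assume E: "simple_graph V E"
  have G: "Gedges E (Node {} []) = {}" by (auto simp: Gedges_iff)
  have Y: "Yset (Node {} []) = {}" by (simp add: Yset_def)
  have "orientation {} {}" by (simp add: orientation_def bij_betw_def)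
  then show ?thesis by (auto simp: R_def G Y)
qed

text \<open>An edge from \<open>v\<close> to a vertex of \<open>Yset t1\<close> would lie inside
  \<open>Vset t1\<close>, which does not contain \<open>v\<close>; edges from \<open>v\<close> into
  the bag are excluded from the graph. So \<open>v\<close> is isolated, and neither the edges nor
  \<open>Y\<close> change.\<close>

lemma R_introduce:
  assumes E: "simple_graph V E" and v: "introduces v X (bag t1)" and s: "separated V E (Node X [t1])"
    and d: "dom d = X"
  shows "(d, k) \<in> R E c (Node X [t1]) \<longleftrightarrow> (d |` (- {v}), k) \<in> R E c t1 \<and> d v = Some 0"
proof -
  let ?t = "Node X [t1]"
  from v have X: "X = insert v (bag t1)" "v \<notin> bag t1" by (auto simp: introduces_def)
  from s have nv: "Vset t1 \<inter> X \<subseteq> bag t1" and e: "\<And>y x. y \<in> Yset t1 \<Longrightarrow> {x, y} \<in> E \<Longrightarrow> x \<in> Vset t1"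
    by (auto simp: separated_def)
  have vV: "v \<notin> Vset t1" using nv X by auto
  have V: "Vset ?t = insert v (Vset t1)" using X bag_subset_Vset[of t1] by auto
  have Y: "Yset ?t = Yset t1" unfolding Yset_def V using X vV by auto
  have G: "Gedges E ?t = Gedges E t1"
  proof (intro set_eqI iffI)
    fix a assume a: "a \<in> Gedges E ?t"
    then obtain y where y: "y \<in> a" "y \<notin> X" by (auto simp: Gedges_iff)
    with a have "y \<in> Yset t1" using V X by (auto simp: Gedges_iff Yset_def)
    moreover obtain x where x: "a = {y, x}" using edge_pair[OF E _ y(1)] a by (metis Gedges_iff)
    ultimately have "x \<in> Vset t1" using e[of y x] a by (auto simp: Gedges_iff insert_commute)
    with x y \<open>y \<in> Yset t1\<close> a show "a \<in> Gedges E t1" using X by (auto simp: Gedges_iff Yset_def)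
  next
    fix a assume "a \<in> Gedges E t1"
    then show "a \<in> Gedges E ?t" using X V vV by (auto simp: Gedges_iff)
  qed
  have out: "outdeg D v = 0" if "orientation (Gedges E t1) D" for D
  proof -
    have "{u. (v, u) \<in> D} = {}" using orientation_arc[OF that] vV by (auto simp: Gedges_iff)
    then show ?thesis by (simp add: outdeg_def)
  qed
  have "realizes E c ?t d k D \<longleftrightarrow> realizes E c t1 (d |` (- {v})) k D \<and> d v = Some 0" for D
    unfolding realizes_def G Y using X out[of D] by (auto simp: restrict_map_def)
  then show ?thesis unfolding in_R_iff using d X by auto
qed

text \<open>An entry may overstate the number of vertices with positive in-degree. At a join the
  surplus in \<open>k\<close> has to be divided such that neither part exceeds its own upper
  bound.\<close>

lemma split_between:
  fixes k :: nat
  assumes "a1 + a2 \<le> k" "k \<le> y1 + y2" "a1 \<le> y1" "a2 \<le> y2"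
  shows "\<exists>k1 k2. a1 \<le> k1 \<and> k1 \<le> y1 \<and> a2 \<le> k2 \<and> k2 \<le> y2 \<and> k = k1 + k2"
proof (cases "k \<le> a1 + y2")
  case True
  with assms show ?thesis by (rule_tac exI[of _ a1], rule_tac exI[of _ "k - a1"]) auto
next
  case False
  with assms show ?thesis by (rule_tac exI[of _ "k - y2"], rule_tac exI[of _ y2]) auto
qed

text \<open>Every edge of the graph has an end in \<open>Y\<close>, and the two forgotten parts are
  disjoint, so each edge belongs to exactly one child. Out-degrees on the bag add up, while the
  in-degree of a vertex in \<open>Y\<close> comes from one child alone.\<close>

lemma R_join:
  assumes E: "simple_graph V E" and X: "bag t1 = X" "bag t2 = X" and s: "separated V E (Node X [t1, t2])"
    and d: "dom d = X"
  shows "(d, k) \<in> R E c (Node X [t1, t2]) \<longleftrightarrow>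
    (\<exists>(d1, k1) \<in> R E c t1. \<exists>(d2, k2) \<in> R E c t2.
        (\<forall>u\<in>X. the (d u) = the (d1 u) + the (d2 u)) \<and> k = k1 + k2)" (is "?L \<longleftrightarrow> ?R")
proof -
  let ?t = "Node X [t1, t2]"
  have c: "Vset (children ?t ! 0) = Vset t1" "Vset (children ?t ! 1) = Vset t2" by simp_all
  from s have e1: "\<And>y x. y \<in> Yset t1 \<Longrightarrow> {x, y} \<in> E \<Longrightarrow> x \<in> Vset t1"
    and e2: "\<And>y x. y \<in> Yset t2 \<Longrightarrow> {x, y} \<in> E \<Longrightarrow> x \<in> Vset t2"
    and VV: "Vset t1 \<inter> Vset t2 \<subseteq> X" and "Vset ?t \<subseteq> V"
    by (auto simp: separated_def less_Suc_eq)
  have V: "Vset ?t = Vset t1 \<union> Vset t2" using X bag_subset_Vset[of t1] by auto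
  have Y: "Yset ?t = Yset t1 \<union> Yset t2" unfolding Yset_def V using X by auto
  have Yd: "Yset t1 \<inter> Yset t2 = {}" using VV X by (auto simp: Yset_def)
  have fin: "finite (Yset t1)" "finite (Yset t2)"
    using \<open>Vset ?t \<subseteq> V\<close> E V by (auto simp: Yset_def simple_graph_def intro: finite_subset)
  let ?F1 = "Gedges E t1" and ?F2 = "Gedges E t2"
  have G: "Gedges E ?t = ?F1 \<union> ?F2"
  proof (intro set_eqI iffI)
    fix a assume a: "a \<in> Gedges E ?t"
    then obtain y where y: "y \<in> a" "y \<notin> X" by (auto simp: Gedges_iff)
    obtain x where x: "a = {y, x}" using edge_pair[OF E _ y(1)] a by (metis Gedges_iff)
    have aE: "{x, y} \<in> E" using a x by (auto simp: Gedges_iff insert_commute)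
    from a y have "y \<in> Yset t1 \<or> y \<in> Yset t2" using V X by (auto simp: Gedges_iff Yset_def)
    then show "a \<in> ?F1 \<union> ?F2"
    proof
      assume "y \<in> Yset t1"
      with e1[OF this aE] x aE show ?thesis by (auto simp: Gedges_iff Yset_def insert_commute)
    next
      assume "y \<in> Yset t2"
      with e2[OF this aE] x aE show ?thesis by (auto simp: Gedges_iff Yset_def insert_commute)
    qed
  next
    fix a assume "a \<in> ?F1 \<union> ?F2"
    then show "a \<in> Gedges E ?t" using X V by (auto simp: Gedges_iff)
  qed
  have "a \<subseteq> X" if "a \<in> ?F1" "a \<in> ?F2" for a
    using that VV unfolding Gedges_iff by blast
  moreover have "\<not> a \<subseteq> X" if "a \<in> ?F1" for a
    using that X by (simp add: Gedges_iff)
  ultimately have Fd: "?F1 \<inter> ?F2 = {}" by blast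
  note sub = Gedges_subset[of E t1] Gedges_subset[of E t2]
  have deg: "u \<in> X \<Longrightarrow> outdeg (D1 \<union> D2) u = outdeg D1 u + outdeg D2 u"
     "y \<in> Yset t1 \<Longrightarrow> indeg (D1 \<union> D2) y = indeg D1 y" "y \<in> Yset t2 \<Longrightarrow> indeg (D1 \<union> D2) y = indeg D2 y"
    if o: "orientation ?F1 D1" "orientation ?F2 D2" for D1 D2 u y
  proof -
    note f = orientation_finite[OF E sub(1) o(1)] orientation_finite[OF E sub(2) o(2)]
    have "{w. (u, w) \<in> D1 \<union> D2} = {w. (u, w) \<in> D1} \<union> {w. (u, w) \<in> D2}" by auto
    moreover have "{w. (u, w) \<in> D1} \<inter> {w. (u, w) \<in> D2} = {}"
      using orientation_arc[OF o(1)] orientation_arc[OF o(2)] Fd by blast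
    ultimately show "outdeg (D1 \<union> D2) u = outdeg D1 u + outdeg D2 u"
      unfolding outdeg_def using f by (simp add: card_Un_disjoint)
    show "indeg (D1 \<union> D2) y = indeg D1 y" if "y \<in> Yset t1"
    proof -
      have "(w, y) \<notin> D2" for w
        using orientation_arc[OF o(2), of w y] that VV X by (auto simp: Gedges_iff Yset_def)
      then show ?thesis by (simp add: indeg_def)
    qed
    show "indeg (D1 \<union> D2) y = indeg D2 y" if "y \<in> Yset t2"
    proof -
      have "(w, y) \<notin> D1" for w
        using orientation_arc[OF o(1), of w y] that VV X by (auto simp: Gedges_iff Yset_def)
      then show ?thesis by (simp add: indeg_def)
    qed
  qed
  have act: "card {v \<in> Yset ?t. 0 < indeg (D1 \<union> D2) v} =
      card {v \<in> Yset t1. 0 < indeg D1 v} + card {v \<in> Yset t2. 0 < indeg D2 v}"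
    if o: "orientation ?F1 D1" "orientation ?F2 D2" for D1 D2
  proof -
    have "{v \<in> Yset ?t. 0 < indeg (D1 \<union> D2) v} =
       {v \<in> Yset t1. 0 < indeg D1 v} \<union> {v \<in> Yset t2. 0 < indeg D2 v}"
      unfolding Y using deg(2,3)[OF o] by auto
    moreover have "{v \<in> Yset t1. 0 < indeg D1 v} \<inter> {v \<in> Yset t2. 0 < indeg D2 v} = {}" using Yd by auto
    ultimately show ?thesis using fin by (simp add: card_Un_disjoint)
  qed
  have cY: "card (Yset ?t) = card (Yset t1) + card (Yset t2)"
    unfolding Y using fin Yd by (simp add: card_Un_disjoint)
  show ?thesis
  proof
    assume ?L
    then obtain D where D: "realizes E c ?t d k D" by (auto simp: in_R_iff)
    then obtain D1 D2 where o: "orientation ?F1 D1" "orientation ?F2 D2" and DD: "D = D1 \<union> D2"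
      unfolding realizes_def G orientation_union_iff[OF E sub Fd] by blast
    define a1 where "a1 = card {v \<in> Yset t1. 0 < indeg D1 v}"
    define a2 where "a2 = card {v \<in> Yset t2. 0 < indeg D2 v}"
    have a: "a1 \<le> card (Yset t1)" "a2 \<le> card (Yset t2)"
      unfolding a1_def a2_def using fin by (auto intro!: card_mono)
    have k: "a1 + a2 \<le> k" "k \<le> card (Yset t1) + card (Yset t2)"
      using D act[OF o] cY by (auto simp: realizes_def DD a1_def a2_def)
    obtain k1 k2 where kk: "a1 \<le> k1" "k1 \<le> card (Yset t1)" "a2 \<le> k2" "k2 \<le> card (Yset t2)" "k = k1 + k2"
      using split_between[OF k(1) k(2) a] by blast
    define d1 where "d1 u = (if u \<in> X then Some (outdeg D1 u) else None)" for u
    define d2 where "d2 u = (if u \<in> X then Some (outdeg D2 u) else None)" for u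
    have cD: "\<forall>v\<in>Yset t1 \<union> Yset t2. indeg (D1 \<union> D2) v \<le> c v" using D by (simp add: realizes_def Y DD)
    have "(d1, k1) \<in> R E c t1"
      unfolding in_R_iff realizes_def
    proof (intro conjI exI[of _ D1])
      show "dom d1 = bag t1" by (simp add: X dom_def d1_def)
      show "\<forall>v\<in>Yset t1. indeg D1 v \<le> c v" using cD deg(2)[OF o] by (metis UnI1)
      show "orientation ?F1 D1" by (rule o(1))
      show "\<forall>v\<in>bag t1. d1 v = Some (outdeg D1 v)" using X by (simp add: d1_def)
      show "card {v \<in> Yset t1. 0 < indeg D1 v} \<le> k1" "k1 \<le> card (Yset t1)"
        using kk by (simp_all only: a1_def)
    qed
    moreover have "(d2, k2) \<in> R E c t2"
      unfolding in_R_iff realizes_def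
    proof (intro conjI exI[of _ D2])
      show "dom d2 = bag t2" by (simp add: X dom_def d2_def)
      show "\<forall>v\<in>Yset t2. indeg D2 v \<le> c v" using cD deg(3)[OF o] by (metis UnI2)
      show "orientation ?F2 D2" by (rule o(2))
      show "\<forall>v\<in>bag t2. d2 v = Some (outdeg D2 v)" using X by (simp add: d2_def)
      show "card {v \<in> Yset t2. 0 < indeg D2 v} \<le> k2" "k2 \<le> card (Yset t2)"
        using kk by (simp_all only: a2_def)
    qed
    moreover have "\<forall>u\<in>X. the (d u) = the (d1 u) + the (d2 u)"
      using D deg(1)[OF o] by (auto simp: realizes_def DD d1_def d2_def)
    ultimately show ?R using kk(5) by blast
  next
    assume ?R
    then obtain d1 k1 d2 k2 where r: "(d1, k1) \<in> R E c t1" "(d2, k2) \<in> R E c t2"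
      and du: "\<forall>u\<in>X. the (d u) = the (d1 u) + the (d2 u)" and k: "k = k1 + k2" by blast
    from r obtain D1 D2 where D: "realizes E c t1 d1 k1 D1" "realizes E c t2 d2 k2 D2"
      by (auto simp: in_R_iff)
    then have o: "orientation ?F1 D1" "orientation ?F2 D2" by (auto simp: realizes_def)
    have "realizes E c ?t d k (D1 \<union> D2)"
      unfolding realizes_def
    proof (intro conjI ballI)
      show "orientation (Gedges E ?t) (D1 \<union> D2)" unfolding G by (rule orientation_union[OF E sub Fd o])
      show "d v = Some (outdeg (D1 \<union> D2) v)" if "v \<in> bag ?t" for v
      proof -
        have v: "v \<in> X" using that by simp
        then obtain z where "d v = Some z" using d by auto
        with du v D X deg(1)[OF o v] show ?thesis by (auto simp: realizes_def)
      qed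
      show "indeg (D1 \<union> D2) v \<le> c v" if "v \<in> Yset ?t" for v
        using that D deg(2,3)[OF o] unfolding Y by (auto simp: realizes_def)
      show "card {v \<in> Yset ?t. 0 < indeg (D1 \<union> D2) v} \<le> k" "k \<le> card (Yset ?t)"
        unfolding act[OF o] cY k using D by (auto simp: realizes_def)
    qed
    then show ?L using d by (auto simp: in_R_iff)
  qed
qed

lemma neighbours_subset: "simple_graph V E \<Longrightarrow> neighbours E v \<subseteq> V - {v}"
  by (force simp: neighbours_def simple_graph_def)

text \<open>The edges between \<open>v\<close> and its neighbours in \<open>X\<close> enter the
  graph here; those between \<open>v\<close> and \<open>Y\<close> were present in the child. With
  \<Delta> the neighbours whose new edge points to \<open>v\<close>, the in-degree of
  \<open>v\<close> is |N(v) \<inter> Y| minus its out-degree in the child plus |\<Delta>|. This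
  turns the interval for \<open>A\<close> into the capacity condition.\<close>

lemma R_forget:
  assumes E: "simple_graph V E" and v: "forgets v X (bag t1)" and s: "separated V E (Node X [t1])"
    and d: "dom d = X"
  shows "(d, k) \<in> R E c (Node X [t1]) \<longleftrightarrow>
    (\<exists>(d1, k1) \<in> R E c t1. forget_rule E c (Node X [t1]) v (bag t1) d k d1 k1)" (is "?L \<longleftrightarrow> ?R")
proof -
  let ?t = "Node X [t1]"
  from v have X: "bag t1 = insert v X" "v \<notin> X" by (auto simp: forgets_def)
  have V: "Vset ?t = Vset t1" using X bag_subset_Vset[of t1] by auto
  have Y: "Yset ?t = insert v (Yset t1)" unfolding Yset_def V using X bag_subset_Vset[of t1] by auto
  have vY: "v \<notin> Yset t1" using X by (auto simp: Yset_def)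
  have VV: "Vset t1 \<subseteq> V" using s by (simp only: separated_def V)
  have fin: "finite (Yset t1)" "finite V"
    using VV E by (auto simp: Yset_def simple_graph_def intro: finite_subset)
  let ?N = "neighbours E v" and ?F1 = "Gedges E t1"
  define S where "S = {{u, v} | u. u \<in> ?N \<inter> X}"
  note NV = neighbours_subset[OF E, of v]
  have finN: "finite ?N" using NV fin by (meson finite_Diff finite_subset)
  have NY: "?N \<inter> Yset ?t = ?N \<inter> Yset t1" unfolding Y using NV by auto
  have SE: "S \<subseteq> E" by (auto simp: S_def neighbours_def)
  note sub = Gedges_subset[of E t1]
  have G: "Gedges E ?t = ?F1 \<union> S"
  proof (intro set_eqI iffI)
    fix a assume a: "a \<in> Gedges E ?t"
    show "a \<in> ?F1 \<union> S"
    proof (cases "a \<subseteq> bag t1")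
      case True
      with a X have va: "v \<in> a" by (auto simp: Gedges_iff)
      obtain u where u: "a = {v, u}" "v \<noteq> u" using edge_pair[OF E _ va] a by (metis Gedges_iff)
      with True X a have "u \<in> ?N \<inter> X" by (auto simp: Gedges_iff neighbours_def insert_commute)
      then have "a \<in> S" unfolding S_def using u by (auto simp: insert_commute)
      then show ?thesis by blast
    next
      case False
      with a V show ?thesis by (auto simp: Gedges_iff)
    qed
  next
    fix a assume "a \<in> ?F1 \<union> S"
    then show "a \<in> Gedges E ?t"
    proof
      assume "a \<in> ?F1"
      then show ?thesis using X V by (auto simp: Gedges_iff)
    next
      assume "a \<in> S"
      then obtain u where "a = {u, v}" "u \<in> ?N" "u \<in> X" by (auto simp: S_def)
      then show ?thesis using X V bag_subset_Vset[of t1] by (auto simp: Gedges_iff neighbours_def)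
    qed
  qed
  have Fd: "?F1 \<inter> S = {}" using X by (auto simp: S_def Gedges_iff)
  have DSo: "orientation S D \<longleftrightarrow> (\<exists>\<Delta> \<subseteq> ?N \<inter> X. D = (\<lambda>u. (u, v)) ` \<Delta> \<union> (\<lambda>u. (v, u)) ` (?N \<inter> X - \<Delta>))" for D
  proof
    assume o: "orientation S D"
    note o' = o[unfolded orientation_iff[OF E SE]]
    have arc: "a = v \<and> b \<in> ?N \<inter> X \<or> b = v \<and> a \<in> ?N \<inter> X" if "(a, b) \<in> D" for a b
      using orientation_arc[OF o that] by (auto simp: S_def doubleton_eq_iff)
    have ex: "(u, v) \<in> D \<or> (v, u) \<in> D" if "u \<in> ?N \<inter> X" for u
    proof -
      have "{u, v} \<in> S" using that by (auto simp: S_def)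
      with o' show ?thesis by blast
    qed
    have ne: "(v, u) \<notin> D" if "(u, v) \<in> D" for u using o' that by blast
    have "{u \<in> ?N \<inter> X. (u, v) \<in> D} \<subseteq> ?N \<inter> X" by auto
    moreover have "D = (\<lambda>u. (u, v)) ` {u \<in> ?N \<inter> X. (u, v) \<in> D} \<union>
        (\<lambda>u. (v, u)) ` (?N \<inter> X - {u \<in> ?N \<inter> X. (u, v) \<in> D})"
    proof (intro set_eqI iffI)
      fix e assume "e \<in> D"
      then obtain a b where e: "e = (a, b)" "(a, b) \<in> D" by (cases e) auto
      from arc[OF e(2)] show "e \<in> (\<lambda>u. (u, v)) ` {u \<in> ?N \<inter> X. (u, v) \<in> D} \<union>
        (\<lambda>u. (v, u)) ` (?N \<inter> X - {u \<in> ?N \<inter> X. (u, v) \<in> D})"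
        using e ne by blast
    next
      fix e assume "e \<in> (\<lambda>u. (u, v)) ` {u \<in> ?N \<inter> X. (u, v) \<in> D} \<union>
        (\<lambda>u. (v, u)) ` (?N \<inter> X - {u \<in> ?N \<inter> X. (u, v) \<in> D})"
      then show "e \<in> D" using ex by blast
    qed
    ultimately show "\<exists>\<Delta> \<subseteq> ?N \<inter> X. D = (\<lambda>u. (u, v)) ` \<Delta> \<union> (\<lambda>u. (v, u)) ` (?N \<inter> X - \<Delta>)" by blast
  next
    assume "\<exists>\<Delta> \<subseteq> ?N \<inter> X. D = (\<lambda>u. (u, v)) ` \<Delta> \<union> (\<lambda>u. (v, u)) ` (?N \<inter> X - \<Delta>)"
    then obtain \<Delta> where "\<Delta> \<subseteq> ?N \<inter> X" "D = (\<lambda>u. (u, v)) ` \<Delta> \<union> (\<lambda>u. (v, u)) ` (?N \<inter> X - \<Delta>)" by blast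
    then show "orientation S D"
      unfolding orientation_iff[OF E SE] using X(2)
      by (auto simp: S_def doubleton_eq_iff)
  qed
  define ext where "ext D1 \<Delta> = D1 \<union> ((\<lambda>u. (u, v)) ` \<Delta> \<union> (\<lambda>u. (v, u)) ` (?N \<inter> X - \<Delta>))" for D1 \<Delta>
  have Do: "orientation (Gedges E ?t) D \<longleftrightarrow> (\<exists>D1. orientation ?F1 D1 \<and> (\<exists>\<Delta> \<subseteq> ?N \<inter> X. D = ext D1 \<Delta>))" for D
    unfolding G orientation_union_iff[OF E sub SE Fd] DSo ext_def by blast
  \<comment> \<open>The last equation holds because in the child's graph every edge at
    \<open>v\<close> leads to \<open>Yset t1\<close>: edges inside the child's bag are left
    out.\<close>
  have deg: "u \<in> X \<Longrightarrow> outdeg (ext D1 \<Delta>) u = outdeg D1 u + (if u \<in> \<Delta> then 1 else 0)"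
     "y \<in> Yset t1 \<Longrightarrow> indeg (ext D1 \<Delta>) y = indeg D1 y"
     "indeg (ext D1 \<Delta>) v = indeg D1 v + card \<Delta>"
     "outdeg D1 v + indeg D1 v = card (?N \<inter> Yset t1)"
    if o: "orientation ?F1 D1" and D: "\<Delta> \<subseteq> ?N \<inter> X" for D1 \<Delta> u y
  proof -
    note f = orientation_finite[OF E sub(1) o(1)]
    have arcY: "w \<in> Yset t1" if "(w, v) \<in> D1 \<or> (v, w) \<in> D1" for w
      using that orientation_arc[OF o, of w v] orientation_arc[OF o, of v w] X bag_subset_Vset[of t1]
      by (auto simp: Gedges_iff Yset_def)
    show "outdeg (ext D1 \<Delta>) u = outdeg D1 u + (if u \<in> \<Delta> then 1 else 0)" if u: "u \<in> X"
    proof -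
      have "u \<noteq> v" "u \<notin> Yset t1" using u X by (auto simp: Yset_def)
      then have "{w. (u, w) \<in> ext D1 \<Delta>} = {w. (u, w) \<in> D1} \<union> (if u \<in> \<Delta> then {v} else {})" "(u, v) \<notin> D1"
        using arcY by (auto simp: ext_def)
      then show ?thesis using f(1)[of u] by (simp add: outdeg_def)
    qed
    show "indeg (ext D1 \<Delta>) y = indeg D1 y" if y: "y \<in> Yset t1"
    proof -
      have "y \<noteq> v" "y \<notin> X" using y X vY by (auto simp: Yset_def)
      then have "{w. (w, y) \<in> ext D1 \<Delta>} = {w. (w, y) \<in> D1}"
        using D by (auto simp: ext_def)
      then show ?thesis by (simp add: indeg_def)
    qed
    have "{w. (w, v) \<in> ext D1 \<Delta>} = {w. (w, v) \<in> D1} \<union> \<Delta>"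
      using D X(2) by (auto simp: ext_def)
    moreover have "{w. (w, v) \<in> D1} \<inter> \<Delta> = {}" using arcY D X by (auto simp: Yset_def)
    moreover have "finite \<Delta>" using D finN by (meson finite_Int finite_subset)
    ultimately show "indeg (ext D1 \<Delta>) v = indeg D1 v + card \<Delta>"
      using f(2)[of v] by (simp add: indeg_def card_Un_disjoint)
    note o' = o[unfolded orientation_iff[OF E sub]]
    have "?N \<inter> Yset t1 = {w. (v, w) \<in> D1} \<union> {w. (w, v) \<in> D1}"
    proof (intro set_eqI iffI)
      fix w assume w: "w \<in> ?N \<inter> Yset t1"
      then have "{w, v} \<in> ?F1" using X bag_subset_Vset[of t1] by (auto simp: neighbours_def Gedges_iff Yset_def)
      with o' show "w \<in> {w. (v, w) \<in> D1} \<union> {w. (w, v) \<in> D1}" by blast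
    next
      fix w assume w: "w \<in> {w. (v, w) \<in> D1} \<union> {w. (w, v) \<in> D1}"
      with arcY have "w \<in> Yset t1" by blast
      moreover have "{w, v} \<in> E"
        using w orientation_arc[OF o, of w v] orientation_arc[OF o, of v w] by (auto simp: Gedges_iff insert_commute)
      ultimately show "w \<in> ?N \<inter> Yset t1" by (simp add: neighbours_def)
    qed
    moreover have "{w. (v, w) \<in> D1} \<inter> {w. (w, v) \<in> D1} = {}" using o' by blast
    ultimately show "outdeg D1 v + indeg D1 v = card (?N \<inter> Yset t1)"
      using f by (simp add: outdeg_def indeg_def card_Un_disjoint)
  qed
  have cY: "card (Yset ?t) = Suc (card (Yset t1))" unfolding Y using fin vY by simp
  have act: "card {y \<in> Yset ?t. 0 < indeg (ext D1 \<Delta>) y} =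
      card {y \<in> Yset t1. 0 < indeg D1 y} + (if 0 < indeg (ext D1 \<Delta>) v then 1 else 0)"
    if o: "orientation ?F1 D1" and D: "\<Delta> \<subseteq> ?N \<inter> X" for D1 \<Delta>
  proof -
    have "{y \<in> Yset ?t. 0 < indeg (ext D1 \<Delta>) y} =
       {y \<in> Yset t1. 0 < indeg D1 y} \<union> (if 0 < indeg (ext D1 \<Delta>) v then {v} else {})"
      unfolding Y using deg(2)[OF o D] by auto
    then show ?thesis using fin vY by simp
  qed
  show ?thesis
  proof
    assume ?L
    then obtain D where D: "realizes E c ?t d k D" by (auto simp: in_R_iff)
    then obtain D1 \<Delta> where o: "orientation ?F1 D1" and Dl: "\<Delta> \<subseteq> ?N \<inter> X" and DD: "D = ext D1 \<Delta>"
      unfolding realizes_def Do by blast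
    note dg = deg[OF o Dl]
    define a where "a = card {y \<in> Yset t1. 0 < indeg D1 y}"
    have a: "a \<le> card (Yset t1)" unfolding a_def using fin by (auto intro!: card_mono)
    have k: "a + (if 0 < indeg D v then 1 else 0) \<le> k" "k \<le> Suc (card (Yset t1))"
      using D act[OF o Dl] cY by (auto simp: realizes_def DD a_def)
    define d1 where "d1 u = (if u \<in> bag t1 then Some (outdeg D1 u) else None)" for u
    have cD: "\<forall>y\<in>insert v (Yset t1). indeg (ext D1 \<Delta>) y \<le> c y"
      using D unfolding realizes_def Y DD by blast
    have r1: "(d1, k1) \<in> R E c t1" if "a \<le> k1" "k1 \<le> card (Yset t1)" for k1
      unfolding in_R_iff realizes_def
    proof (intro conjI exI[of _ D1])
      show "dom d1 = bag t1" by (simp add: dom_def d1_def)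
      show "\<forall>v\<in>Yset t1. indeg D1 v \<le> c v" using cD dg(2) by (metis insertI2)
      show "orientation ?F1 D1" by (rule o)
      show "\<forall>v\<in>bag t1. d1 v = Some (outdeg D1 v)" by (simp add: d1_def)
      show "card {v \<in> Yset t1. 0 < indeg D1 v} \<le> k1" "k1 \<le> card (Yset t1)"
        using that by (simp_all only: a_def)
    qed
    have du: "d u = Some (outdeg D1 u + (if u \<in> \<Delta> then 1 else 0))" if "u \<in> X" for u
      using D dg(1)[OF that] that by (auto simp: realizes_def DD)
    have vX: "v \<in> bag t1" using X by simp
    show ?R
    \<comment> \<open>Alternative (i) needs more than in-degree 0: if \<open>k\<close> is
      \<open>Suc (card (Yset t1))\<close>, the child has no entry with this \<open>k\<close>, and
      alternative (ii) with \<open>k - 1\<close> applies although \<open>v\<close> receives no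
      arc.\<close>
    proof (cases "indeg D v = 0 \<and> k \<le> card (Yset t1)")
      case True
      have "card \<Delta> = 0" "indeg D1 v = 0" using True dg(3) by (auto simp: DD)
      moreover have "finite \<Delta>" using Dl finN by (meson finite_Int finite_subset)
      ultimately have "\<Delta> = {}" by simp
      have "d1 |` (- {v}) = d"
      proof
        fix u show "(d1 |` (- {v})) u = d u"
          using du[of u] \<open>\<Delta> = {}\<close> X d by (cases "u \<in> X") (auto simp: d1_def restrict_map_def)
      qed
      then have "forget_rule E c ?t v (bag t1) d k d1 k"
        unfolding forget_rule_def NY using dg(4) \<open>indeg D1 v = 0\<close> vX by (simp add: d1_def)
      then show ?thesis using r1[of k] k True by auto
    next
      case False
      have k1: "a \<le> k - 1" "k - 1 \<le> card (Yset t1)" "k \<ge> 1" using False k a by auto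
      have "indeg D v \<le> c v" using D by (auto simp: realizes_def Y)
      then have "int (card (?N \<inter> Yset t1)) - int (c v) + int (card \<Delta>) \<le> int (outdeg D1 v)"
        "int (outdeg D1 v) \<le> int (card (?N \<inter> Yset t1))"
        using dg(3,4) by (auto simp: DD)
      moreover have "\<forall>u\<in>\<Delta>. int (the (d1 u)) = int (the (d u)) - 1"
        using Dl du X by (auto simp: d1_def)
      moreover have "\<forall>u\<in>bag t1 - (\<Delta> \<union> {v}). the (d1 u) = the (d u)"
        using du X by (auto simp: d1_def)
      ultimately have "forget_rule E c ?t v (bag t1) d k d1 (k - 1)"
        unfolding forget_rule_def NY using k1(3) Dl vX
        by (intro disjI2 conjI exI[of _ \<Delta>] exI[of _ "int (outdeg D1 v)"]) (auto simp: d1_def)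
      then show ?thesis using r1[OF k1(1,2)] by auto
    qed
  next
    assume ?R
    then obtain d1 k1 where r: "(d1, k1) \<in> R E c t1" and f: "forget_rule E c ?t v (bag t1) d k d1 k1" by blast
    from r obtain D1 where D1: "realizes E c t1 d1 k1 D1" and dom1: "dom d1 = bag t1" by (auto simp: in_R_iff)
    then have o: "orientation ?F1 D1" by (auto simp: realizes_def)
    have d1: "d1 u = Some (outdeg D1 u)" if "u \<in> bag t1" for u using D1 that by (auto simp: realizes_def)
    \<comment> \<open>Both alternatives in one form. In (i) all edges from \<open>v\<close> to
      \<open>Y\<close> point away from \<open>v\<close>, so with \<Delta> empty the in-degree is 0;
      (ii) leaves a surplus of one in \<open>k\<close> if \<open>v\<close> turns out to have
      in-degree 0.\<close>
    have "\<exists>\<Delta> \<subseteq> ?N \<inter> X. indeg (ext D1 \<Delta>) v \<le> c v \<and> (\<forall>u\<in>X. d u = Some (outdeg (ext D1 \<Delta>) u)) \<and>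
       k1 + (if 0 < indeg (ext D1 \<Delta>) v then 1 else 0) \<le> k \<and> k \<le> Suc k1"
      using f unfolding forget_rule_def NY
    proof (elim disjE conjE exE)
      assume k: "k1 = k" and dv: "d1 v = Some (card (?N \<inter> Yset t1))" and dd: "d1 |` (- {v}) = d"
      have e: "{} \<subseteq> ?N \<inter> X" by simp
      have "indeg (ext D1 {}) v = 0" using deg(3,4)[OF o e] dv d1[of v] X by simp
      moreover have "d u = Some (outdeg (ext D1 {}) u)" if "u \<in> X" for u
        using deg(1)[OF o e that] d1[of u] that X dd[symmetric] by (auto simp: restrict_map_def)
      ultimately show ?thesis using k by (intro exI[of _ "{}"]) auto
    next
      fix \<Delta> A
      assume k: "int k1 = int k - 1" and Dl: "\<Delta> \<subseteq> ?N \<inter> bag ?t"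
        and A: "A \<in> {int (card (?N \<inter> Yset t1)) - int (c v) + int (card \<Delta>)..int (card (?N \<inter> Yset t1))}"
        and dv: "int (the (d1 v)) = A"
        and u1: "\<forall>u\<in>\<Delta>. int (the (d1 u)) = int (the (d u)) - 1"
        and u2: "\<forall>u\<in>bag t1 - (\<Delta> \<union> {v}). the (d1 u) = the (d u)"
      have Dl': "\<Delta> \<subseteq> ?N \<inter> X" using Dl by simp
      have "indeg (ext D1 \<Delta>) v \<le> c v" using deg(3,4)[OF o Dl'] dv d1[of v] X A by auto
      moreover have "d u = Some (outdeg (ext D1 \<Delta>) u)" if u: "u \<in> X" for u
      proof -
        from u d obtain z where z: "d u = Some z" by auto
        have "u \<noteq> v" "u \<in> bag t1" using u X by auto
        with z u1 u2 d1[of u] deg(1)[OF o Dl' u] show ?thesis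
          by (cases "u \<in> \<Delta>") force+
      qed
      moreover have "k = Suc k1" using k by simp
      ultimately show ?thesis using Dl' by (intro exI[of _ \<Delta>]) auto
    qed
    then obtain \<Delta> where Dl: "\<Delta> \<subseteq> ?N \<inter> X" and *: "indeg (ext D1 \<Delta>) v \<le> c v"
      "\<forall>u\<in>X. d u = Some (outdeg (ext D1 \<Delta>) u)"
      "k1 + (if 0 < indeg (ext D1 \<Delta>) v then 1 else 0) \<le> k" "k \<le> Suc k1" by blast
    have "realizes E c ?t d k (ext D1 \<Delta>)"
      unfolding realizes_def Do act[OF o Dl] cY
    proof (intro conjI ballI)
      show "\<exists>D. orientation ?F1 D \<and> (\<exists>\<Delta>'\<subseteq>?N \<inter> X. ext D1 \<Delta> = ext D \<Delta>')" using o Dl by blast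
      show "indeg (ext D1 \<Delta>) y \<le> c y" if "y \<in> Yset ?t" for y
        using that D1 deg(2)[OF o Dl] * unfolding Y by (auto simp: realizes_def)
    qed (use D1 * in \<open>auto simp: realizes_def\<close>)
    then show ?L using d by (auto simp: in_R_iff)
  qed
qed

lemma R_dom: "(d, k) \<in> R E c t \<Longrightarrow> dom d = bag t"
  by (simp add: in_R_iff)

text \<open>At a unary node the two bags determine whether a vertex is introduced or forgotten, and
  which one, so the existential quantifiers of \<open>R'\<close> leave a single rule, to which the
  lemma for this kind of node applies.\<close>

lemma R'_eq_R:
  assumes E: "simple_graph V E"
  shows "all_separated V E t \<Longrightarrow> R' E c t = R E c t"
proof (induction t)
  case (Node X ts)
  note sep = all_separated_root[OF Node.prems]
  have IH: "R' E c s = R E c s" if "s \<in> set ts" for s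
    using Node.IH[OF that] all_separated_child[OF Node.prems that] by simp
  have nice: "nice_node (Node X ts)" using sep by (simp add: separated_def)
  consider "ts = []" | t1 where "ts = [t1]" | t1 t2 where "ts = [t1, t2]" | t1 t2 t3 us where "ts = t1 # t2 # t3 # us"
    by (metis list.exhaust)
  then show ?case
  proof cases
    case 1
    with nice show ?thesis using R_leaf[OF E] by simp
  next
    case 2
    have "(d, k) \<in> R' E c (Node X [t1]) \<longleftrightarrow> (d, k) \<in> R E c (Node X [t1])" for d k
    proof (cases "dom d = X")
      case True
      from nice 2 obtain v where "introduces v X (bag t1) \<or> forgets v X (bag t1)" by auto
      then show ?thesis
      proof
        assume v: "introduces v X (bag t1)"
        then have "introduces v' X (bag t1) \<longleftrightarrow> v' = v" "\<not> forgets v' X (bag t1)" for v'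
          by (auto simp: introduces_def forgets_def)
        then show ?thesis
          using R_introduce[OF E v sep[unfolded 2] True] IH[of t1] 2 True by simp
      next
        assume v: "forgets v X (bag t1)"
        then have "forgets v' X (bag t1) \<longleftrightarrow> v' = v" "\<not> introduces v' X (bag t1)" for v'
          by (auto simp: introduces_def forgets_def)
        then show ?thesis
          using R_forget[OF E v sep[unfolded 2] True] IH[of t1] 2 True by simp
      qed
    next
      case False
      then show ?thesis using R_dom[of d k E c "Node X [t1]"] by auto
    qed
    then show ?thesis using 2 by auto
  next
    case 3
    with nice have X: "bag t1 = X" "bag t2 = X" by auto
    have "(d, k) \<in> R' E c (Node X [t1, t2]) \<longleftrightarrow> (d, k) \<in> R E c (Node X [t1, t2])" for d k
    proof (cases "dom d = X")
      case True
      then show ?thesis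
        using R_join[OF E X sep[unfolded 3] True] IH[of t1] IH[of t2] 3 by simp
    next
      case False
      then show ?thesis using R_dom[of d k E c "Node X [t1, t2]"] by auto
    qed
    then show ?thesis using 3 by auto
  next
    case 4
    with nice show ?thesis by simp
  qed
qed

section \<open>The program\<close>

text \<open>Positions in \<open>prog\<close>, used as first argument of \<open>CallE\<close>.
  Position 1 is written \<open>Suc 0\<close>, the form into which the simplifier brings it.\<close>

abbreviation (input) f_main :: nat where "f_main \<equiv> 0"
abbreviation (input) f_len :: nat where "f_len \<equiv> Suc 0"
abbreviation (input) f_add :: nat where "f_add \<equiv> 2"
abbreviation (input) f_mul :: nat where "f_mul \<equiv> 3"
abbreviation (input) f_nonzero :: nat where "f_nonzero \<equiv> 4"
abbreviation (input) f_aadd :: nat where "f_aadd \<equiv> 5"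
abbreviation (input) f_scale :: nat where "f_scale \<equiv> 6"
abbreviation (input) f_outer :: nat where "f_outer \<equiv> 7"
abbreviation (input) f_comb :: nat where "f_comb \<equiv> 8"
abbreviation (input) f_conv :: nat where "f_conv \<equiv> 9"
abbreviation (input) f_convl :: nat where "f_convl \<equiv> 10"
abbreviation (input) f_rep :: nat where "f_rep \<equiv> 11"
abbreviation (input) f_zeros :: nat where "f_zeros \<equiv> 12"
abbreviation (input) f_set :: nat where "f_set \<equiv> 13"
abbreviation (input) f_fill :: nat where "f_fill \<equiv> 14"
abbreviation (input) f_revapp :: nat where "f_revapp \<equiv> 15"
abbreviation (input) f_jpaths :: nat where "f_jpaths \<equiv> 16"
abbreviation (input) f_fpaths :: nat where "f_fpaths \<equiv> 17"
abbreviation (input) f_gen :: nat where "f_gen \<equiv> 18"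
abbreviation (input) f_enum :: nat where "f_enum \<equiv> 19"
abbreviation (input) f_sumfirst :: nat where "f_sumfirst \<equiv> 20"
abbreviation (input) f_app :: nat where "f_app \<equiv> 21"
abbreviation (input) f_del :: nat where "f_del \<equiv> 22"
abbreviation (input) f_nth :: nat where "f_nth \<equiv> 23"
abbreviation (input) f_sub :: nat where "f_sub \<equiv> 24"
abbreviation (input) f_eqn :: nat where "f_eqn \<equiv> 25"
abbreviation (input) f_pos :: nat where "f_pos \<equiv> 26"
abbreviation (input) f_count :: nat where "f_count \<equiv> 27"
abbreviation (input) f_flags :: nat where "f_flags \<equiv> 28"
abbreviation (input) f_ins :: nat where "f_ins \<equiv> 29"
abbreviation (input) f_introt :: nat where "f_introt \<equiv> 30"
abbreviation (input) f_shorter :: nat where "f_shorter \<equiv> 31"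
abbreviation (input) f_umul :: nat where "f_umul \<equiv> 32"
abbreviation (input) f_mone :: nat where "f_mone \<equiv> 33"
abbreviation (input) f_pts :: nat where "f_pts \<equiv> 34"
abbreviation (input) f_eprod :: nat where "f_eprod \<equiv> 35"
abbreviation (input) f_es :: nat where "f_es \<equiv> 36"
abbreviation (input) f_lmul :: nat where "f_lmul \<equiv> 37"
abbreviation (input) f_plin :: nat where "f_plin \<equiv> 38"
abbreviation (input) f_wc :: nat where "f_wc \<equiv> 39"
abbreviation (input) f_pmul :: nat where "f_pmul \<equiv> 40"
abbreviation (input) f_vc :: nat where "f_vc \<equiv> 41"
abbreviation (input) f_ctx :: nat where "f_ctx \<equiv> 42"
abbreviation (input) f_join :: nat where "f_join \<equiv> 43"
abbreviation (input) f_forget :: nat where "f_forget \<equiv> 44"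
abbreviation (input) f_unary :: nat where "f_unary \<equiv> 45"
abbreviation (input) f_solve :: nat where "f_solve \<equiv> 46"

abbreviation (input) TrueE :: expr where "TrueE \<equiv> PairE AtomE AtomE"
abbreviation (input) SucE :: "expr \<Rightarrow> expr" where "SucE e \<equiv> PairE AtomE e"

primrec elemE :: "nat \<Rightarrow> expr \<Rightarrow> expr" where
  "elemE 0 e = LeftE e"
| "elemE (Suc i) e = elemE i (RightE e)"

text \<open>With \<open>N\<close> one more than the number of vertices, the unary numeral
  \<open>(N + 1)^5\<close> doubles as the word of that many zero bits and so fixes the word length.
  The list of forgotten vertices that \<open>solve\<close> returns along with the tables is
  dropped.\<close>

definition main_body :: expr where
  "main_body =
     LetE (SucE (CallE f_len [elemE 0 (Var 0)]))
    (LetE (SucE (Var 0))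
    (LetE (CallE f_umul [Var 0, Var 0])
    (LetE (CallE f_umul [Var 1, CallE f_umul [Var 0, Var 0]])
    (RightE (CallE f_solve
       [elemE 2 (Var 4), AtomE,
        CallE f_ctx [elemE 0 (Var 4), elemE 1 (Var 4), Var 3, Var 0]])))))"

definition len_body :: expr where
  "len_body = IfAtomE (Var 0) AtomE (SucE (CallE f_len [RightE (Var 0)]))"

text \<open>Ripple-carry addition with the carry as first argument. The last carry is dropped, which
  is reduction modulo a power of two.\<close>

definition add_body :: expr where
  "add_body =
     IfAtomE (Var 1) AtomE (IfAtomE (Var 2) AtomE (PairE
       (IfAtomE (Var 0)
         (IfAtomE (LeftE (Var 1)) (LeftE (Var 2)) (IfAtomE (LeftE (Var 2)) TrueE AtomE))
         (IfAtomE (LeftE (Var 1)) (IfAtomE (LeftE (Var 2)) TrueE AtomE) (LeftE (Var 2))))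
       (CallE f_add
         [IfAtomE (Var 0)
           (IfAtomE (LeftE (Var 1)) AtomE (LeftE (Var 2)))
           (IfAtomE (LeftE (Var 1)) (LeftE (Var 2)) TrueE),
          RightE (Var 1), RightE (Var 2)])))"

definition mul_body :: expr where
  "mul_body =
     IfAtomE (Var 1) AtomE
       (LetE (PairE AtomE (CallE f_mul [Var 0, RightE (Var 1)]))
         (IfAtomE (LeftE (Var 2)) (Var 0) (CallE f_add [AtomE, Var 1, Var 0])))"

definition nonzero_body :: expr where
  "nonzero_body =
     IfAtomE (Var 0) AtomE
       (IfAtomE (LeftE (Var 0)) (CallE f_nonzero [RightE (Var 0)]) TrueE)"

definition aadd_body :: expr where
  "aadd_body =
     IfAtomE (Var 0) (CallE f_add [AtomE, Var 1, Var 2])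
       (IfAtomE (Var 1) AtomE
         (PairE (CallE f_aadd [RightE (Var 0), LeftE (Var 1), LeftE (Var 2)])
                (CallE f_aadd [Var 0, RightE (Var 1), RightE (Var 2)])))"

definition scale_body :: expr where
  "scale_body =
     IfAtomE (Var 0) (CallE f_mul [Var 1, Var 2])
       (IfAtomE (Var 2) AtomE
         (PairE (CallE f_scale [RightE (Var 0), Var 1, LeftE (Var 2)])
                (CallE f_scale [Var 0, Var 1, RightE (Var 2)])))"

definition outer_body :: expr where
  "outer_body =
     IfAtomE (Var 1) AtomE
       (PairE (CallE f_scale [Var 0, LeftE (Var 1), Var 2])
              (CallE f_outer [Var 0, RightE (Var 1), Var 2]))"

text \<open>A linear map applied along the first axis: the sum over j of the j-th column times the
  j-th slice. With the matrix of powers this evaluates, with the Lagrange matrix it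
  interpolates.\<close>

definition comb_body :: expr where
  "comb_body =
     LetE (CallE f_outer [Var 0, LeftE (Var 1), LeftE (Var 2)])
       (IfAtomE (RightE (Var 2)) (Var 0)
         (CallE f_aadd [SucE (Var 1), Var 0, CallE f_comb [Var 1, RightE (Var 2), RightE (Var 3)]]))"

definition conv_body :: expr where
  "conv_body =
     IfAtomE (Var 0) (CallE f_mul [Var 1, Var 2])
       (CallE f_comb [RightE (Var 0), Var 4,
         CallE f_convl [RightE (Var 0), CallE f_comb [RightE (Var 0), Var 3, Var 1],
           CallE f_comb [RightE (Var 0), Var 3, Var 2], Var 3, Var 4]])"

definition convl_body :: expr where
  "convl_body =
     IfAtomE (Var 1) AtomE
       (PairE (CallE f_conv [Var 0, LeftE (Var 1), LeftE (Var 2), Var 3, Var 4])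
              (CallE f_convl [Var 0, RightE (Var 1), RightE (Var 2), Var 3, Var 4]))"

definition rep_body :: expr where
  "rep_body = IfAtomE (Var 0) AtomE (PairE (Var 1) (CallE f_rep [RightE (Var 0), Var 1]))"

definition zeros_body :: expr where
  "zeros_body =
     IfAtomE (Var 0) (Var 2)
       (CallE f_rep [Var 1, CallE f_zeros [RightE (Var 0), Var 1, Var 2]])"

definition set_body :: expr where
  "set_body =
     IfAtomE (Var 0) (Var 2)
       (IfAtomE (LeftE (Var 0))
         (PairE (CallE f_set [RightE (Var 0), LeftE (Var 1), Var 2]) (RightE (Var 1)))
         (PairE (LeftE (Var 1))
           (CallE f_set [PairE (RightE (LeftE (Var 0))) (RightE (Var 0)), RightE (Var 1), Var 2])))"

definition fill_body :: expr where
  "fill_body =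
     IfAtomE (Var 0) (Var 1)
       (CallE f_fill [RightE (Var 0), CallE f_set [LeftE (Var 0), Var 1, Var 2], Var 2])"

definition revapp_body :: expr where
  "revapp_body =
     IfAtomE (Var 0) (Var 1) (CallE f_revapp [RightE (Var 0), PairE (LeftE (Var 0)) (Var 1)])"

definition jpaths_body :: expr where
  "jpaths_body =
     IfAtomE (Var 0) AtomE
       (PairE (CallE f_revapp [LeftE (LeftE (Var 0)), PairE (RightE (LeftE (Var 0))) AtomE])
              (CallE f_jpaths [RightE (Var 0)]))"

definition fpaths_body :: expr where
  "fpaths_body =
     IfAtomE (Var 2) AtomE
       (PairE
         (PairE (CallE f_sub [Var 1, CallE f_nth [Var 0, LeftE (LeftE (Var 2))]])
           (CallE f_revapp [CallE f_del [Var 0, LeftE (LeftE (Var 2))],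
              PairE (RightE (LeftE (Var 2))) AtomE]))
         (CallE f_fpaths [Var 0, Var 1, RightE (Var 2)]))"

definition gen_body :: expr where
  "gen_body =
     IfAtomE (Var 0) (PairE (PairE (Var 2) (Var 1)) (Var 3))
       (LetE (CallE f_gen [RightE (Var 0), PairE AtomE (Var 1), Var 2, Var 3])
         (IfAtomE (LeftE (Var 1)) (Var 0)
           (CallE f_gen [RightE (Var 1), PairE TrueE (Var 2), SucE (Var 3), Var 0])))"

text \<open>The arguments are the number of axes, the array, the running index, the stack of chosen
  indices and the rows found so far. Passing the rows along avoids appending lists.\<close>

definition enum_body :: expr where
  "enum_body =
     IfAtomE (Var 0)
       (IfAtomE (CallE f_nonzero [Var 1]) (Var 4)
         (PairE (PairE (RightE (Var 3)) (LeftE (Var 3))) (Var 4)))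
       (IfAtomE (Var 1) (Var 4)
         (CallE f_enum [Var 0, RightE (Var 1), SucE (Var 2), Var 3,
           CallE f_enum [RightE (Var 0), LeftE (Var 1), AtomE, PairE (Var 2) (Var 3), Var 4]]))"

text \<open>The capacity is read only as long as slices remain, so the time does not depend on how
  large it is.\<close>

definition sumfirst_body :: expr where
  "sumfirst_body =
     IfAtomE (Var 1) (LeftE (Var 2))
       (IfAtomE (RightE (Var 2)) (LeftE (Var 2))
         (CallE f_aadd [Var 0, LeftE (Var 2),
            CallE f_sumfirst [Var 0, RightE (Var 1), RightE (Var 2)]]))"

definition app_body :: expr where
  "app_body =
     IfAtomE (Var 0) (Var 1) (PairE (LeftE (Var 0)) (CallE f_app [RightE (Var 0), Var 1]))"

definition del_body :: expr where
  "del_body =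
     IfAtomE (Var 0) (RightE (Var 1))
       (PairE (LeftE (Var 1)) (CallE f_del [RightE (Var 0), RightE (Var 1)]))"

definition nth_body :: expr where
  "nth_body =
     IfAtomE (Var 0) (LeftE (Var 1)) (CallE f_nth [RightE (Var 0), RightE (Var 1)])"

definition sub_body :: expr where
  "sub_body = IfAtomE (Var 1) (Var 0) (CallE f_sub [RightE (Var 0), RightE (Var 1)])"

definition eqn_body :: expr where
  "eqn_body =
     IfAtomE (Var 0) (IfAtomE (Var 1) TrueE AtomE)
       (IfAtomE (Var 1) AtomE (CallE f_eqn [RightE (Var 0), RightE (Var 1)]))"

text \<open>The two lists differ by one additional entry in the first; the first disagreement is its
  position.\<close>

definition pos_body :: expr where
  "pos_body =
     IfAtomE (Var 1) AtomE
       (IfAtomE (CallE f_eqn [LeftE (Var 0), LeftE (Var 1)]) AtomE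
         (SucE (CallE f_pos [RightE (Var 0), RightE (Var 1)])))"

definition count_body :: expr where
  "count_body =
     IfAtomE (Var 1) AtomE
       (IfAtomE (CallE f_nth [LeftE (Var 1), Var 0])
         (CallE f_count [Var 0, RightE (Var 1)])
         (SucE (CallE f_count [Var 0, RightE (Var 1)])))"

definition flags_body :: expr where
  "flags_body =
     IfAtomE (Var 1) AtomE
       (PairE (CallE f_nth [LeftE (Var 1), Var 0]) (CallE f_flags [Var 0, RightE (Var 1)]))"

definition ins_body :: expr where
  "ins_body =
     IfAtomE (Var 0) (PairE AtomE (Var 1))
       (PairE (LeftE (Var 1)) (CallE f_ins [RightE (Var 0), RightE (Var 1)]))"

definition introt_body :: expr where
  "introt_body =
     IfAtomE (Var 1) AtomE
       (PairE (PairE (CallE f_ins [Var 0, LeftE (LeftE (Var 1))]) (RightE (LeftE (Var 1))))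
              (CallE f_introt [Var 0, RightE (Var 1)]))"

definition shorter_body :: expr where
  "shorter_body =
     IfAtomE (Var 1) AtomE
       (IfAtomE (Var 0) TrueE (CallE f_shorter [RightE (Var 0), RightE (Var 1)]))"

definition umul_body :: expr where
  "umul_body =
     IfAtomE (Var 0) AtomE (CallE f_app [Var 1, CallE f_umul [RightE (Var 0), Var 1]])"

definition mone_body :: expr where
  "mone_body = IfAtomE (Var 0) AtomE (PairE TrueE (CallE f_mone [RightE (Var 0)]))"

definition pts_body :: expr where
  "pts_body =
     IfAtomE (Var 0) AtomE
       (PairE (Var 1)
         (CallE f_pts [RightE (Var 0), CallE f_add [AtomE, Var 1, Var 2], Var 2]))"

definition eprod_body :: expr where
  "eprod_body =
     IfAtomE (Var 1) (Var 2)
       (CallE f_mul [CallE f_add [AtomE, Var 0, LeftE (Var 1)],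
                     CallE f_eprod [Var 0, RightE (Var 1), Var 2]])"

definition es_body :: expr where
  "es_body =
     IfAtomE (Var 1) AtomE
       (PairE (CallE f_eprod [LeftE (Var 1), CallE f_del [Var 0, Var 2], Var 3])
              (CallE f_es [SucE (Var 0), RightE (Var 1), Var 2, Var 3]))"

definition lmul_body :: expr where
  "lmul_body =
     IfAtomE (Var 1) (PairE (Var 0) AtomE)
       (PairE (CallE f_add [AtomE, Var 0, CallE f_mul [Var 2, LeftE (Var 1)]])
              (CallE f_lmul [LeftE (Var 1), RightE (Var 1), Var 2]))"

definition plin_body :: expr where
  "plin_body =
     IfAtomE (Var 0) (PairE (Var 2) AtomE)
       (CallE f_lmul [Var 1, CallE f_plin [RightE (Var 0), Var 1, Var 2], LeftE (Var 0)])"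

definition wc_body :: expr where
  "wc_body =
     IfAtomE (Var 1) AtomE
       (LetE (CallE f_eprod [Var 4, CallE f_del [Var 0, Var 2], Var 5])
         (PairE
           (CallE f_scale [SucE AtomE, CallE f_mul [LeftE (Var 2), CallE f_mul [Var 0, Var 0]],
              CallE f_plin [CallE f_del [Var 1, Var 4], Var 5, Var 6]])
           (CallE f_wc [SucE (Var 1), RightE (Var 2), Var 3, Var 4, Var 5, Var 6])))"

definition pmul_body :: expr where
  "pmul_body =
     IfAtomE (Var 0) AtomE
       (PairE (CallE f_mul [LeftE (Var 0), LeftE (Var 1)])
              (CallE f_pmul [RightE (Var 0), RightE (Var 1)]))"

definition vc_body :: expr where
  "vc_body =
     IfAtomE (Var 0) AtomE
       (PairE (Var 1) (CallE f_vc [RightE (Var 0), CallE f_pmul [Var 1, Var 2], Var 2]))"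

primrec listE :: "expr list \<Rightarrow> expr" where
  "listE [] = AtomE"
| "listE (e # es) = PairE e (listE es)"

definition ctx_body :: expr where
  "ctx_body =
     LetE (PairE TrueE (RightE (Var 3)))
    (LetE (CallE f_pts [Var 3, Var 4, Var 0])
    (LetE (CallE f_pts [Var 4, Var 5, CallE f_mone [Var 5]])
    (listE [Var 3, Var 4, Var 5, Var 6, Var 2,
       CallE f_vc [Var 5, CallE f_rep [Var 5, Var 2], Var 1],
       LetE (CallE f_es [AtomE, Var 1, Var 0, Var 2])
         (CallE f_wc [AtomE, Var 0, Var 0, Var 1, Var 7, Var 3])])))"

definition join_body :: expr where
  "join_body =
     LetE (SucE (CallE f_len [Var 0]))
    (LetE (CallE f_zeros [Var 0, elemE 2 (Var 4), elemE 3 (Var 4)])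
    (PairE (CallE f_app [LeftE (Var 3), LeftE (Var 4)])
      (PairE
        (CallE f_enum [Var 1,
           CallE f_conv [Var 1,
             CallE f_fill [CallE f_jpaths [LeftE (RightE (Var 3))], Var 0, elemE 4 (Var 5)],
             CallE f_fill [CallE f_jpaths [LeftE (RightE (Var 4))], Var 0, elemE 4 (Var 5)],
             elemE 5 (Var 5), elemE 6 (Var 5)],
           AtomE, AtomE, AtomE])
        (RightE (Var 3)))))"

text \<open>The list of forgotten vertices in the child's state gives |N(v) \<inter> Y| by counting
  adjacency bits. The arrays have one axis more than the result; that axis belongs to
  \<open>v\<close> and disappears by taking slice 0 in one summand and by \<open>sumfirst\<close> in
  the other.\<close>

definition forget_body :: expr where
  "forget_body =
     LetE (CallE f_pos [Var 1, Var 0])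
    (LetE (CallE f_nth [Var 0, Var 2])
    (LetE (CallE f_nth [Var 0, elemE 0 (Var 5)])
    (LetE (SucE (CallE f_len [Var 3]))
    (LetE (CallE f_zeros [SucE (Var 0), elemE 2 (Var 7), elemE 3 (Var 7)])
    (LetE (CallE f_fill
            [CallE f_fpaths [Var 4, CallE f_count [Var 2, LeftE (Var 7)], LeftE (RightE (Var 7))],
             Var 0, elemE 4 (Var 8)])
    (PairE (PairE (Var 4) (LeftE (Var 8)))
      (PairE
        (CallE f_enum [Var 2,
           CallE f_aadd [Var 2, LeftE (Var 0),
             CallE f_sumfirst [Var 2, CallE f_nth [Var 4, elemE 1 (Var 9)],
               CallE f_conv [SucE (Var 2), Var 0,
                 CallE f_fill
                   [CallE f_gen [CallE f_flags [Var 3, Var 6], PairE TrueE AtomE, AtomE, AtomE],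
                    Var 1, elemE 4 (Var 9)],
                 elemE 5 (Var 9), elemE 6 (Var 9)]]],
           AtomE, AtomE, AtomE])
        (RightE (Var 8)))))))))"

text \<open>The input does not say of which kind a node is; the lengths of the two bag lists tell an
  introduce node from a forget node.\<close>

definition unary_body :: expr where
  "unary_body =
     IfAtomE (CallE f_shorter [Var 1, Var 0])
       (CallE f_forget [Var 0, Var 1, Var 2, Var 3])
       (PairE (LeftE (Var 2))
         (PairE (CallE f_introt [CallE f_pos [Var 0, Var 1], LeftE (RightE (Var 2))])
                (RightE (Var 2))))"

text \<open>A state consists of the forgotten vertices and the list of tables computed so far. The
  second child of a join is solved before the first and its output list is the accumulator for the
  first, so the tables come out in preorder without appending.\<close>

definition solve_body :: expr where
  "solve_body =
     IfAtomE (RightE (Var 0))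
       (PairE AtomE (PairE (PairE (PairE AtomE AtomE) AtomE) (Var 1)))
       (IfAtomE (RightE (RightE (Var 0)))
         (CallE f_unary [LeftE (Var 0), LeftE (LeftE (RightE (Var 0))),
            CallE f_solve [LeftE (RightE (Var 0)), Var 1, Var 2], Var 2])
         (LetE (CallE f_solve [LeftE (RightE (RightE (Var 0))), Var 1, Var 2])
           (CallE f_join [LeftE (Var 1),
              CallE f_solve [LeftE (RightE (Var 1)), RightE (Var 0), Var 3], Var 0, Var 3])))"

definition prog :: program where
  "prog =
     [main_body, len_body, add_body, mul_body, nonzero_body, aadd_body, scale_body, outer_body,
      comb_body, conv_body, convl_body, rep_body, zeros_body, set_body, fill_body, revapp_body,
      jpaths_body, fpaths_body, gen_body, enum_body, sumfirst_body, app_body, del_body, nth_body,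
      sub_body, eqn_body, pos_body, count_body, flags_body, ins_body, introt_body, shorter_body,
      umul_body, mone_body, pts_body, eprod_body, es_body, lmul_body, plin_body, wc_body,
      pmul_body, vc_body, ctx_body, join_body, forget_body, unary_body, solve_body]"

lemma length_prog: "length prog = 47"
  by (simp add: prog_def)

lemma prog_nth:
  "prog ! f_main = main_body" "prog ! f_len = len_body" "prog ! f_add = add_body"
  "prog ! f_mul = mul_body" "prog ! f_nonzero = nonzero_body" "prog ! f_aadd = aadd_body"
  "prog ! f_scale = scale_body" "prog ! f_outer = outer_body" "prog ! f_comb = comb_body"
  "prog ! f_conv = conv_body" "prog ! f_convl = convl_body" "prog ! f_rep = rep_body"
  "prog ! f_zeros = zeros_body" "prog ! f_set = set_body" "prog ! f_fill = fill_body"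
  "prog ! f_revapp = revapp_body" "prog ! f_jpaths = jpaths_body" "prog ! f_fpaths = fpaths_body"
  "prog ! f_gen = gen_body" "prog ! f_enum = enum_body" "prog ! f_sumfirst = sumfirst_body"
  "prog ! f_app = app_body" "prog ! f_del = del_body" "prog ! f_nth = nth_body"
  "prog ! f_sub = sub_body" "prog ! f_eqn = eqn_body" "prog ! f_pos = pos_body"
  "prog ! f_count = count_body" "prog ! f_flags = flags_body" "prog ! f_ins = ins_body"
  "prog ! f_introt = introt_body" "prog ! f_shorter = shorter_body" "prog ! f_umul = umul_body"
  "prog ! f_mone = mone_body" "prog ! f_pts = pts_body" "prog ! f_eprod = eprod_body"
  "prog ! f_es = es_body" "prog ! f_lmul = lmul_body" "prog ! f_plin = plin_body"
  "prog ! f_wc = wc_body" "prog ! f_pmul = pmul_body" "prog ! f_vc = vc_body"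
  "prog ! f_ctx = ctx_body" "prog ! f_join = join_body" "prog ! f_forget = forget_body"
  "prog ! f_unary = unary_body" "prog ! f_solve = solve_body"
  by (simp_all add: prog_def)

section \<open>Weakest preconditions with time\<close>

definition call :: "nat \<Rightarrow> data list \<Rightarrow> (data \<Rightarrow> nat \<Rightarrow> bool) \<Rightarrow> bool" where
  "call f xs Q \<longleftrightarrow> f < length prog \<and> (\<exists>x t. eval prog xs (prog ! f) x t \<and> Q x t)"

text \<open>The bound concerns the evaluation of the body; the step for the call itself is charged
  to the caller.\<close>

definition computes :: "nat \<Rightarrow> data list \<Rightarrow> data \<Rightarrow> nat \<Rightarrow> bool" where
  "computes f xs r b \<longleftrightarrow> call f xs (\<lambda>x t. x = r \<and> t \<le> b)"

text \<open>Recursion on the expression lets the simplifier execute a body symbolically up to its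
  calls. These remain as \<open>call\<close> goals, which \<open>callI\<close> discharges by the
  specification of the callee; recursive functions are thus handled by induction on their
  data.\<close>

fun wp :: "expr \<Rightarrow> data list \<Rightarrow> (data \<Rightarrow> nat \<Rightarrow> bool) \<Rightarrow> bool"
  and wps :: "expr list \<Rightarrow> data list \<Rightarrow> (data list \<Rightarrow> nat \<Rightarrow> bool) \<Rightarrow> bool" where
  "wp (Var i) env Q = (i < length env \<and> Q (env ! i) 1)"
| "wp AtomE env Q = Q Atom 1"
| "wp (PairE a b) env Q = wp a env (\<lambda>x s. wp b env (\<lambda>y t. Q (Pair x y) (s + t + 1)))"
| "wp (LeftE a) env Q = wp a env (\<lambda>x s. Q (left x) (s + 1))"
| "wp (RightE a) env Q = wp a env (\<lambda>x s. Q (right x) (s + 1))"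
| "wp (IfAtomE e a b) env Q = wp e env (\<lambda>x s.
     if x = Atom then wp a env (\<lambda>y t. Q y (s + t + 1)) else wp b env (\<lambda>y t. Q y (s + t + 1)))"
| "wp (LetE a b) env Q = wp a env (\<lambda>x s. wp b (x # env) (\<lambda>y t. Q y (s + t + 1)))"
| "wp (CallE f es) env Q = wps es env (\<lambda>xs s. call f xs (\<lambda>y t. Q y (s + t + 1)))"
| "wps [] env Q = Q [] 0"
| "wps (e # es) env Q = wp e env (\<lambda>x s. wps es env (\<lambda>xs t. Q (x # xs) (s + t)))"

lemma wp_sound:
  "wp e env Q \<Longrightarrow> \<exists>x t. eval prog env e x t \<and> Q x t"
  "wps es env P \<Longrightarrow> \<exists>xs t. evals prog env es xs t \<and> P xs t"
proof (induction e env Q and es env P rule: wp_wps.induct)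
  case (1 i env Q)
  then show ?case unfolding wp.simps by (blast intro: eval_Var)
next
  case (2 env Q)
  then show ?case unfolding wp.simps by (blast intro: eval_Atom)
next
  case (3 a b env Q)
  from 3(2)[OF 3(3)[unfolded wp.simps]] obtain x s where x: "eval prog env a x s"
    and r: "wp b env (\<lambda>y t. Q (Pair x y) (s + t + 1))" by blast
  from 3(1)[OF r] x show ?case by (blast intro: eval_Pair)
next
  case (4 a env Q)
  from 4(1)[OF 4(2)[unfolded wp.simps]] show ?case by (blast intro: eval_Left)
next
  case (5 a env Q)
  from 5(1)[OF 5(2)[unfolded wp.simps]] show ?case by (blast intro: eval_Right)
next
  case (6 e a b env Q)
  from 6(3)[OF 6(4)[unfolded wp.simps]] obtain x s where x: "eval prog env e x s"
    and r: "if x = Atom then wp a env (\<lambda>y t. Q y (s + t + 1)) else wp b env (\<lambda>y t. Q y (s + t + 1))"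
    by blast
  show ?case
  proof (cases x)
    case Atom
    with r have "wp a env (\<lambda>y t. Q y (s + t + 1))" by simp
    from 6(1)[OF Atom this] x Atom show ?thesis by (blast intro: eval_IfAtom)
  next
    case (Pair y z)
    with r have "x \<noteq> Atom" "wp b env (\<lambda>y t. Q y (s + t + 1))" by simp_all
    from 6(2)[OF this] x Pair show ?thesis by (blast intro: eval_IfPair)
  qed
next
  case (7 a b env Q)
  from 7(2)[OF 7(3)[unfolded wp.simps]] obtain x s where x: "eval prog env a x s"
    and r: "wp b (x # env) (\<lambda>y t. Q y (s + t + 1))" by blast
  from 7(1)[OF r] x show ?case by (blast intro: eval_Let)
next
  case (8 f es env Q)
  from 8(1)[OF 8(2)[unfolded wp.simps]] obtain xs s where x: "evals prog env es xs s"
    and r: "call f xs (\<lambda>y t. Q y (s + t + 1))" by blast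
  from r x show ?case unfolding call_def by (blast intro: eval_Call)
next
  case (9 env Q)
  then show ?case unfolding wps.simps by (blast intro: evals_Nil)
next
  case (10 e es env Q)
  from 10(2)[OF 10(3)[unfolded wps.simps]] obtain x s where x: "eval prog env e x s"
    and r: "wps es env (\<lambda>xs t. Q (x # xs) (s + t))" by blast
  from 10(1)[OF r] x show ?case by (blast intro: evals_Cons)
qed

lemma computesI:
  "wp (prog ! f) xs (\<lambda>x t. x = r \<and> t \<le> b) \<Longrightarrow> f < 47 \<Longrightarrow> computes f xs r b"
  unfolding computes_def call_def length_prog using wp_sound(1) by blast

lemma callI: "computes f xs r b \<Longrightarrow> (\<And>t. t \<le> b \<Longrightarrow> Q r t) \<Longrightarrow> call f xs Q"
  unfolding computes_def call_def by blast

lemma computes_mono: "computes f xs r b \<Longrightarrow> b \<le> b' \<Longrightarrow> computes f xs r b'"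
  unfolding computes_def call_def by force

text \<open>Two's complement with \<open>L\<close> bits, least significant first: a ring homomorphism from the integers, so
  the programs can be specified on unbounded integers and only the test for zero needs a size bound.\<close>

primrec bits :: "nat \<Rightarrow> int \<Rightarrow> data" where
  "bits 0 x = Atom"
| "bits (Suc L) x = Pair (enc_bool (odd x)) (bits L (x div 2))"

lemma enc_bool_simps [simp]:
  "enc_bool False = Atom" "enc_bool True = Pair Atom Atom" "enc_bool b = Atom \<longleftrightarrow> \<not> b"
  by (simp_all add: enc_bool_def)

lemma len_spec: "computes f_len [enc_list xs] (enc_nat (length xs)) (10 * length xs + 5)"
proof (induction xs)
  case Nil
  show ?case by (rule computesI) (simp_all add: prog_nth len_body_def)
next
  case (Cons x xs)
  show ?case
    by (rule computesI) (auto simp: prog_nth len_body_def intro!: callI[OF Cons])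
qed

text \<open>The second word may be shorter than the first and decides the length of the result, as
  in multiplication, where partial products have fewer bits than the full factor.\<close>

lemma add_spec:
  "j \<le> L \<Longrightarrow> computes f_add [enc_bool c, bits L x, bits j y] (bits j (x + y + of_bool c)) (60 * j + 10)"
proof (induction j arbitrary: L x y c)
  case 0
  show ?case by (rule computesI) (simp_all add: prog_nth add_body_def)
next
  case (Suc j)
  from Suc.prems obtain L' where L: "L = Suc L'" "j \<le> L'" by (cases L) auto
  \<comment> \<open>The majority of the incoming carry and the two lowest bits, that is, the carry
    into the next position.\<close>
  define c' where "c' = (if c then odd x \<or> odd y else odd x \<and> odd y)"
  have d: "(x + y + of_bool c) div 2 = x div 2 + y div 2 + of_bool c'"
    unfolding c'_def by (cases c; cases "odd x"; cases "odd y"; simp; presburger)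
  note IH = Suc.IH[OF L(2), of c' "x div 2" "y div 2", folded d]
  show ?case
    apply (rule computesI)
    using IH
     apply (cases c; cases "odd x"; cases "odd y")
     apply (auto simp: prog_nth add_body_def L c'_def intro!: callI)
    done
qed

section \<open>Integers and dense arrays\<close>

lemma enc_nat_eq_Atom [simp]: "enc_nat n = Atom \<longleftrightarrow> n = 0"
  by (cases n) auto

lemma enc_list_eq_Atom [simp]: "enc_list xs = Atom \<longleftrightarrow> xs = []"
  by (cases xs) auto

text \<open>A common bound for the operations on words of \<open>L\<close> bits, quadratic because
  of multiplication bit by bit.\<close>

definition scalar_cost :: "nat \<Rightarrow> nat" where
  "scalar_cost L = 100 * (L + 1) * (L + 1)"

lemma scalar_cost_ge: "100 * L + 100 \<le> scalar_cost L" "100 \<le> scalar_cost L"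
  by (simp_all add: scalar_cost_def algebra_simps)

lemma add_bits_spec: "computes f_add [Atom, bits L x, bits L y] (bits L (x + y)) (scalar_cost L)"
  using add_spec[of L L False x y] scalar_cost_ge(1)[of L] by (auto elim: computes_mono)

lemma bits_double: "Pair Atom (bits j x) = bits (Suc j) (2 * x)"
  by simp

text \<open>Horner's scheme in the bits of \<open>y\<close>: \<open>x * y\<close> is twice
  \<open>x * (y div 2)\<close>, plus \<open>x\<close> if \<open>y\<close> is odd. The low
  \<open>j\<close> bits of the product require only the low \<open>j\<close> bits of
  \<open>y\<close>.\<close>

lemma mul_spec:
  "j \<le> L \<Longrightarrow> computes f_mul [bits L x, bits j y] (bits j (x * y)) (j * (60 * j + 100) + 10)"
proof (induction j arbitrary: y)
  case 0
  show ?case by (rule computesI) (simp_all add: prog_nth mul_body_def)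
next
  case (Suc j)
  then have IH: "computes f_mul [bits L x, bits j (y div 2)] (bits j (x * (y div 2))) (j * (60 * j + 100) + 10)"
    by simp
  have a: "computes f_add [Atom, bits L x, Pair Atom (bits j (x * (y div 2)))]
     (bits (Suc j) (x + 2 * (x * (y div 2)))) (60 * Suc j + 10)"
    unfolding bits_double using add_spec[OF Suc.prems, of False x "2 * (x * (y div 2))"]
    by (simp only: of_bool_def if_False add_0_right enc_bool_simps)
  have y: "odd y \<Longrightarrow> x + 2 * (x * (y div 2)) = x * y" "even y \<Longrightarrow> 2 * (x * (y div 2)) = x * y"
    by (auto elim!: oddE evenE simp: algebra_simps)
  show ?case
  proof (cases "odd y")
    case True
    have a': "computes f_add [Atom, bits L x, Pair Atom (bits j (x * (y div 2)))]
     (bits (Suc j) (x * y)) (60 * Suc j + 10)" using a y(1)[OF True] by simp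
    show ?thesis
      by (rule computesI)
        (auto simp: prog_nth mul_body_def True algebra_simps simp del: bits.simps(2) simp: bits.simps(2)[of j y]
          intro!: callI[OF IH] callI[OF a'])
  next
    case False
    then have "x * y div 2 = x * (y div 2)" "even (x * y)" using y(2) by auto
    with False show ?thesis
      by (intro computesI)
        (auto simp: prog_nth mul_body_def algebra_simps intro!: callI[OF IH])
  qed
qed

lemma mul_bits_spec: "computes f_mul [bits L x, bits L y] (bits L (x * y)) (scalar_cost L)"
  by (rule computes_mono[OF mul_spec]) (auto simp: scalar_cost_def algebra_simps)

lemma nonzero_spec': "computes f_nonzero [bits L x] (enc_bool (\<not> 2 ^ L dvd x)) (20 * L + 10)"
proof (induction L arbitrary: x)
  case 0
  show ?case by (rule computesI) (simp_all add: prog_nth nonzero_body_def)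
next
  case (Suc L)
  have "2 ^ Suc L dvd x \<longleftrightarrow> even x \<and> 2 ^ L dvd x div 2"
    by (cases "even x") (auto elim!: evenE simp: dvd_def)
  then show ?case
    by (intro computesI) (auto simp: prog_nth nonzero_body_def intro!: callI[OF Suc])
qed

text \<open>A word vanishes exactly for the multiples of \<open>2 ^ L\<close>, and 0 is the only
  multiple in this range.\<close>

lemma nonzero_spec:
  assumes "\<bar>x\<bar> < 2 ^ L"
  shows "computes f_nonzero [bits L x] (enc_bool (x \<noteq> 0)) (scalar_cost L)"
proof -
  have "\<not> 2 ^ L dvd x \<longleftrightarrow> x \<noteq> 0"
    using assms by (metis abs_ge_zero abs_of_nonneg dvd_0_right dvd_abs_iff linorder_not_less zdvd_imp_le zero_less_abs_iff)
  with nonzero_spec'[of L x] show ?thesis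
    using scalar_cost_ge(1)[of L] by (auto elim: computes_mono)
qed

section \<open>Arrays over a grid as nested lists, with linear operations\<close>

primrec int_array :: "nat \<Rightarrow> nat \<Rightarrow> nat \<Rightarrow> (nat list \<Rightarrow> int) \<Rightarrow> data" where
  "int_array N L 0 f = bits L (f [])"
| "int_array N L (Suc D) f = enc_list (map (\<lambda>i. int_array N L D (\<lambda>xs. f (i # xs))) [0..<N])"

definition grid :: "nat \<Rightarrow> nat \<Rightarrow> nat list set" where
  "grid N D = {xs. length xs = D \<and> set xs \<subseteq> {..<N}}"

lemma grid_0 [simp]: "grid N 0 = {[]}"
  by (auto simp: grid_def)

lemma grid_Suc: "grid N (Suc D) = (\<Union>i\<in>{..<N}. (#) i ` grid N D)"
  by (auto simp: grid_def length_Suc_conv image_iff)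

lemma Cons_in_grid [simp]: "i # xs \<in> grid N (Suc D) \<longleftrightarrow> i < N \<and> xs \<in> grid N D"
  by (auto simp: grid_def)

text \<open>The factor \<open>D + 1\<close> pays for the overhead of the traversal: every further
  axis adds a summand of the order of the number of cells, which solves the recurrence in
  \<open>array_cost_Suc\<close>.\<close>

definition array_cost :: "nat \<Rightarrow> nat \<Rightarrow> nat \<Rightarrow> nat" where
  "array_cost N L D = (scalar_cost L + 100) * ((D + 1) * N ^ D)"

lemma array_cost_Suc: "0 < N \<Longrightarrow> N * (array_cost N L D + 50) + 50 \<le> array_cost N L (Suc D)"
proof -
  assume N: "0 < N"
  have "50 * N \<le> 50 * (N * N ^ D)" "50 \<le> 50 * (N * N ^ D)" using N by simp_all
  moreover have "array_cost N L (Suc D) = N * array_cost N L D + (scalar_cost L + 100) * (N * N ^ D)"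
    by (simp add: array_cost_def algebra_simps)
  moreover have "100 * (N * N ^ D) \<le> (scalar_cost L + 100) * (N * N ^ D)" by simp
  ultimately show ?thesis unfolding add_mult_distrib2 by linarith
qed

lemma array_cost_0: "array_cost N L 0 = scalar_cost L + 100"
  by (simp add: array_cost_def)

lemma aadd_spec:
  assumes N: "0 < N"
  shows "computes f_aadd [enc_nat D, int_array N L D f, int_array N L D g] (int_array N L D (\<lambda>xs. f xs + g xs)) (array_cost N L D)"
proof (induction D arbitrary: f g)
  case 0
  show ?case
    by (rule computesI) (auto simp: prog_nth aadd_body_def array_cost_0 intro!: callI[OF add_bits_spec])
next
  case (Suc D)
  have "computes f_aadd [Pair Atom (enc_nat D), enc_list (map (\<lambda>i. int_array N L D (\<lambda>xs. f (i # xs))) is),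
      enc_list (map (\<lambda>i. int_array N L D (\<lambda>xs. g (i # xs))) is)]
     (enc_list (map (\<lambda>i. int_array N L D (\<lambda>xs. f (i # xs) + g (i # xs))) is))
     (length is * (array_cost N L D + 50) + 50)" for "is"
  proof (induction "is")
    case Nil
    show ?case by (rule computesI) (auto simp: prog_nth aadd_body_def)
  next
    case (Cons i "is")
    show ?case
      by (rule computesI)
        (auto simp: prog_nth aadd_body_def intro!: callI[OF Suc.IH] callI[OF Cons.IH])
  qed
  from this[of "[0..<N]"] array_cost_Suc[OF N, of L D] show ?case by (auto elim: computes_mono)
qed

lemma scale_spec:
  assumes N: "0 < N"
  shows "computes f_scale [enc_nat D, bits L c, int_array N L D f] (int_array N L D (\<lambda>xs. c * f xs)) (array_cost N L D)"
proof (induction D arbitrary: f)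
  case 0
  show ?case
    by (rule computesI) (auto simp: prog_nth scale_body_def array_cost_0 intro!: callI[OF mul_bits_spec])
next
  case (Suc D)
  have "computes f_scale [Pair Atom (enc_nat D), bits L c, enc_list (map (\<lambda>i. int_array N L D (\<lambda>xs. f (i # xs))) is)]
     (enc_list (map (\<lambda>i. int_array N L D (\<lambda>xs. c * f (i # xs))) is))
     (length is * (array_cost N L D + 50) + 50)" for "is"
  proof (induction "is")
    case Nil
    show ?case by (rule computesI) (auto simp: prog_nth scale_body_def)
  next
    case (Cons i "is")
    show ?case
      by (rule computesI)
        (auto simp: prog_nth scale_body_def intro!: callI[OF Suc.IH] callI[OF Cons.IH])
  qed
  from this[of "[0..<N]"] array_cost_Suc[OF N, of L D] show ?case by (auto elim: computes_mono)
qed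

lemma outer_spec:
  assumes N: "0 < N"
  shows "computes f_outer [enc_nat D, int_array N L (Suc 0) w, int_array N L D f]
    (int_array N L (Suc D) (\<lambda>xs. w [hd xs] * f (tl xs))) (array_cost N L (Suc D))"
proof -
  have "computes f_outer [enc_nat D, enc_list (map (\<lambda>i. bits L (w [i])) is), int_array N L D f]
     (enc_list (map (\<lambda>i. int_array N L D (\<lambda>xs. w [i] * f xs)) is))
     (length is * (array_cost N L D + 50) + 50)" for "is"
  proof (induction "is")
    case Nil
    show ?case by (rule computesI) (auto simp: prog_nth outer_body_def)
  next
    case (Cons i "is")
    show ?case
      by (rule computesI)
        (auto simp: prog_nth outer_body_def intro!: callI[OF scale_spec[OF N]] callI[OF Cons.IH])
  qed
  from this[of "[0..<N]"] array_cost_Suc[OF N, of L D] show ?thesis by (auto elim: computes_mono)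
qed

text \<open>The list is nonempty because the program forms the outer product of the heads before it
  tests the tail.\<close>

lemma comb_spec:
  assumes N: "0 < N" and "js \<noteq> []"
  shows "computes f_comb [enc_nat D, enc_list (map (\<lambda>j. int_array N L (Suc 0) (w j)) js),
       enc_list (map (\<lambda>j. int_array N L D (f j)) js)]
    (int_array N L (Suc D) (\<lambda>xs. \<Sum>j\<leftarrow>js. w j [hd xs] * f j (tl xs)))
    (length js * (2 * array_cost N L (Suc D) + 100))"
  using \<open>js \<noteq> []\<close>
proof (induction js rule: list_nonempty_induct)
  case (single j)
  show ?case
    apply (rule computesI)
     apply (simp add: prog_nth comb_body_def del: int_array.simps(2))
     apply (rule callI[OF outer_spec[OF N]])
     apply (simp del: int_array.simps(2))
    apply simp
    done
next
  case (cons j js)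
  have a: "computes f_aadd [Pair Atom (enc_nat D), int_array N L (Suc D) p, int_array N L (Suc D) q]
      (int_array N L (Suc D) (\<lambda>xs. p xs + q xs)) (array_cost N L (Suc D))" for p q
    using aadd_spec[OF N, of "Suc D"] by (simp only: enc_nat.simps)
  show ?case
    apply (rule computesI)
     apply (simp add: prog_nth comb_body_def cons.hyps del: int_array.simps(2))
     apply (rule callI[OF outer_spec[OF N]])
     apply (rule callI[OF cons.IH])
     apply (rule callI[OF a])
     apply (simp del: int_array.simps(2))
    apply simp
    done
qed

text \<open>Multiplication of polynomials in \<open>D\<close> variables by evaluating the first variable at all points (matrix \<open>v\<close>),
  multiplying recursively, and interpolating (matrix \<open>w\<close>).\<close>

primrec interp_conv :: "nat \<Rightarrow> (nat \<Rightarrow> nat \<Rightarrow> int) \<Rightarrow> (nat \<Rightarrow> nat \<Rightarrow> int) \<Rightarrow> nat \<Rightarrow>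
    (nat list \<Rightarrow> int) \<Rightarrow> (nat list \<Rightarrow> int) \<Rightarrow> nat list \<Rightarrow> int" where
  "interp_conv N v w 0 f g xs = f [] * g []"
| "interp_conv N v w (Suc D) f g xs = (\<Sum>j\<leftarrow>[0..<N]. w j (hd xs) *
     interp_conv N v w D (\<lambda>ys. \<Sum>i\<leftarrow>[0..<N]. v i j * f (i # ys)) (\<lambda>ys. \<Sum>i\<leftarrow>[0..<N]. v i j * g (i # ys)) (tl xs))"

definition cols :: "nat \<Rightarrow> nat \<Rightarrow> (nat \<Rightarrow> nat \<Rightarrow> int) \<Rightarrow> data" where
  "cols N L v = enc_list (map (\<lambda>i. int_array N L (Suc 0) (\<lambda>xs. v i (hd xs))) [0..<N])"

definition conv_cost :: "nat \<Rightarrow> nat \<Rightarrow> nat \<Rightarrow> nat" where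
  "conv_cost N L D = (D + 1) * (12 * (N * array_cost N L D))"

lemma array_cost_ge: "0 < N \<Longrightarrow> 100 \<le> array_cost N L D"
  unfolding array_cost_def
  using mult_le_mono[of 100 "scalar_cost L + 100" 1 "(D + 1) * N ^ D"] mult_le_mono[of 1 "D + 1" 1 "N ^ D"]
  by simp

text \<open>The recurrence of \<open>conv\<close>: three combinations along the first axis, each
  with \<open>N\<close> outer products of the size of the whole array, and \<open>N\<close>
  recursive calls. Every axis costs \<open>N\<close> array operations, so \<open>D\<close> axes take
  \<open>N^(D+1)\<close> up to polynomial factors, whereas combining all pairs of cells would square
  \<open>N^D\<close>.\<close>

lemma conv_cost_Suc:
  assumes N: "0 < N"
  shows "3 * (N * (2 * array_cost N L (Suc D) + 100)) + (N * (conv_cost N L D + 50) + 50) + 50 \<le> conv_cost N L (Suc D)"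
proof -
  have "N * array_cost N L D \<le> array_cost N L (Suc D)" using array_cost_Suc[OF N, of L D] by (simp add: algebra_simps)
  then have "(D + 1) * (12 * N) * (N * array_cost N L D) \<le> (D + 1) * (12 * N) * array_cost N L (Suc D)"
    by (rule mult_le_mono2)
  then have "N * conv_cost N L D \<le> (D + 1) * (12 * (N * array_cost N L (Suc D)))"
    unfolding conv_cost_def by (simp only: mult_ac)
  moreover have "N * 100 \<le> N * array_cost N L (Suc D)" using array_cost_ge[OF N] by simp
  moreover have "conv_cost N L (Suc D) = (D + 1) * (12 * (N * array_cost N L (Suc D))) + 12 * (N * array_cost N L (Suc D))"
    by (simp add: conv_cost_def)
  moreover have "3 * (N * (2 * array_cost N L (Suc D) + 100)) + (N * (conv_cost N L D + 50) + 50) + 50 =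
    6 * (N * array_cost N L (Suc D)) + N * conv_cost N L D + 350 * N + 100" by (simp add: algebra_simps)
  ultimately show ?thesis using N by linarith
qed

lemma comb_cols_spec:
  assumes N: "0 < N"
  shows "computes f_comb [enc_nat D, cols N L v, enc_list (map (\<lambda>i. int_array N L D (f i)) [0..<N])]
    (int_array N L (Suc D) (\<lambda>xs. \<Sum>i\<leftarrow>[0..<N]. v i (hd xs) * f i (tl xs))) (N * (2 * array_cost N L (Suc D) + 100))"
  using comb_spec[OF N, of "[0..<N]" D L "\<lambda>i xs. v i (hd xs)" f] N
  by (simp only: cols_def length_upt list.sel) simp

lemma conv_spec:
  assumes N: "0 < N"
  shows "computes f_conv [enc_nat D, int_array N L D f, int_array N L D g, cols N L v, cols N L w]
     (int_array N L D (interp_conv N v w D f g)) (conv_cost N L D)"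
proof (induction D arbitrary: f g)
  case 0
  have "scalar_cost L + 20 \<le> conv_cost N L 0" using N by (cases N) (simp_all add: conv_cost_def array_cost_0)
  then show ?case
    by (intro computesI) (auto simp: prog_nth conv_body_def intro!: callI[OF mul_bits_spec])
next
  case (Suc D)
  have l: "computes f_convl [enc_nat D, enc_list (map (\<lambda>j. int_array N L D (f j)) js),
      enc_list (map (\<lambda>j. int_array N L D (g j)) js), cols N L v, cols N L w]
     (enc_list (map (\<lambda>j. int_array N L D (interp_conv N v w D (f j) (g j))) js))
     (length js * (conv_cost N L D + 50) + 50)" for js f g
  proof (induction js)
    case Nil
    show ?case by (rule computesI) (auto simp: prog_nth convl_body_def)
  next
    case (Cons j js)
    show ?case
      by (rule computesI)
        (auto simp: prog_nth convl_body_def intro!: callI[OF Suc.IH] callI[OF Cons.IH])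
  qed
  have c: "computes f_comb [enc_nat D, cols N L v, int_array N L (Suc D) h]
    (enc_list (map (\<lambda>j. int_array N L D (\<lambda>ys. \<Sum>i\<leftarrow>[0..<N]. v i j * h (i # ys))) [0..<N]))
    (N * (2 * array_cost N L (Suc D) + 100))" for h v
    using comb_cols_spec[OF N, of D L v "\<lambda>i xs. h (i # xs)"] by simp
  show ?case
    apply (rule computesI)
     apply (simp add: prog_nth conv_body_def del: int_array.simps(2))
     apply (rule callI[OF c])
     apply (rule callI[OF c])
     apply (rule callI[OF l])
     apply (rule callI[OF comb_cols_spec[OF N]])
    using conv_cost_Suc[OF N, of L D]
     apply (simp del: int_array.simps(2))
    apply simp
    done
qed

section \<open>Filling an array from a list of index paths\<close>

lemma rep_spec: "computes f_rep [enc_nat n, z] (enc_list (replicate n z)) (20 * n + 10)"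
proof (induction n)
  case 0
  show ?case by (rule computesI) (auto simp: prog_nth rep_body_def)
next
  case (Suc n)
  show ?case by (rule computesI) (auto simp: prog_nth rep_body_def intro!: callI[OF Suc])
qed

text \<open>All slices of an axis share one subterm, so the zero array takes time proportional to
  \<open>D * N\<close> although it has \<open>N^D\<close> cells.\<close>

lemma zeros_spec:
  "computes f_zeros [enc_nat D, enc_nat N, bits L 0] (int_array N L D (\<lambda>_. 0)) (D * (20 * N + 50) + 10)"
proof (induction D)
  case 0
  show ?case by (rule computesI) (auto simp: prog_nth zeros_body_def)
next
  case (Suc D)
  show ?case
    by (rule computesI) (auto simp: prog_nth zeros_body_def map_replicate_const
        intro!: callI[OF Suc] callI[OF rep_spec])
qed

abbreviation epath :: "nat list \<Rightarrow> data" where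
  "epath xs \<equiv> enc_list (map enc_nat xs)"

text \<open>Only the cells along the path are copied, the rest of the array is shared; hence a bound
  linear in \<open>D * N\<close>.\<close>

lemma set_spec:
  assumes "path \<in> grid N D"
  shows "computes f_set [epath path, int_array N L D f, bits L 1] (int_array N L D (f(path := 1))) (D * (50 * N + 50) + 10)"
  using assms
proof (induction path arbitrary: D f)
  case Nil
  then have "D = 0" by (simp add: grid_def)
  then show ?case by (intro computesI) (auto simp: prog_nth set_body_def)
next
  case (Cons i ps)
  then obtain D' where D: "D = Suc D'" and ps: "ps \<in> grid N D'" and i: "i < N"
    by (auto simp: grid_def)
  \<comment> \<open>The head of the path serves as a counter while the program walks to slice
    \<open>i\<close>.\<close>
  have *: "computes f_set [Pair (enc_nat i) (epath ps), enc_list As, bits L 1] (enc_list (As[i := r]))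
      (b + 50 * i + 50)"
    if "i < length As" "computes f_set [epath ps, As ! i, bits L 1] r b" for i As r b
    using that
  proof (induction i arbitrary: As)
    case 0
    then obtain a as where "As = a # as" by (cases As) auto
    with 0 have "computes f_set [epath ps, a, bits L 1] r b" by simp
    note * = callI[OF this]
    from \<open>As = a # as\<close> show ?case
      by (intro computesI) (auto simp: prog_nth set_body_def intro!: *)
  next
    case (Suc i)
    then obtain a as where As: "As = a # as" by (cases As) auto
    with Suc.prems have "computes f_set [Pair (enc_nat i) (epath ps), enc_list as, bits L 1] (enc_list (as[i := r]))
      (b + 50 * i + 50)" by (intro Suc.IH) auto
    note * = callI[OF this]
    from As show ?case
      by (intro computesI) (auto simp: prog_nth set_body_def intro!: *)
  qed
  have "computes f_set [epath ps, map (\<lambda>i. int_array N L D' (\<lambda>xs. f (i # xs))) [0..<N] ! i, bits L 1]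
     (int_array N L D' ((\<lambda>xs. f (i # xs))(ps := 1))) (D' * (50 * N + 50) + 10)"
    using Cons.IH[OF ps, of "\<lambda>xs. f (i # xs)"] i by (simp add: fun_upd_def)
  from *[OF _ this] i
  have "computes f_set [epath (i # ps), int_array N L D f, bits L 1]
     (enc_list ((map (\<lambda>i. int_array N L D' (\<lambda>xs. f (i # xs))) [0..<N])
        [i := int_array N L D' ((\<lambda>xs. f (i # xs))(ps := 1))]))
     (D' * (50 * N + 50) + 10 + 50 * i + 50)"
    by (simp add: D)
  moreover have "(map (\<lambda>i. int_array N L D' (\<lambda>xs. f (i # xs))) [0..<N])
        [i := int_array N L D' ((\<lambda>xs. f (i # xs))(ps := 1))] =
      map (\<lambda>j. int_array N L D' (\<lambda>xs. (f(i # ps := 1)) (j # xs))) [0..<N]"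
    using i by (intro nth_equalityI) (auto simp: nth_list_update fun_upd_def cong: if_cong)
  ultimately show ?case
    using i by (auto simp: D elim!: computes_mono)
qed

lemma fill_spec:
  assumes "set paths \<subseteq> grid N D"
  shows "computes f_fill [enc_list (map epath paths), int_array N L D f, bits L 1]
     (int_array N L D (\<lambda>xs. if xs \<in> set paths then 1 else f xs))
     (length paths * (D * (50 * N + 50) + 50) + 10)"
  using assms
proof (induction paths arbitrary: f)
  case Nil
  show ?case by (rule computesI) (auto simp: prog_nth fill_body_def)
next
  case (Cons p ps)
  have eq: "(\<lambda>xs. if xs \<in> set ps then 1 else (f(p := 1)) xs) = (\<lambda>xs. if xs \<in> set (p # ps) then 1 else f xs)"
    by (auto simp: fun_eq_iff)
  from Cons.IH[of "f(p := 1)"] Cons.prems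
  have IH: "computes f_fill [enc_list (map epath ps), int_array N L D (f(p := 1)), bits L 1]
     (int_array N L D (\<lambda>xs. if xs \<in> set (p # ps) then 1 else f xs))
     (length ps * (D * (50 * N + 50) + 50) + 10)"
    by (simp only: eq set_simps insert_subset)
  have p: "p \<in> grid N D" using Cons.prems by simp
  show ?case
    apply (rule computesI)
     apply (simp add: prog_nth fill_body_def del: set_simps)
     apply (rule callI[OF set_spec[OF p]])
     apply (rule callI[OF IH])
     apply (simp add: algebra_simps)
    apply simp
    done
qed

lemma revapp_spec:
  "computes f_revapp [enc_list xs, enc_list ys] (enc_list (rev xs @ ys)) (20 * length xs + 10)"
proof (induction xs arbitrary: ys)
  case Nil
  show ?case by (rule computesI) (auto simp: prog_nth revapp_body_def)
next
  case (Cons x xs)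
  have "computes f_revapp [enc_list xs, Pair x (enc_list ys)] (enc_list (rev xs @ x # ys)) (20 * length xs + 10)"
    using Cons[of "x # ys"] by simp
  note * = callI[OF this]
  show ?case by (rule computesI) (auto simp: prog_nth revapp_body_def intro!: *)
qed

type_synonym row = "nat list \<times> nat"

definition erow :: "row \<Rightarrow> data" where
  "erow r = Pair (epath (fst r)) (enc_nat (snd r))"

lemma revapp_path_spec:
  "computes f_revapp [epath xs, Pair (enc_nat k) Atom] (epath (rev xs @ [k])) (20 * length xs + 10)"
  using revapp_spec[of "map enc_nat xs" "[enc_nat k]"] by (simp add: rev_map)

text \<open>The order of the axes is reversed because the enumeration of an array collects indices on a stack.\<close>

definition jpath :: "row \<Rightarrow> nat list" where
  "jpath r = rev (fst r) @ [snd r]"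

lemma jpaths_spec:
  assumes "\<forall>r\<in>set rows. length (fst r) = m"
  shows "computes f_jpaths [enc_list (map erow rows)] (enc_list (map (\<lambda>r. epath (jpath r)) rows))
     (length rows * (20 * m + 60) + 10)"
  using assms
proof (induction rows)
  case Nil
  show ?case by (rule computesI) (auto simp: prog_nth jpaths_body_def)
next
  case (Cons r rows)
  then have IH: "computes f_jpaths [enc_list (map erow rows)] (enc_list (map (\<lambda>r. epath (jpath r)) rows))
     (length rows * (20 * m + 60) + 10)" and m: "m = length (fst r)" by auto
  show ?case
    apply (rule computesI)
     apply (simp add: prog_nth jpaths_body_def erow_def[of r] del: map_append)
     apply (rule callI[OF revapp_path_spec])
     apply (rule callI[OF IH])
     apply (simp add: m jpath_def)
    apply simp
    done
qed

definition delat :: "nat \<Rightarrow> 'a list \<Rightarrow> 'a list" where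
  "delat j xs = take j xs @ drop (Suc j) xs"

lemma delat_simps [simp]:
  "delat 0 (x # xs) = xs" "delat (Suc j) (x # xs) = x # delat j xs"
  by (simp_all add: delat_def)

lemma map_delat: "map f (delat j xs) = delat j (map f xs)"
  by (simp add: delat_def take_map drop_map)

lemma length_delat [simp]: "j < length xs \<Longrightarrow> length (delat j xs) = length xs - 1"
  by (simp add: delat_def)

lemma del_spec:
  "j < length xs \<Longrightarrow> computes f_del [enc_nat j, enc_list xs] (enc_list (delat j xs)) (20 * j + 10)"
proof (induction j arbitrary: xs)
  case 0
  then show ?case by (cases xs) (auto simp: prog_nth del_body_def intro!: computesI)
next
  case (Suc j)
  then obtain y ys where xs: "xs = y # ys" "j < length ys" by (cases xs) auto
  show ?case using xs(1)
    by (intro computesI) (auto simp: prog_nth del_body_def intro!: callI[OF Suc.IH[OF xs(2)]])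
qed

lemma nth_spec:
  "j < length xs \<Longrightarrow> computes f_nth [enc_nat j, enc_list xs] (xs ! j) (20 * j + 10)"
proof (induction j arbitrary: xs)
  case 0
  then show ?case by (cases xs) (auto simp: prog_nth nth_body_def intro!: computesI)
next
  case (Suc j)
  then obtain y ys where xs: "xs = y # ys" "j < length ys" by (cases xs) auto
  show ?case using xs(1)
    by (intro computesI) (auto simp: prog_nth nth_body_def intro!: callI[OF Suc.IH[OF xs(2)]])
qed

lemma right_enc_nat [simp]: "right (enc_nat a) = enc_nat (a - 1)"
  by (cases a) auto

lemma sub_spec: "computes f_sub [enc_nat a, enc_nat b] (enc_nat (a - b)) (20 * b + 10)"
proof (induction b arbitrary: a)
  case 0
  show ?case by (rule computesI) (auto simp: prog_nth sub_body_def)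
next
  case (Suc b)
  have "computes f_sub [enc_nat (a - Suc 0), enc_nat b] (enc_nat (a - Suc b)) (20 * b + 10)"
    using Suc[of "a - 1"] by simp
  note * = callI[OF this]
  show ?case by (rule computesI) (auto simp: prog_nth sub_body_def intro!: *)
qed

text \<open>The first axis holds the in-degree of the forgotten vertex within $Y_\alpha$ instead of its out-degree.\<close>

definition fpath :: "nat \<Rightarrow> nat \<Rightarrow> row \<Rightarrow> nat list" where
  "fpath p B r = (B - fst r ! p) # rev (delat p (fst r)) @ [snd r]"

lemma fpaths_spec:
  assumes "\<forall>r\<in>set rows. length (fst r) = m \<and> fst r ! p \<le> n" "p < m"
  shows "computes f_fpaths [enc_nat p, enc_nat B, enc_list (map erow rows)]
     (enc_list (map (\<lambda>r. epath (fpath p B r)) rows))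
     (length rows * (20 * n + 60 * m + 200) + 10)"
  using assms(1)
proof (induction rows)
  case Nil
  show ?case by (rule computesI) (auto simp: prog_nth fpaths_body_def)
next
  case (Cons r rows)
  define K where "K = 20 * n + 60 * m + 200"
  from Cons have IH: "computes f_fpaths [enc_nat p, enc_nat B, enc_list (map erow rows)]
     (enc_list (map (\<lambda>r. epath (fpath p B r)) rows)) (length rows * K + 10)"
    by (simp add: K_def)
  have r: "length (fst r) = m" "fst r ! p \<le> n" using Cons.prems by auto
  have d: "computes f_del [enc_nat p, epath (fst r)] (epath (delat p (fst r))) (20 * p + 10)"
    using del_spec[of p "map enc_nat (fst r)"] assms(2) r by (simp add: map_delat)
  have k: "computes f_nth [enc_nat p, epath (fst r)] (enc_nat (fst r ! p)) (20 * p + 10)"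
    using nth_spec[of p "map enc_nat (fst r)"] assms(2) r by simp
  have l: "20 * (fst r ! p) + 40 * p + 20 * length (delat p (fst r)) + 140 \<le> K"
    using assms(2) r by (simp add: K_def)
  show ?case
    unfolding K_def[symmetric]
    apply (rule computesI)
     apply (simp add: prog_nth fpaths_body_def erow_def[of r] del: map_append length_delat)
     apply (rule callI[OF k])
     apply (rule callI[OF sub_spec])
     apply (rule callI[OF d])
     apply (rule callI[OF revapp_path_spec])
     apply (rule callI[OF IH])
     apply (simp (no_asm) add: fpath_def[of p B r])
    using l apply linarith
    apply simp
    done
qed

section \<open>Subsets and supports as lists of index paths\<close>

primrec subset_paths :: "bool list \<Rightarrow> nat list \<Rightarrow> nat \<Rightarrow> nat list list" where
  "subset_paths [] acc c = [c # acc]"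
| "subset_paths (b # bs) acc c = (if b then subset_paths bs (1 # acc) (Suc c) else []) @ subset_paths bs (0 # acc) c"

text \<open>Results are accumulated in \<open>res\<close> across the two recursive calls, so the
  time is the number of subsets up to a factor linear in the number of flags.\<close>

lemma gen_spec:
  "computes f_gen [enc_list (map enc_bool bs), epath acc, enc_nat c, enc_list res]
     (enc_list (map epath (subset_paths bs acc c) @ res)) ((length bs + 1) * (60 * 2 ^ length bs))"
proof (induction bs arbitrary: acc c res)
  case Nil
  show ?case by (rule computesI) (auto simp: prog_nth gen_body_def)
next
  case (Cons b bs)
  define X where "X = (length bs + 1) * (60 * 2 ^ length bs)"
  have 1: "computes f_gen [enc_list (map enc_bool bs), Pair Atom (epath acc), enc_nat c, enc_list res]
     (enc_list (map epath (subset_paths bs (0 # acc) c) @ res)) X"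
    using Cons[of "0 # acc" c res] by (simp add: X_def)
  have 2: "computes f_gen [enc_list (map enc_bool bs), Pair (Pair Atom Atom) (epath acc), Pair Atom (enc_nat c),
       enc_list (map epath (subset_paths bs (0 # acc) c) @ res)]
     (enc_list (map epath (subset_paths bs (Suc 0 # acc) (Suc c)) @ map epath (subset_paths bs (0 # acc) c) @ res)) X"
    using Cons[of "Suc 0 # acc" "Suc c" "map epath (subset_paths bs (0 # acc) c) @ res"] by (simp add: X_def)
  have "2 * X + 60 \<le> 2 * X + 120 * 2 ^ length bs" by simp
  also have "\<dots> = (length (b # bs) + 1) * (60 * 2 ^ length (b # bs))"
    by (simp add: X_def algebra_simps)
  finally have t: "2 * X + 60 \<le> (length (b # bs) + 1) * (60 * 2 ^ length (b # bs))" .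
  show ?case
  proof (cases b)
    case True
    show ?thesis
      apply (rule computes_mono[OF computesI t])
       apply (simp add: prog_nth gen_body_def True)
       apply (rule callI[OF 1])
       apply (rule callI[OF 2])
       apply simp_all
      done
  next
    case False
    show ?thesis
      apply (rule computes_mono[OF computesI t])
       apply (simp add: prog_nth gen_body_def False)
       apply (rule callI[OF 1])
       apply simp_all
      done
  qed
qed

text \<open>The order \<open>rev [0..<N]\<close> mirrors the program, which puts the results of
  later slices in front of those of earlier ones.\<close>

primrec support_paths :: "nat \<Rightarrow> nat \<Rightarrow> (nat list \<Rightarrow> int) \<Rightarrow> nat list \<Rightarrow> nat list list" where
  "support_paths N 0 f acc = (if f [] \<noteq> 0 then [acc] else [])"
| "support_paths N (Suc D) f acc = concat (map (\<lambda>i. support_paths N D (\<lambda>xs. f (i # xs)) (i # acc)) (rev [0..<N]))"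

definition eacc :: "nat list \<Rightarrow> data" where
  "eacc acc = Pair (epath (tl acc)) (enc_nat (hd acc))"

text \<open>At a single cell the top of the stack is split off as \<open>k\<close>, so the stack
  must be nonempty by then.\<close>

lemma enum_spec:
  assumes N: "0 < N"
  shows "\<lbrakk>D > 0 \<or> acc \<noteq> []; \<And>xs. xs \<in> grid N D \<Longrightarrow> \<bar>f xs\<bar> < 2 ^ L\<rbrakk> \<Longrightarrow>
    computes f_enum [enc_nat D, int_array N L D f, Atom, epath acc, enc_list res]
      (enc_list (map eacc (support_paths N D f acc) @ res)) (array_cost N L D)"
proof (induction D arbitrary: f acc res)
  case 0
  then obtain a as where acc: "acc = a # as" by (cases acc) auto
  have "\<bar>f []\<bar> < 2 ^ L" using 0 by simp
  note * = nonzero_spec[OF this]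
  show ?case
  proof (cases "f [] = 0")
    case True
    note ** = *[simplified True, simplified]
    show ?thesis
      by (rule computesI) (auto simp: prog_nth enum_body_def True array_cost_0 intro!: callI[OF **])
  next
    case False
    note ** = *[simplified False, simplified]
    show ?thesis using False
      by (intro computesI) (auto simp: prog_nth enum_body_def acc eacc_def array_cost_0 intro!: callI[OF **])
  qed
next
  case (Suc D)
  note IH = Suc.IH and small = Suc.prems(2)
  \<comment> \<open>Generalised from a whole axis to the suffix that starts at index
    \<open>i\<close>, because the program counts upwards while it walks down the list of
    slices.\<close>
  have "computes f_enum [Pair Atom (enc_nat D), enc_list (map (\<lambda>i. int_array N L D (\<lambda>xs. f (i # xs))) [i..<N]),
      enc_nat i, epath acc, enc_list res]
     (enc_list (map eacc (concat (map (\<lambda>i. support_paths N D (\<lambda>xs. f (i # xs)) (i # acc)) (rev [i..<N]))) @ res))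
     ((N - i) * (array_cost N L D + 50) + 50)" if "i \<le> N" for i
    using that
  proof (induction "N - i" arbitrary: i res)
    case 0
    then show ?case by (intro computesI) (auto simp: prog_nth enum_body_def)
  next
    case (Suc n)
    then have i: "i < N" by simp
    then have u: "[i..<N] = i # [Suc i..<N]" by (simp add: upt_conv_Cons)
    let ?r = "map eacc (support_paths N D (\<lambda>xs. f (i # xs)) (i # acc)) @ res"
    have b: "computes f_enum [enc_nat D, int_array N L D (\<lambda>xs. f (i # xs)), Atom, Pair (enc_nat i) (epath acc), enc_list res]
      (enc_list ?r) (array_cost N L D)"
      using IH[of "i # acc" "\<lambda>xs. f (i # xs)" res] i small by simp
    have c: "computes f_enum [Pair Atom (enc_nat D), enc_list (map (\<lambda>i. int_array N L D (\<lambda>xs. f (i # xs))) [Suc i..<N]),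
      Pair Atom (enc_nat i), epath acc, enc_list ?r]
     (enc_list (map eacc (concat (map (\<lambda>i. support_paths N D (\<lambda>xs. f (i # xs)) (i # acc)) (rev [Suc i..<N]))) @ ?r))
     ((N - Suc i) * (array_cost N L D + 50) + 50)"
      using Suc.hyps(1)[of "Suc i" ?r] Suc.hyps(2) i by simp
    have t: "(N - i) * (array_cost N L D + 50) = (N - Suc i) * (array_cost N L D + 50) + array_cost N L D + 50"
      using i by (metis Suc_diff_Suc add.commute add.left_commute mult_Suc)
    show ?case unfolding t
      apply (rule computesI)
       apply (simp add: prog_nth enum_body_def u del: append_assoc)
       apply (rule callI[OF b])
       apply (rule callI[OF c])
       apply (simp)
      apply simp
      done
  qed
  from this[of 0] array_cost_Suc[OF N, of L D] show ?case by (auto elim: computes_mono)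
qed

lemma set_support_paths: "set (support_paths N D f acc) = {rev xs @ acc | xs. xs \<in> grid N D \<and> f xs \<noteq> 0}"
proof (induction D arbitrary: f acc)
  case 0
  then show ?case by auto
next
  case (Suc D)
  show ?case
  proof (intro set_eqI iffI)
    fix ys assume "ys \<in> set (support_paths N (Suc D) f acc)"
    then obtain i xs where "i < N" "xs \<in> grid N D" "f (i # xs) \<noteq> 0" "ys = rev xs @ i # acc"
      by (auto simp: Suc)
    then show "ys \<in> {rev xs @ acc | xs. xs \<in> grid N (Suc D) \<and> f xs \<noteq> 0}"
      by (intro CollectI exI[of _ "i # xs"]) auto
  next
    fix ys assume "ys \<in> {rev xs @ acc | xs. xs \<in> grid N (Suc D) \<and> f xs \<noteq> 0}"
    then obtain i xs where "i < N" "xs \<in> grid N D" "f (i # xs) \<noteq> 0" "ys = rev xs @ i # acc"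
      by (auto simp: grid_Suc)
    then show "ys \<in> set (support_paths N (Suc D) f acc)"
      by (auto simp: Suc)
  qed
qed

lemma length_support_paths: "length (support_paths N D f acc) \<le> N ^ D"
proof (induction D arbitrary: f acc)
  case (Suc D)
  have "length (support_paths N (Suc D) f acc) = (\<Sum>i\<leftarrow>rev [0..<N]. length (support_paths N D (\<lambda>xs. f (i # xs)) (i # acc)))"
    by (simp add: length_concat comp_def)
  also have "\<dots> \<le> (\<Sum>i\<leftarrow>rev [0..<N]. N ^ D)" by (rule sum_list_mono) (rule Suc)
  also have "\<dots> = N ^ Suc D" by (simp add: sum_list_triv)
  finally show ?case .
qed simp

lemma sumfirst_spec:
  assumes N: "0 < N" and "js \<noteq> []"
  shows "computes f_sumfirst [enc_nat D, enc_nat c, enc_list (map (\<lambda>j. int_array N L D (f j)) js)]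
    (int_array N L D (\<lambda>xs. \<Sum>j\<leftarrow>take (Suc c) js. f j xs)) (length js * (array_cost N L D + 50) + 20)"
  using assms(2)
proof (induction js arbitrary: c rule: list_nonempty_induct)
  case (single j)
  show ?case by (rule computesI) (auto simp: prog_nth sumfirst_body_def)
next
  case (cons j js)
  show ?case
  proof (cases c)
    case 0
    then show ?thesis by (intro computesI) (auto simp: prog_nth sumfirst_body_def)
  next
    case (Suc c')
    then show ?thesis
      apply (intro computesI)
       apply (simp add: prog_nth sumfirst_body_def cons.hyps)
       apply (rule callI[OF cons.IH])
       apply (rule callI[OF aadd_spec[OF N]])
       apply simp
      apply simp
      done
  qed
qed

section \<open>Lists and interpolation matrices\<close>

lemma app_spec:
  "computes f_app [enc_list xs, enc_list ys] (enc_list (xs @ ys)) (20 * length xs + 10)"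
proof (induction xs)
  case Nil
  show ?case by (rule computesI) (auto simp: prog_nth app_body_def)
next
  case (Cons x xs)
  show ?case by (rule computesI) (auto simp: prog_nth app_body_def intro!: callI[OF Cons])
qed

lemma enc_nat_conv_list: "enc_nat n = enc_list (replicate n Atom)"
  by (induction n) auto

lemma umul_spec: "computes f_umul [enc_nat a, enc_nat b] (enc_nat (a * b)) (a * (20 * b + 50) + 10)"
proof (induction a)
  case 0
  show ?case by (rule computesI) (auto simp: prog_nth umul_body_def)
next
  case (Suc a)
  have "computes f_app [enc_nat b, enc_nat (a * b)] (enc_nat (b + a * b)) (20 * b + 10)"
    using app_spec[of "replicate b Atom" "replicate (a * b) Atom"]
    by (simp add: enc_nat_conv_list replicate_add)
  note * = callI[OF this]
  show ?case
    apply (rule computesI)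
     apply (simp add: prog_nth umul_body_def)
     apply (rule callI[OF Suc])
     apply (rule *)
     apply simp
    apply simp
    done
qed

lemma eqn_spec: "computes f_eqn [enc_nat a, enc_nat b] (enc_bool (a = b)) (20 * a + 20)"
proof (induction a arbitrary: b)
  case 0
  show ?case by (rule computesI) (auto simp: prog_nth eqn_body_def)
next
  case (Suc a)
  show ?case
  proof (cases b)
    case 0
    then show ?thesis by (intro computesI) (auto simp: prog_nth eqn_body_def)
  next
    case (Suc b')
    show ?thesis unfolding Suc
      by (rule computesI) (auto simp: prog_nth eqn_body_def intro!: callI[OF Suc.IH])
  qed
qed

text \<open>The lists agree on \<open>pre\<close>, and then \<open>v\<close> differs from the head
  of \<open>post\<close>, if there is one. Hence the comparison stops exactly at the position of
  \<open>v\<close>.\<close>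

lemma pos_spec:
  assumes "v \<notin> set post" "set pre \<subseteq> {..<n}" "v < n"
  shows "computes f_pos [epath (pre @ v # post), epath (pre @ post)] (enc_nat (length pre))
     (length pre * (20 * n + 60) + 20 * n + 60)"
  using assms(2)
proof (induction pre)
  case Nil
  show ?case
  proof (cases post)
    case Nil
    then show ?thesis by (intro computesI) (auto simp: prog_nth pos_body_def)
  next
    case (Cons y ys)
    have "computes f_eqn [enc_nat v, enc_nat y] Atom (20 * v + 20)"
      using eqn_spec[of v y] assms(1) Cons by auto
    note * = callI[OF this]
    show ?thesis using Cons assms(3)
      by (intro computesI) (auto simp: prog_nth pos_body_def intro!: *)
  qed
next
  case (Cons x pre)
  have "computes f_eqn [enc_nat x, enc_nat x] (Pair Atom Atom) (20 * x + 20)"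
    using eqn_spec[of x x] by simp
  note * = callI[OF this]
  from Cons have IH: "computes f_pos [epath (pre @ v # post), epath (pre @ post)] (enc_nat (length pre))
     (length pre * (20 * n + 60) + 20 * n + 60)" and "x < n" by auto
  then show ?case
    apply (intro computesI)
     apply (simp add: prog_nth pos_body_def)
     apply (rule *)
     apply simp
     apply (rule callI[OF IH[simplified]])
     apply simp
    apply simp
    done
qed

lemma nth_bool_spec:
  "y < length bs \<Longrightarrow> computes f_nth [enc_nat y, enc_list (map enc_bool bs)] (enc_bool (bs ! y)) (20 * y + 10)"
  using nth_spec[of y "map enc_bool bs"] by simp

lemma count_spec:
  assumes "set ys \<subseteq> {..<length bs}"
  shows "computes f_count [enc_list (map enc_bool bs), epath ys]
     (enc_nat (length (filter (\<lambda>y. bs ! y) ys))) (length ys * (20 * length bs + 60) + 10)"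
  using assms
proof (induction ys)
  case Nil
  show ?case by (rule computesI) (auto simp: prog_nth count_body_def)
next
  case (Cons y ys)
  then have y: "y < length bs" and IH: "computes f_count [enc_list (map enc_bool bs), epath ys]
     (enc_nat (length (filter (\<lambda>y. bs ! y) ys))) (length ys * (20 * length bs + 60) + 10)" by auto
  show ?case
  proof (cases "bs ! y")
    case True
    show ?thesis
      apply (rule computesI)
       apply (simp add: prog_nth count_body_def True)
       apply (rule callI[OF nth_bool_spec[OF y]])
       apply (simp add: True)
       apply (rule callI[OF IH])
      using y apply (simp)
      apply simp
      done
  next
    case False
    show ?thesis
      apply (rule computesI)
       apply (simp add: prog_nth count_body_def False)
       apply (rule callI[OF nth_bool_spec[OF y]])
       apply (simp add: False)
       apply (rule callI[OF IH])
      using y apply (simp)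
      apply simp
      done
  qed
qed

lemma flags_spec:
  assumes "set ys \<subseteq> {..<length bs}"
  shows "computes f_flags [enc_list (map enc_bool bs), epath ys]
     (enc_list (map enc_bool (map (\<lambda>y. bs ! y) ys))) (length ys * (20 * length bs + 60) + 10)"
  using assms
proof (induction ys)
  case Nil
  show ?case by (rule computesI) (auto simp: prog_nth flags_body_def)
next
  case (Cons y ys)
  then have y: "y < length bs" and IH: "computes f_flags [enc_list (map enc_bool bs), epath ys]
     (enc_list (map enc_bool (map (\<lambda>y. bs ! y) ys))) (length ys * (20 * length bs + 60) + 10)" by auto
  show ?case
    apply (rule computesI)
     apply (simp add: prog_nth flags_body_def)
     apply (rule callI[OF nth_bool_spec[OF y]])
     apply (rule callI[OF IH])
    using y apply (simp)
    apply simp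
    done
qed

definition insat :: "nat \<Rightarrow> 'a \<Rightarrow> 'a list \<Rightarrow> 'a list" where
  "insat p x xs = take p xs @ x # drop p xs"

lemma insat_simps [simp]:
  "insat 0 x xs = x # xs" "insat (Suc p) x (y # ys) = y # insat p x ys"
  by (simp_all add: insat_def)

lemma map_insat: "map f (insat p x xs) = insat p (f x) (map f xs)"
  by (simp add: insat_def take_map drop_map)

lemma ins_spec:
  "p \<le> length xs \<Longrightarrow> computes f_ins [enc_nat p, enc_list xs] (enc_list (insat p Atom xs)) (20 * p + 10)"
proof (induction p arbitrary: xs)
  case 0
  then show ?case by (intro computesI) (auto simp: prog_nth ins_body_def)
next
  case (Suc p)
  then obtain y ys where xs: "xs = y # ys" "p \<le> length ys" by (cases xs) auto
  show ?case using xs(1)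
    by (intro computesI) (auto simp: prog_nth ins_body_def intro!: callI[OF Suc.IH[OF xs(2)]])
qed

definition irow :: "nat \<Rightarrow> row \<Rightarrow> row" where
  "irow p r = (insat p 0 (fst r), snd r)"

lemma introt_spec:
  assumes "\<forall>r\<in>set rows. length (fst r) = m" "p \<le> m"
  shows "computes f_introt [enc_nat p, enc_list (map erow rows)] (enc_list (map (\<lambda>r. erow (irow p r)) rows))
     (length rows * (20 * m + 60) + 10)"
  using assms(1)
proof (induction rows)
  case Nil
  show ?case by (rule computesI) (auto simp: prog_nth introt_body_def)
next
  case (Cons r rows)
  have i: "computes f_ins [enc_nat p, epath (fst r)] (epath (insat p 0 (fst r))) (20 * p + 10)"
    using ins_spec[of p "map enc_nat (fst r)"] Cons.prems assms(2) by (simp add: map_insat)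
  from Cons have IH: "computes f_introt [enc_nat p, enc_list (map erow rows)] (enc_list (map (\<lambda>r. erow (irow p r)) rows))
     (length rows * (20 * m + 60) + 10)" by simp
  show ?case
    apply (rule computesI)
     apply (simp add: prog_nth introt_body_def erow_def[of r])
     apply (rule callI[OF i])
     apply (rule callI[OF IH])
    using assms(2) apply (simp add: irow_def erow_def[of "(_, _)"])
    apply simp
    done
qed

lemma shorter_spec:
  "computes f_shorter [enc_list xs, enc_list ys] (enc_bool (length xs < length ys)) (20 * length xs + 20)"
proof (induction xs arbitrary: ys)
  case Nil
  show ?case by (rule computesI) (auto simp: prog_nth shorter_body_def)
next
  case (Cons x xs)
  show ?case
  proof (cases ys)
    case Nil
    then show ?thesis by (intro computesI) (auto simp: prog_nth shorter_body_def)
  next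
    case (Cons y ys')
    show ?thesis unfolding Cons
      by (rule computesI) (auto simp: prog_nth shorter_body_def intro!: callI[OF Cons.IH])
  qed
qed

section \<open>Evaluation points and Lagrange coefficients in machine words\<close>

lemma bits_zero: "bits L 0 = enc_nat L"
  by (induction L) auto

lemma mone_spec: "computes f_mone [bits L 0] (bits L (-1)) (20 * L + 10)"
proof (induction L)
  case 0
  show ?case by (rule computesI) (auto simp: prog_nth mone_body_def)
next
  case (Suc L)
  show ?case by (rule computesI) (auto simp: prog_nth mone_body_def intro!: callI[OF Suc])
qed

abbreviation bits_list :: "nat \<Rightarrow> int list \<Rightarrow> data" where
  "bits_list L xs \<equiv> enc_list (map (bits L) xs)"

lemma pts_spec:
  "computes f_pts [enc_nat n, bits L (x + int i * s), bits L s] (bits_list L (map (\<lambda>i. x + int i * s) [i..<i + n]))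
     (n * (scalar_cost L + 50) + 10)"
proof (induction n arbitrary: i)
  case 0
  show ?case by (rule computesI) (auto simp: prog_nth pts_body_def)
next
  case (Suc n)
  have e: "x + int i * s + s = x + int (Suc i) * s" by (simp add: algebra_simps)
  have u: "[i..<i + Suc n] = i # [Suc i..<Suc i + n]"
    using upt_conv_Cons[of i "i + Suc n"] by simp
  show ?case unfolding u
    apply (rule computesI)
     apply (simp add: prog_nth pts_body_def del: of_nat_Suc upt_Suc)
     apply (rule callI[OF add_bits_spec])
    unfolding e
     apply (rule callI[OF Suc])
     apply (simp del: of_nat_Suc upt_Suc)
    apply simp
    done
qed

lemma eprod_spec:
  "computes f_eprod [bits L x, bits_list L ls, bits L 1] (bits L (\<Prod>l\<leftarrow>ls. x + l)) (length ls * (2 * scalar_cost L + 50) + 10)"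
proof (induction ls)
  case Nil
  show ?case by (rule computesI) (auto simp: prog_nth eprod_body_def)
next
  case (Cons l ls)
  show ?case
    apply (rule computesI)
     apply (simp add: prog_nth eprod_body_def)
     apply (rule callI[OF add_bits_spec])
     apply (rule callI[OF Cons])
     apply (rule callI[OF mul_bits_spec])
     apply simp
    apply simp
    done
qed

lemma del_bits_list_spec:
  "j < length xs \<Longrightarrow> computes f_del [enc_nat j, bits_list L xs] (bits_list L (delat j xs)) (20 * j + 10)"
  using del_spec[of j "map (bits L) xs"] by (simp add: map_delat)

definition negpts :: "nat \<Rightarrow> int list" where
  "negpts N = map (\<lambda>i. - int i) [0..<N]"

text \<open>The product of the differences between \<open>j\<close> and the other points: the
  denominator of the \<open>j\<close>-th Lagrange basis polynomial.\<close>

definition lagr_val :: "nat \<Rightarrow> nat \<Rightarrow> int" where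
  "lagr_val N j = (\<Prod>l\<leftarrow>delat j (negpts N). int j + l)"

lemma length_negpts [simp]: "length (negpts N) = N"
  by (simp add: negpts_def)

lemma es_spec:
  assumes "j \<le> N"
  shows "computes f_es [enc_nat j, bits_list L (map int [j..<N]), bits_list L (negpts N), bits L 1]
     (bits_list L (map (lagr_val N) [j..<N])) ((N - j) * (N * (2 * scalar_cost L + 100) + 100) + 10)"
  using assms
proof (induction "N - j" arbitrary: j)
  case 0
  then show ?case by (intro computesI) (auto simp: prog_nth es_body_def)
next
  case (Suc n)
  then have j: "j < N" by simp
  then have u: "[j..<N] = j # [Suc j..<N]" by (simp add: upt_conv_Cons)
  define K where "K = N * (2 * scalar_cost L + 100) + 100"
  have IH: "computes f_es [Pair Atom (enc_nat j), bits_list L (map int [Suc j..<N]), bits_list L (negpts N), bits L 1]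
     (bits_list L (map (lagr_val N) [Suc j..<N])) ((N - Suc j) * K + 10)"
    using Suc.hyps(1)[of "Suc j"] Suc.hyps(2) j by (simp add: K_def del: map_map)
  have t: "(N - j) * K = (N - Suc j) * K + K"
    using j by (metis Suc_diff_Suc add.commute mult_Suc)
  have "(N - 1) * (2 * scalar_cost L + 50) \<le> N * (2 * scalar_cost L + 50)" by simp
  moreover have "N * (2 * scalar_cost L + 100) = N * (2 * scalar_cost L + 50) + 50 * N" by (simp add: algebra_simps)
  ultimately have k: "(N - 1) * (2 * scalar_cost L + 50) + 20 * j + 70 \<le> K" using j unfolding K_def by linarith
  show ?case unfolding u K_def[symmetric] t
    apply (rule computesI)
     apply (simp add: prog_nth es_body_def del: map_map)
     apply (rule callI[OF del_bits_list_spec])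
    using j apply simp
     apply (rule callI[OF eprod_spec])
     apply (rule callI[OF IH])
    using k j apply (simp add: lagr_val_def[of N j] del: map_map)
    apply simp
    done
qed

text \<open>Coefficients, lowest first, of \<open>p + (x + l) * q\<close> if \<open>as\<close> are
  those of \<open>q\<close>; the argument \<open>p\<close> carries the coefficient that
  multiplication by \<open>x\<close> shifts up by one position.\<close>

primrec lmul :: "int \<Rightarrow> int \<Rightarrow> int list \<Rightarrow> int list" where
  "lmul l p [] = [p]"
| "lmul l p (a # as) = (p + l * a) # lmul l a as"

primrec plin :: "int list \<Rightarrow> int list" where
  "plin [] = [1]"
| "plin (l # ls) = lmul l 0 (plin ls)"

lemma length_lmul [simp]: "length (lmul l p as) = Suc (length as)"
  by (induction as arbitrary: p) auto

lemma length_plin [simp]: "length (plin ls) = Suc (length ls)"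
  by (induction ls) auto

lemma lmul_spec:
  "computes f_lmul [bits L p, bits_list L as, bits L l] (bits_list L (lmul l p as)) (length as * (2 * scalar_cost L + 50) + 10)"
proof (induction as arbitrary: p)
  case Nil
  show ?case by (rule computesI) (auto simp: prog_nth lmul_body_def)
next
  case (Cons a as)
  show ?case
    apply (rule computesI)
     apply (simp add: prog_nth lmul_body_def)
     apply (rule callI[OF mul_bits_spec])
     apply (rule callI[OF add_bits_spec])
     apply (rule callI[OF Cons])
     apply simp
    apply simp
    done
qed

lemma plin_spec:
  "length ls < N \<Longrightarrow> computes f_plin [bits_list L ls, bits L 0, bits L 1] (bits_list L (plin ls)) (length ls * (N * (2 * scalar_cost L + 50) + 50) + 10)"
proof (induction ls)
  case Nil
  show ?case by (rule computesI) (auto simp: prog_nth plin_body_def)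
next
  case (Cons l ls)
  then have IH: "computes f_plin [bits_list L ls, bits L 0, bits L 1] (bits_list L (plin ls)) (length ls * (N * (2 * scalar_cost L + 50) + 50) + 10)"
    by simp
  have t: "length (plin ls) * (2 * scalar_cost L + 50) \<le> N * (2 * scalar_cost L + 50)"
    using Cons.prems by (intro mult_le_mono1) simp
  show ?case
    apply (rule computesI)
     apply (simp add: prog_nth plin_body_def)
     apply (rule callI[OF IH])
     apply (rule callI[OF lmul_spec])
    using t apply simp
    apply simp
    done
qed

text \<open>The product of all other denominators, so that \<open>lagr_val N j * lagr_wt N j\<close>
  does not depend on \<open>j\<close>; this takes the place of a division. The summand 0 is there
  because \<open>eprod\<close> multiplies sums.\<close>

definition lagr_wt :: "nat \<Rightarrow> nat \<Rightarrow> int" where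
  "lagr_wt N j = (\<Prod>l\<leftarrow>delat j (map (lagr_val N) [0..<N]). 0 + l)"

text \<open>Lagrange interpolation multiplied by the common denominator; the square makes the factor positive, so
  that supports of products can be added to those of other arrays.\<close>

definition interp :: "nat \<Rightarrow> nat \<Rightarrow> nat \<Rightarrow> int" where
  "interp N j i = lagr_val N j * (lagr_wt N j * lagr_wt N j) * plin (delat j (negpts N)) ! i"

lemma bits_list_eq_array:
  assumes "length xs = N"
  shows "bits_list L xs = int_array N L (Suc 0) (\<lambda>is. xs ! hd is)"
proof -
  have "map (bits L) xs = map (\<lambda>i. bits L (xs ! i)) [0..<N]"
    using assms by (intro nth_equalityI) auto
  then show ?thesis by simp
qed

lemma wc_spec:
  assumes "j \<le> N"
  shows "computes f_wc [enc_nat j, bits_list L (map (lagr_val N) [j..<N]), bits_list L (map (lagr_val N) [0..<N]),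
       bits_list L (negpts N), bits L 0, bits L 1]
     (enc_list (map (\<lambda>j. int_array N L (Suc 0) (\<lambda>is. interp N j (hd is))) [j..<N]))
     ((N - j) * (N * (2 * scalar_cost L + 100) + N * (N * (2 * scalar_cost L + 50) + 100) + array_cost N L (Suc 0) + 2 * scalar_cost L + 200) + 10)"
  using assms
proof (induction "N - j" arbitrary: j)
  case 0
  then show ?case by (intro computesI) (auto simp: prog_nth wc_body_def)
next
  case (Suc n)
  then have j: "j < N" by simp
  then have N: "0 < N" by simp
  from j have u: "[j..<N] = j # [Suc j..<N]" by (simp add: upt_conv_Cons)
  let ?w = "lagr_wt N j" and ?es = "map (lagr_val N) [0..<N]"
  define K where "K = N * (2 * scalar_cost L + 100) + N * (N * (2 * scalar_cost L + 50) + 100) + array_cost N L (Suc 0) + 2 * scalar_cost L + 200"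
  have IH: "computes f_wc [Pair Atom (enc_nat j), bits_list L (map (lagr_val N) [Suc j..<N]), bits_list L ?es,
       bits_list L (negpts N), bits L 0, bits L 1]
     (enc_list (map (\<lambda>j. int_array N L (Suc 0) (\<lambda>is. interp N j (hd is))) [Suc j..<N]))
     ((N - Suc j) * K + 10)"
    using Suc.hyps(1)[of "Suc j"] Suc.hyps(2) j by (simp only: K_def enc_nat.simps)
  have d: "computes f_del [enc_nat j, bits_list L ?es] (bits_list L (delat j ?es)) (20 * j + 10)"
    by (rule del_bits_list_spec) (use j in simp)
  have e: "computes f_eprod [bits L 0, bits_list L (delat j ?es), bits L 1] (bits L ?w) ((N - 1) * (2 * scalar_cost L + 50) + 10)"
    using eprod_spec[of L 0 "delat j ?es"] j by (simp add: lagr_wt_def)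
  have d2: "computes f_del [enc_nat j, bits_list L (negpts N)] (bits_list L (delat j (negpts N))) (20 * j + 10)"
    by (rule del_bits_list_spec) (use j in simp)
  have p: "computes f_plin [bits_list L (delat j (negpts N)), bits L 0, bits L 1]
     (int_array N L (Suc 0) (\<lambda>is. plin (delat j (negpts N)) ! hd is)) ((N - 1) * (N * (2 * scalar_cost L + 50) + 50) + 10)"
    using plin_spec[of "delat j (negpts N)" N L] j bits_list_eq_array[of "plin (delat j (negpts N))" N L] by simp
  have s: "computes f_scale [Pair Atom Atom, bits L (lagr_val N j * (?w * ?w)),
       int_array N L (Suc 0) (\<lambda>is. plin (delat j (negpts N)) ! hd is)]
     (int_array N L (Suc 0) (\<lambda>is. interp N j (hd is))) (array_cost N L (Suc 0))"
    using scale_spec[OF N, of "Suc 0" L "lagr_val N j * (?w * ?w)" "\<lambda>is. plin (delat j (negpts N)) ! hd is"]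
    by (simp only: interp_def enc_nat.simps)
  have t: "(N - j) * K = (N - Suc j) * K + K"
    using j by (metis Suc_diff_Suc add.commute mult_Suc)
  have "(N - 1) * (2 * scalar_cost L + 50) \<le> N * (2 * scalar_cost L + 50)"
    "(N - 1) * (N * (2 * scalar_cost L + 50) + 50) \<le> N * (N * (2 * scalar_cost L + 50) + 50)" by simp_all
  moreover have "N * (2 * scalar_cost L + 100) = N * (2 * scalar_cost L + 50) + 50 * N"
    "N * (N * (2 * scalar_cost L + 50) + 100) = N * (N * (2 * scalar_cost L + 50) + 50) + 50 * N" by (simp_all add: algebra_simps)
  ultimately have k: "(N - 1) * (2 * scalar_cost L + 50) + (N - 1) * (N * (2 * scalar_cost L + 50) + 50) + array_cost N L (Suc 0) +
     2 * scalar_cost L + 20 * j + 20 * j + 200 \<le> K"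
    using j unfolding K_def by linarith
  show ?case unfolding u K_def[symmetric] t
    apply (rule computesI)
     apply (simp add: prog_nth wc_body_def del: int_array.simps map_map)
     apply (rule callI[OF d])
     apply (rule callI[OF e])
     apply (rule callI[OF mul_bits_spec])
     apply (rule callI[OF mul_bits_spec])
     apply (rule callI[OF d2])
     apply (rule callI[OF p])
     apply (rule callI[OF s])
     apply (rule callI[OF IH])
    using k apply (simp del: int_array.simps map_map)
    apply simp
    done
qed

lemma pmul_spec:
  "computes f_pmul [bits_list L (map f is), bits_list L (map g is)] (bits_list L (map (\<lambda>i. f i * g i) is))
     (length is * (scalar_cost L + 50) + 10)"
proof (induction "is")
  case Nil
  show ?case by (rule computesI) (auto simp: prog_nth pmul_body_def)
next
  case (Cons i "is")
  show ?case
    by (rule computesI)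
      (auto simp: prog_nth pmul_body_def simp del: map_map intro!: callI[OF mul_bits_spec] callI[OF Cons])
qed

text \<open>Each column of the matrix of powers is the previous one multiplied entrywise by the
  points, starting from a column of ones, also at the point 0.\<close>

lemma vc_spec:
  "computes f_vc [enc_nat n, bits_list L (map (\<lambda>j. int j ^ i) [0..<N]), bits_list L (map int [0..<N])]
     (enc_list (map (\<lambda>i. int_array N L (Suc 0) (\<lambda>is. int (hd is) ^ i)) [i..<i + n]))
     (n * (N * (scalar_cost L + 50) + 50) + 10)"
proof (induction n arbitrary: i)
  case 0
  show ?case by (rule computesI) (auto simp: prog_nth vc_body_def)
next
  case (Suc n)
  have u: "[i..<i + Suc n] = i # [Suc i..<Suc i + n]"
    using upt_conv_Cons[of i "i + Suc n"] by simp
  have p: "computes f_pmul [bits_list L (map (\<lambda>j. int j ^ i) [0..<N]), bits_list L (map int [0..<N])]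
     (bits_list L (map (\<lambda>j. int j ^ Suc i) [0..<N])) (N * (scalar_cost L + 50) + 10)"
    using pmul_spec[of L "\<lambda>j. int j ^ i" "[0..<N]" int] by (simp add: mult.commute)
  have a: "bits_list L (map (\<lambda>j. int j ^ i) [0..<N]) = int_array N L (Suc 0) (\<lambda>is. int (hd is) ^ i)"
    by (simp add: comp_def)
  show ?case unfolding u
    apply (rule computesI)
     apply (simp add: prog_nth vc_body_def del: int_array.simps upt_Suc map_map power_Suc)
     apply (rule callI[OF p])
     apply (rule callI[OF Suc])
     apply (simp add: a del: int_array.simps upt_Suc map_map power_Suc)
    apply simp
    done
qed

text \<open>The word 1 is obtained from the zero word by setting its lowest bit, which requires a
  word of at least one bit.\<close>

lemma ctx_spec:
  assumes N: "0 < N"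
  shows "computes f_ctx [adj, caps, enc_nat N, bits (Suc L) 0]
     (enc_list [adj, caps, enc_nat N, bits (Suc L) 0, bits (Suc L) 1,
        cols N (Suc L) (\<lambda>i j. int j ^ i), cols N (Suc L) (interp N)])
     (100 * (N * (N * (N * scalar_cost (Suc L)))))"
proof -
  define M where "M = Suc L"
  define K where "K = scalar_cost M"
  have one: "bits M 1 = Pair (Pair Atom Atom) (bits L 0)" by (simp add: M_def)
  have z: "bits M 0 = Pair Atom (bits L 0)" by (simp add: M_def)
  have p: "computes f_pts [enc_nat N, bits M 0, bits M 1] (bits_list M (map int [0..<N])) (N * (K + 50) + 10)"
    using pts_spec[of N M 0 0 1] by (simp add: K_def del: map_map)
  have m: "computes f_mone [bits M 0] (bits M (-1)) (20 * M + 10)" by (rule mone_spec)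
  have n: "computes f_pts [enc_nat N, bits M 0, bits M (-1)] (bits_list M (negpts N)) (N * (K + 50) + 10)"
    using pts_spec[of N M 0 0 "-1"] by (simp add: K_def negpts_def del: map_map)
  have r: "computes f_rep [enc_nat N, bits M 1] (bits_list M (map (\<lambda>j. int j ^ 0) [0..<N])) (20 * N + 10)"
    using rep_spec[of N "bits M 1"] by (simp add: map_replicate_const)
  have v: "computes f_vc [enc_nat N, bits_list M (map (\<lambda>j. int j ^ 0) [0..<N]), bits_list M (map int [0..<N])]
     (cols N M (\<lambda>i j. int j ^ i)) (N * (N * (K + 50) + 50) + 10)"
    using vc_spec[of N M 0 N] by (simp only: add_0 cols_def K_def)
  have e: "computes f_es [Atom, bits_list M (map int [0..<N]), bits_list M (negpts N), bits M 1]
     (bits_list M (map (lagr_val N) [0..<N])) (N * (N * (2 * K + 100) + 100) + 10)"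
    using es_spec[of 0 N M] by (simp only: enc_nat.simps K_def diff_zero le0)
  have w: "computes f_wc [Atom, bits_list M (map (lagr_val N) [0..<N]), bits_list M (map (lagr_val N) [0..<N]),
       bits_list M (negpts N), bits M 0, bits M 1] (cols N M (interp N))
     (N * (N * (2 * K + 100) + N * (N * (2 * K + 50) + 100) + array_cost N M (Suc 0) + 2 * K + 200) + 10)"
    using wc_spec[of 0 N M] by (simp only: enc_nat.simps K_def diff_zero le0 cols_def)
  \<comment> \<open>Names for the monomials in \<open>N\<close> and \<open>K\<close> make the final
    estimate linear.\<close>
  define A where "A = N * K"
  define B where "B = N * A"
  define C where "C = N * B"
  have K: "100 \<le> K" "20 * M \<le> K" using scalar_cost_ge[of M] by (auto simp: K_def)
  define P where "P = N * N"
  define Q where "Q = N * P"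
  have le: "K \<le> A" "A \<le> B" "B \<le> C" using N by (auto simp: A_def B_def C_def)
  have a: "100 * N \<le> A" using mult_le_mono2[OF K(1), of N] by (simp add: A_def mult.commute)
  have b: "100 * P \<le> B" using mult_le_mono2[OF a, of N] by (simp add: B_def P_def mult_ac)
  have c: "100 * Q \<le> C" using mult_le_mono2[OF b, of N] by (simp add: C_def Q_def mult_ac)
  have eqs: "N * (K + 50) = A + 50 * N" "N * (N * (K + 50) + 50) = B + 50 * P + 50 * N"
    "N * (N * (2 * K + 100) + 100) = 2 * B + 100 * P + 100 * N"
    "N * (N * (2 * K + 100) + N * (N * (2 * K + 50) + 100) + array_cost N M (Suc 0) + 2 * K + 200) =
      4 * B + 400 * P + 2 * C + 50 * Q + 2 * A + 200 * N"
    by (simp_all add: A_def B_def C_def P_def Q_def algebra_simps array_cost_def K_def)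
  have t: "2 * (N * (K + 50)) + (20 * M) + 20 * N + N * (N * (K + 50) + 50) +
     N * (N * (2 * K + 100) + 100) +
     N * (N * (2 * K + 100) + N * (N * (2 * K + 50) + 100) + array_cost N M (Suc 0) + 2 * K + 200) + 1000 \<le> 100 * C"
  proof -
    have "100 \<le> C" "20 * M \<le> C" "A \<le> C" "100 * N \<le> C" "100 * P \<le> C"
      using K le a b by (meson order_trans)+
    then show ?thesis
      unfolding eqs(2-4) unfolding eqs(1) using le(3) c by simp
  qed
  have C: "100 * (N * (N * (N * scalar_cost (Suc L)))) = 100 * C"
    by (simp add: C_def B_def A_def K_def M_def)
  show ?thesis unfolding C unfolding M_def[symmetric]
    apply (rule computesI)
     apply (simp add: prog_nth ctx_body_def del: map_map)
    unfolding z right.simps one[symmetric]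
    unfolding z[symmetric]
     apply (rule callI[OF p])
     apply (rule callI[OF m])
     apply (rule callI[OF n])
     apply (rule callI[OF r])
     apply (rule callI[OF v])
     apply (rule callI[OF e])
     apply (rule callI[OF w])
    using t apply simp
    apply simp
    done
qed

section \<open>Interpolation and convolution\<close>

lemma poly_lmul: "poly (Poly (lmul l p as)) x = p + (x + l) * poly (Poly as) x"
  by (induction as arbitrary: p) (simp_all add: algebra_simps)

lemma poly_plin: "poly (Poly (plin ls)) x = (\<Prod>l\<leftarrow>ls. x + l)"
  by (induction ls) (simp_all add: poly_lmul)

lemma delat_map_upt: "j < N \<Longrightarrow> delat j (map f [0..<N]) = map f ([0..<j] @ [Suc j..<N])"
  by (simp add: delat_def take_map drop_map)

lemma upt_split: "j < N \<Longrightarrow> [0..<N] = [0..<j] @ j # [Suc j..<N]"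
  by (metis less_imp_add_positive upt_add_eq_append upt_conv_Cons zero_le)

definition lagr_prod :: "nat \<Rightarrow> int" where
  "lagr_prod N = (\<Prod>j\<leftarrow>[0..<N]. lagr_val N j)"

lemma lagr_val_nz: "j < N \<Longrightarrow> lagr_val N j \<noteq> 0"
  by (auto simp: lagr_val_def negpts_def delat_map_upt prod_list_zero_iff)

lemma lagr_wt_val:
  assumes "j < N"
  shows "lagr_val N j * lagr_wt N j = lagr_prod N"
proof -
  have "lagr_wt N j = (\<Prod>i\<leftarrow>[0..<j] @ [Suc j..<N]. lagr_val N i)"
    unfolding lagr_wt_def delat_map_upt[OF assms] by (simp add: comp_def)
  moreover have "lagr_prod N = (\<Prod>i\<leftarrow>[0..<j] @ j # [Suc j..<N]. lagr_val N i)"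
    unfolding lagr_prod_def using upt_split[OF assms] by simp
  ultimately show ?thesis by (simp add: mult_ac)
qed

lemma lagr_prod_nz: "lagr_prod N \<noteq> 0"
  using lagr_val_nz by (auto simp: lagr_prod_def prod_list_zero_iff)

text \<open>Up to the common factor, interpolating the values of x^s at the points 0, ..., N - 1
  returns x^s: the difference \<open>Q\<close> has degree below \<open>N\<close> and
  \<open>N\<close> roots, so all its coefficients vanish.\<close>

lemma interp_inverse:
  assumes s: "s < N" and i: "i < N"
  shows "(\<Sum>j<N. interp N j i * int j ^ s) = (if i = s then (lagr_prod N)\<^sup>2 else 0)"
proof -
  define c where "c j = int j ^ s * (lagr_val N j * (lagr_wt N j * lagr_wt N j))" for j
  define Q where "Q = (\<Sum>j<N. smult (c j) (Poly (plin (delat j (negpts N))))) - monom ((lagr_prod N)\<^sup>2) s"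
  have "degree (smult (c j) (Poly (plin (delat j (negpts N))))) \<le> N - 1" if "j < N" for j
  proof (rule order.trans[OF degree_smult_le], rule degree_le, safe)
    fix k assume "N - 1 < k"
    then show "coeff (Poly (plin (delat j (negpts N)))) k = 0"
      using that by (simp add: nth_default_beyond)
  qed
  then have "degree Q \<le> N - 1"
    unfolding Q_def using s
    by (intro degree_diff_le degree_sum_le order.trans[OF degree_monom_le]) auto
  then have dQ: "degree Q < N" using s by simp
  have root: "poly Q (int k) = 0" if k: "k < N" for k
  proof -
    have "poly (Poly (plin (delat j (negpts N)))) (int k) = (if j = k then lagr_val N k else 0)"
      if j: "j < N" for j
    proof (cases "j = k")
      case True
      then show ?thesis by (simp add: poly_plin lagr_val_def)
    next
      case False
      then have "- int k \<in> set (delat j (negpts N))"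
        using j k by (auto simp: negpts_def delat_map_upt image_iff)
      then have "0 \<in> set (map ((+) (int k)) (delat j (negpts N)))" by force
      then show ?thesis using False by (simp add: poly_plin prod_list_zero_iff)
    qed
    then have "(\<Sum>j<N. c j * poly (Poly (plin (delat j (negpts N)))) (int k)) =
      (\<Sum>j<N. if j = k then c k * lagr_val N k else 0)"
      by (intro sum.cong) auto
    also have "\<dots> = c k * lagr_val N k" using k by simp
    also have "\<dots> = int k ^ s * (lagr_val N k * lagr_wt N k)\<^sup>2"
      by (simp add: c_def power2_eq_square mult_ac)
    finally show ?thesis
      using lagr_wt_val[OF k] by (simp add: Q_def poly_sum poly_monom mult.commute)
  qed
  have "Q = 0"
  proof (rule ccontr)
    assume "Q \<noteq> 0"
    then have "card {x. poly Q x = 0} \<le> degree Q" "finite {x. poly Q x = 0}"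
      by (simp_all add: card_poly_roots_bound poly_roots_finite)
    moreover have "int ` {..<N} \<subseteq> {x. poly Q x = 0}" using root by auto
    ultimately have "card (int ` {..<N}) \<le> degree Q" by (meson card_mono le_trans)
    with dQ show False by (simp add: card_image)
  qed
  then have "coeff Q i = 0" by simp
  then have "(\<Sum>j<N. c j * coeff (Poly (plin (delat j (negpts N)))) i) = (if i = s then (lagr_prod N)\<^sup>2 else 0)"
    by (auto simp: Q_def coeff_sum coeff_monom)
  moreover have "c j * coeff (Poly (plin (delat j (negpts N)))) i = interp N j i * int j ^ s"
    if "j < N" for j
    using that i by (simp add: c_def interp_def nth_default_nth mult_ac)
  ultimately show ?thesis by simp
qed

section \<open>Exactness of evaluation followed by interpolation\<close>

lemma finite_grid: "finite (grid N D)"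
  by (induction D) (auto simp: grid_Suc)

lemma sum_grid_Suc: "sum h (grid N (Suc D)) = (\<Sum>i<N. \<Sum>ys\<in>grid N D. h (i # ys))"
proof -
  have "sum h (grid N (Suc D)) = (\<Sum>i<N. sum h ((#) i ` grid N D))"
    unfolding grid_Suc by (rule sum.UNION_disjoint) (auto simp: finite_grid)
  also have "\<dots> = (\<Sum>i<N. \<Sum>ys\<in>grid N D. h (i # ys))"
    by (rule sum.cong[OF refl]) (simp add: sum.reindex)
  finally show ?thesis .
qed

lemma card_grid: "card (grid N D) = N ^ D"
  using sum_grid_Suc[of "\<lambda>_. 1 :: nat" N]
  by (induction D) (simp_all add: card_eq_sum del: sum_constant, simp)

text \<open>For the polynomial with coefficients \<open>f\<close>: the degree in the i-th variable
  is at most \<open>a ! i\<close>.\<close>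

definition supported_below :: "nat \<Rightarrow> (nat list \<Rightarrow> int) \<Rightarrow> nat list \<Rightarrow> bool" where
  "supported_below N f a \<longleftrightarrow> (\<forall>xs\<in>grid N (length a). f xs \<noteq> 0 \<longrightarrow> list_all2 (\<le>) xs a)"

definition convolution :: "nat \<Rightarrow> nat \<Rightarrow> (nat list \<Rightarrow> int) \<Rightarrow> (nat list \<Rightarrow> int) \<Rightarrow> nat list \<Rightarrow> int" where
  "convolution N D f g xs =
     (\<Sum>ys\<in>grid N D. \<Sum>zs\<in>grid N D. if map2 (+) ys zs = xs then f ys * g zs else 0)"

lemma sum_list_upt: "(\<Sum>j\<leftarrow>[0..<N]. h j) = (\<Sum>j<N. h j :: int)"
  by (simp add: interv_sum_list_conv_sum_set_nat atLeast0LessThan)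

text \<open>Evaluation acts on the first axis only, so it keeps the degree bounds of the other axes
  and the induction hypothesis applies to the evaluated slices. Each interpolation contributes one
  factor \<open>(lagr_prod N)\<^sup>2\<close>.\<close>

lemma interp_conv_eq:
  assumes "supported_below N f a" "supported_below N g b" "length a = D" "length b = D" "list_all2 (\<lambda>x y. x + y < N) a b"
    "xs \<in> grid N D"
  shows "interp_conv N (\<lambda>i j. int j ^ i) (interp N) D f g xs = ((lagr_prod N)\<^sup>2) ^ D * convolution N D f g xs"
  using assms
proof (induction D arbitrary: f g a b xs)
  case 0
  then show ?case by (simp add: convolution_def)
next
  case (Suc D)
  from Suc.prems(3,4) obtain a0 a' b0 b' where ab: "a = a0 # a'" "b = b0 # b'" by (cases a; cases b) auto
  from Suc.prems(6) obtain i xs' where xs: "xs = i # xs'" "i < N" "xs' \<in> grid N D"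
    by (auto simp: grid_Suc)
  let ?M = "(lagr_prod N)\<^sup>2"
  define F where "F j ys = (\<Sum>i<N. int j ^ i * f (i # ys))" for j ys
  define G where "G j ys = (\<Sum>i<N. int j ^ i * g (i # ys))" for j ys
  have sF: "supported_below N (F j) a'" for j
    unfolding supported_below_def
  proof safe
    fix ys assume ys: "ys \<in> grid N (length a')" "F j ys \<noteq> 0"
    then obtain i where "i < N" "f (i # ys) \<noteq> 0"
      unfolding F_def by (metis (no_types, lifting) lessThan_iff mult_zero_right sum.neutral)
    with Suc.prems(1) ys show "list_all2 (\<le>) ys a'" by (force simp: supported_below_def ab)
  qed
  have sG: "supported_below N (G j) b'" for j
    unfolding supported_below_def
  proof safe
    fix ys assume ys: "ys \<in> grid N (length b')" "G j ys \<noteq> 0"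
    then obtain i where "i < N" "g (i # ys) \<noteq> 0"
      unfolding G_def by (metis (no_types, lifting) lessThan_iff mult_zero_right sum.neutral)
    with Suc.prems(2) ys show "list_all2 (\<le>) ys b'" by (force simp: supported_below_def ab)
  qed
  \<comment> \<open>\<open>interp_inverse\<close> needs exponents below \<open>N\<close>. Where the
    product of the coefficients is nonzero the degree bounds supply this; elsewhere both sides are
    0.\<close>
  have fg: "f (i' # ys) * g (i'' # zs) * (\<Sum>j<N. interp N j i * int j ^ (i' + i'')) =
      f (i' # ys) * g (i'' # zs) * (if i = i' + i'' then ?M else 0)"
    if "i' < N" "i'' < N" "ys \<in> grid N D" "zs \<in> grid N D" for i' i'' ys zs
  proof (cases "f (i' # ys) = 0 \<or> g (i'' # zs) = 0")
    case False
    with that Suc.prems have "i' \<le> a0" "i'' \<le> b0" "a0 + b0 < N"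
      by (auto simp: supported_below_def ab)
    then have "i' + i'' < N" by simp
    from interp_inverse[OF this xs(2)] show ?thesis by simp
  qed auto
  have "interp_conv N (\<lambda>i j. int j ^ i) (interp N) (Suc D) f g xs =
      (\<Sum>j<N. interp N j i * interp_conv N (\<lambda>i j. int j ^ i) (interp N) D (F j) (G j) xs')"
    by (simp add: sum_list_upt xs F_def[abs_def] G_def[abs_def])
  also have "\<dots> = (\<Sum>j<N. interp N j i * (?M ^ D * convolution N D (F j) (G j) xs'))"
    by (subst Suc.IH[OF sF sG]) (use Suc.prems ab xs in auto)
  also have "\<dots> = ?M ^ D * (\<Sum>j<N. interp N j i * convolution N D (F j) (G j) xs')"
    by (simp add: sum_distrib_left mult_ac)
  also have "(\<Sum>j<N. interp N j i * convolution N D (F j) (G j) xs') =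
     (\<Sum>j<N. \<Sum>ys\<in>grid N D. \<Sum>zs\<in>grid N D. \<Sum>i'<N. \<Sum>i''<N. if map2 (+) ys zs = xs' then
        f (i' # ys) * g (i'' # zs) * (interp N j i * int j ^ (i' + i'')) else 0)"
    unfolding convolution_def sum_distrib_left F_def G_def
    by (intro sum.cong refl) (simp add: sum_product sum_distrib_left power_add mult_ac if_distrib cong: if_cong,
        intro impI, subst sum.swap, intro sum.cong refl, simp)
  \<comment> \<open>The sum over the evaluation points moves innermost, where
    \<open>interp_inverse\<close> evaluates it through \<open>fg\<close>.\<close>
  also have "\<dots> = (\<Sum>ys\<in>grid N D. \<Sum>zs\<in>grid N D. \<Sum>i'<N. \<Sum>i''<N. \<Sum>j<N. if map2 (+) ys zs = xs' then
        f (i' # ys) * g (i'' # zs) * (interp N j i * int j ^ (i' + i'')) else 0)"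
    by (subst sum.swap, rule sum.cong[OF refl], subst sum.swap, rule sum.cong[OF refl],
        subst sum.swap, rule sum.cong[OF refl], rule sum.swap)
  also have "\<dots> = (\<Sum>ys\<in>grid N D. \<Sum>zs\<in>grid N D. \<Sum>i'<N. \<Sum>i''<N. if map2 (+) ys zs = xs' then
        f (i' # ys) * g (i'' # zs) * (\<Sum>j<N. interp N j i * int j ^ (i' + i'')) else 0)"
    by (intro sum.cong refl) (simp add: sum_distrib_left)
  also have "\<dots> = (\<Sum>ys\<in>grid N D. \<Sum>zs\<in>grid N D. \<Sum>i'<N. \<Sum>i''<N. if map2 (+) ys zs = xs' then
        f (i' # ys) * g (i'' # zs) * (if i = i' + i'' then ?M else 0) else 0)"
    by (intro sum.cong refl) (simp add: fg)
  also have "\<dots> = (\<Sum>ys\<in>grid N D. \<Sum>zs\<in>grid N D. \<Sum>i'<N. \<Sum>i''<N.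
      ?M * (if map2 (+) (i' # ys) (i'' # zs) = xs then f (i' # ys) * g (i'' # zs) else 0))"
    by (intro sum.cong refl) (auto simp: xs)
  also have "\<dots> = (\<Sum>i'<N. \<Sum>ys\<in>grid N D. \<Sum>i''<N. \<Sum>zs\<in>grid N D.
      ?M * (if map2 (+) (i' # ys) (i'' # zs) = xs then f (i' # ys) * g (i'' # zs) else 0))"
    by (subst (2) sum.swap, subst sum.swap, rule sum.cong[OF refl], rule sum.cong[OF refl], rule sum.swap)
  also have "\<dots> = ?M * convolution N (Suc D) f g xs"
    unfolding convolution_def sum_grid_Suc sum_distrib_left ..
  finally show ?case by simp
qed

lemma convolution_nonneg:
  assumes "\<And>ys. 0 \<le> f ys" "\<And>ys. 0 \<le> g ys"
  shows "0 \<le> convolution N D f g xs"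
  unfolding convolution_def using assms by (auto intro!: sum_nonneg)

text \<open>Nonnegative terms cannot cancel, so the support of the product is the sumset of the
  supports.\<close>

lemma convolution_nonzero_iff:
  assumes "\<And>ys. 0 \<le> f ys" "\<And>ys. 0 \<le> g ys"
  shows "convolution N D f g xs \<noteq> 0 \<longleftrightarrow>
    (\<exists>ys\<in>grid N D. \<exists>zs\<in>grid N D. map2 (+) ys zs = xs \<and> f ys \<noteq> 0 \<and> g zs \<noteq> 0)"
  unfolding convolution_def using assms
  by (subst sum_nonneg_eq_0_iff, simp add: finite_grid, force intro: sum_nonneg,
      subst sum_nonneg_eq_0_iff) (auto simp: finite_grid)

lemma convolution_le:
  assumes "\<And>ys. 0 \<le> f ys \<and> f ys \<le> 1" "\<And>ys. 0 \<le> g ys \<and> g ys \<le> 1"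
  shows "convolution N D f g xs \<le> int N ^ (2 * D)"
proof -
  have "f ys * g zs \<le> 1" for ys zs using assms mult_le_one[of "f ys" "g zs"] by simp
  then have "convolution N D f g xs \<le> (\<Sum>ys\<in>grid N D. \<Sum>zs\<in>grid N D. 1)"
    unfolding convolution_def by (intro sum_mono) auto
  also have "\<dots> = int N ^ (2 * D)" by (simp add: card_grid mult_2 power_add)
  finally show ?thesis .
qed

section \<open>Size of the scaling factor\<close>

lemma abs_prod_list_le:
  "(\<And>x. x \<in> set xs \<Longrightarrow> \<bar>f x\<bar> \<le> (c :: int)) \<Longrightarrow> 1 \<le> c \<Longrightarrow> \<bar>\<Prod>x\<leftarrow>xs. f x\<bar> \<le> c ^ length xs"
proof (induction xs)
  case (Cons x xs)
  then show ?case by (auto simp: abs_mult intro!: mult_mono)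
qed simp

lemma abs_lagr_val_le:
  assumes "j < N"
  shows "\<bar>lagr_val N j\<bar> \<le> int N ^ N"
proof -
  have "\<bar>lagr_val N j\<bar> \<le> int N ^ length (delat j (negpts N))"
    unfolding lagr_val_def
  proof (rule abs_prod_list_le)
    fix x assume "x \<in> set (delat j (negpts N))"
    then show "\<bar>int j + x\<bar> \<le> int N" using assms by (auto simp: negpts_def delat_map_upt)
  qed (use assms in simp)
  also have "\<dots> \<le> int N ^ N" using assms by (intro power_increasing) auto
  finally show ?thesis .
qed

text \<open>There are \<open>N\<close> factors, each a product of fewer than \<open>N\<close>
  differences of points; squaring doubles the exponent.\<close>

lemma lagr_prod_sq_le: "0 < N \<Longrightarrow> (lagr_prod N)\<^sup>2 \<le> int N ^ (2 * (N * N))"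
proof -
  assume N: "0 < N"
  have "\<bar>lagr_prod N\<bar> \<le> (int N ^ N) ^ length [0..<N]"
    unfolding lagr_prod_def using N by (intro abs_prod_list_le abs_lagr_val_le) auto
  then have "\<bar>lagr_prod N\<bar> \<le> int N ^ (N * N)" by (simp add: power_mult)
  then have "\<bar>lagr_prod N\<bar>\<^sup>2 \<le> (int N ^ (N * N))\<^sup>2" by (rule power_mono) simp
  then show ?thesis by (simp add: power_mult[symmetric] mult.commute)
qed

section \<open>Tables as sets of rows\<close>

definition idx :: "'v list \<Rightarrow> 'v \<Rightarrow> nat" where
  "idx vs v = length (takeWhile (\<lambda>u. u \<noteq> v) vs)"

lemma idx_less: "v \<in> set vs \<Longrightarrow> idx vs v < length vs"
  unfolding idx_def by (induction vs) auto

lemma nth_idx: "v \<in> set vs \<Longrightarrow> vs ! idx vs v = v"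
  unfolding idx_def by (induction vs) auto

lemma inj_on_idx: "inj_on (idx vs) (set vs)"
  by (metis inj_onI nth_idx)

locale instance_graph =
  fixes V :: "'v set" and E :: "'v set set" and c :: "'v \<Rightarrow> nat" and vs :: "'v list"
  assumes simple: "simple_graph V E" and distinct_vs: "distinct vs" and set_vs: "set vs = V"
begin

abbreviation bagl :: "'v set \<Rightarrow> 'v list" where
  "bagl X \<equiv> enum_bag vs X"

lemma finite_V: "finite V"
  using simple by (simp add: simple_graph_def)

lemma set_bagl: "X \<subseteq> V \<Longrightarrow> set (bagl X) = X"
  by (auto simp: enum_bag_def set_vs)

lemma distinct_bagl: "distinct (bagl X)"
  by (simp add: enum_bag_def distinct_vs)

lemma length_bagl: "X \<subseteq> V \<Longrightarrow> length (bagl X) = card X"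
  using distinct_card[OF distinct_bagl, of X] set_bagl by simp

text \<open>Bags are listed in the order of \<open>vs\<close>, so introducing or forgetting a vertex
  changes the list at one position and leaves the rest in place.\<close>

lemma bagl_insert:
  assumes "insert v X \<subseteq> V" "v \<notin> X"
  obtains pre post where "bagl (insert v X) = pre @ v # post" "bagl X = pre @ post"
proof -
  from assms obtain as bs where vs: "vs = as @ v # bs" using set_vs by (metis insert_subset split_list)
  then have "v \<notin> set as" "v \<notin> set bs" using distinct_vs by auto
  then have "filter (\<lambda>u. u = v \<or> u \<in> X) as = filter (\<lambda>u. u \<in> X) as"
    "filter (\<lambda>u. u = v \<or> u \<in> X) bs = filter (\<lambda>u. u \<in> X) bs"
    by (auto intro!: filter_cong)
  then show thesis using that[of "filter (\<lambda>u. u \<in> X) as" "filter (\<lambda>u. u \<in> X) bs"] vs assms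
    by (simp add: enum_bag_def)
qed

definition row_of :: "'v set \<Rightarrow> ('v \<rightharpoonup> nat) \<times> nat \<Rightarrow> row" where
  "row_of X = (\<lambda>(d, k). (map (\<lambda>v. the (d v)) (bagl X), k))"

lemma enc_entry_eq: "enc_entry vs X e = erow (row_of X e)"
  by (cases e) (simp add: enc_entry_def erow_def row_of_def comp_def)

text \<open>The table as the program handles it, with each map on the bag replaced by its list of
  values.\<close>

definition Rset :: "'v rtree \<Rightarrow> row set" where
  "Rset t = row_of (bag t) ` R' E c t"

lemma in_Rset_iff: "(ds, k) \<in> Rset t \<longleftrightarrow> (\<exists>d. (d, k) \<in> R' E c t \<and> ds = map (\<lambda>v. the (d v)) (bagl (bag t)))"
  by (force simp: Rset_def row_of_def)

lemma bag_subset_V: "all_separated V E t \<Longrightarrow> bag t \<subseteq> V" "all_separated V E t \<Longrightarrow> Vset t \<subseteq> V"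
  "all_separated V E t \<Longrightarrow> Yset t \<subseteq> V"
  using all_separated_root[of V E t] bag_subset_Vset[of t] by (auto simp: separated_def Yset_def)

lemma R'_dom: "all_separated V E t \<Longrightarrow> (d, k) \<in> R' E c t \<Longrightarrow> dom d = bag t"
  using R'_eq_R[OF simple, of t c] R_dom by metis

text \<open>Read off from the orientation that the equality with \<open>R\<close> provides: an arc
  leaving a vertex of the bag ends at a neighbour in \<open>Y\<close>. Here correctness enters the
  analysis of the running time.\<close>

lemma R'_bounds:
  assumes "all_separated V E t" "(d, k) \<in> R' E c t"
  shows "k \<le> card (Yset t)" "u \<in> bag t \<Longrightarrow> the (d u) \<le> card (neighbours E u \<inter> Yset t)"
proof -
  from assms R'_eq_R[OF simple, of t c] obtain D where D: "realizes E c t d k D" by (auto simp: in_R_iff)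
  then have o: "orientation (Gedges E t) D" and d: "\<And>u. u \<in> bag t \<Longrightarrow> d u = Some (outdeg D u)"
    and k: "k \<le> card (Yset t)" by (auto simp: realizes_def)
  show "k \<le> card (Yset t)" by fact
  show "the (d u) \<le> card (neighbours E u \<inter> Yset t)" if u: "u \<in> bag t"
  proof -
    have "{w. (u, w) \<in> D} \<subseteq> neighbours E u \<inter> Yset t"
      using orientation_arc[OF o] u by (fastforce simp: Gedges_iff neighbours_def Yset_def insert_commute)
    moreover have "finite (neighbours E u \<inter> Yset t)"
      using bag_subset_V(3)[OF assms(1)] finite_V by (meson finite_Int finite_subset)
    ultimately show ?thesis using d[OF u] by (simp add: outdeg_def card_mono)
  qed
qed

lemma Rset_leaf: "Rset (Node {} []) = {([], 0)}"
  by (simp add: Rset_def row_of_def enum_bag_def)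

lemma Rset_length: "(ds, k) \<in> Rset t \<Longrightarrow> length ds = length (bagl (bag t))"
  by (auto simp: in_Rset_iff)

lemma Rset_bounds:
  assumes "all_separated V E t" "(ds, k) \<in> Rset t"
  shows "k \<le> card (Yset t)" "list_all2 (\<le>) ds (map (\<lambda>u. card (neighbours E u \<inter> Yset t)) (bagl (bag t)))"
proof -
  from assms(2) obtain d where d: "(d, k) \<in> R' E c t" "ds = map (\<lambda>v. the (d v)) (bagl (bag t))"
    by (auto simp: in_Rset_iff)
  note b = R'_bounds[OF assms(1) d(1)]
  show "k \<le> card (Yset t)" by (rule b(1))
  show "list_all2 (\<le>) ds (map (\<lambda>u. card (neighbours E u \<inter> Yset t)) (bagl (bag t)))"
    unfolding d(2) list.rel_map
    by (rule list.rel_refl_strong) (use b(2) set_bagl[OF bag_subset_V(1)[OF assms(1)]] in simp)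
qed

lemma Rset_introduce:
  assumes sep: "all_separated V E (Node X [t1])" and v: "introduces v X (bag t1)"
    and l: "bagl X = pre @ v # post" "bagl (bag t1) = pre @ post"
  shows "Rset (Node X [t1]) = irow (length pre) ` Rset t1"
proof -
  have X: "X = insert v (bag t1)" "v \<notin> bag t1" using v by (auto simp: introduces_def)
  have sep1: "all_separated V E t1" using all_separated_child[OF sep] by simp
  have u: "introduces v' X (bag t1) \<longleftrightarrow> v' = v" "\<not> forgets v' X (bag t1)" for v'
    using X by (auto simp: introduces_def forgets_def)
  have R: "(d, k) \<in> R' E c (Node X [t1]) \<longleftrightarrow> dom d = X \<and> (d |` (- {v}), k) \<in> R' E c t1 \<and> d v = Some 0" for d k
    by (simp add: u)
  have nv: "v \<notin> set (pre @ post)" using l(1) distinct_bagl[of X] by auto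
  show ?thesis
  proof (intro subset_antisym subsetI)
    fix r assume "r \<in> Rset (Node X [t1])"
    then obtain ds k where r: "r = (ds, k)" "(ds, k) \<in> Rset (Node X [t1])" by (cases r) auto
    from r(2) obtain d where d: "(d |` (- {v}), k) \<in> R' E c t1" "d v = Some 0" "ds = map (\<lambda>v. the (d v)) (pre @ v # post)"
      by (auto simp: in_Rset_iff R l simp del: R'.simps)
    let ?d1 = "d |` (- {v})"
    have "map (\<lambda>v. the (?d1 v)) (pre @ post) = map (\<lambda>v. the (d v)) (pre @ post)"
      using nv by (auto simp: restrict_map_def)
    then have "(ds, k) = irow (length pre) (map (\<lambda>v. the (?d1 v)) (pre @ post), k)"
      using d by (simp add: irow_def insat_def)
    moreover have "(map (\<lambda>v. the (?d1 v)) (pre @ post), k) \<in> Rset t1"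
      using d(1) unfolding in_Rset_iff l by blast
    ultimately show "r \<in> irow (length pre) ` Rset t1" unfolding r(1) by (rule image_eqI)
  next
    fix r assume "r \<in> irow (length pre) ` Rset t1"
    then obtain ds k where r: "r = irow (length pre) (ds, k)" "(ds, k) \<in> Rset t1" by auto
    from r(2) obtain d1 where d1: "(d1, k) \<in> R' E c t1" "ds = map (\<lambda>v. the (d1 v)) (pre @ post)"
      by (auto simp: in_Rset_iff l)
    have dom: "dom d1 = bag t1" using R'_dom[OF sep1 d1(1)] .
    let ?d = "d1(v \<mapsto> 0)"
    have "d1 v = None" using dom X by auto
    then have "?d |` (- {v}) = d1" by (auto simp: restrict_map_def fun_eq_iff)
    then have "(?d, k) \<in> R' E c (Node X [t1])" using R[of ?d k] dom X d1(1) by simp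
    moreover have "map (\<lambda>v. the (?d v)) (pre @ v # post) = insat (length pre) 0 ds"
      using nv d1 by (simp add: insat_def)
    ultimately show "r \<in> Rset (Node X [t1])"
      unfolding r(1) irow_def by (simp add: in_Rset_iff l del: R'.simps fun_upd_apply) metis
  qed
qed

lemma Rset_join:
  assumes sep: "all_separated V E (Node X [t1, t2])" and X: "bag t1 = X" "bag t2 = X"
  shows "Rset (Node X [t1, t2]) =
    {(map2 (+) ds1 ds2, k1 + k2) | ds1 k1 ds2 k2. (ds1, k1) \<in> Rset t1 \<and> (ds2, k2) \<in> Rset t2}"
proof -
  have XV: "X \<subseteq> V" using bag_subset_V(1)[OF sep] by simp
  have R: "(d, k) \<in> R' E c (Node X [t1, t2]) \<longleftrightarrow> dom d = X \<and> (\<exists>d1 k1 d2 k2. (d1, k1) \<in> R' E c t1 \<and>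
     (d2, k2) \<in> R' E c t2 \<and> (\<forall>u\<in>X. the (d u) = the (d1 u) + the (d2 u)) \<and> k = k1 + k2)" for d k
    by auto
  have m: "map2 (+) (map f xs) (map g xs) = map (\<lambda>x. f x + g x) xs" for f g :: "'v \<Rightarrow> nat" and xs
    by (induction xs) auto
  show ?thesis
  proof (intro set_eqI iffI; clarify)
    fix ds k assume "(ds, k) \<in> Rset (Node X [t1, t2])"
    then obtain d d1 k1 d2 k2 where d: "(d1, k1) \<in> R' E c t1" "(d2, k2) \<in> R' E c t2"
      "\<forall>u\<in>X. the (d u) = the (d1 u) + the (d2 u)" "k = k1 + k2" "ds = map (\<lambda>v. the (d v)) (bagl X)"
      by (auto simp: in_Rset_iff R simp del: R'.simps)
    have "ds = map2 (+) (map (\<lambda>v. the (d1 v)) (bagl X)) (map (\<lambda>v. the (d2 v)) (bagl X))"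
      unfolding m d(5) using d(3) set_bagl[OF XV] by simp
    moreover have "(map (\<lambda>v. the (d1 v)) (bagl X), k1) \<in> Rset t1" "(map (\<lambda>v. the (d2 v)) (bagl X), k2) \<in> Rset t2"
      using d(1,2) X by (auto simp: in_Rset_iff)
    ultimately show "\<exists>ds1 k1 ds2 k2. (ds, k) = (map2 (+) ds1 ds2, k1 + k2) \<and> (ds1, k1) \<in> Rset t1 \<and> (ds2, k2) \<in> Rset t2"
      using d(4) by blast
  next
    fix ds1 k1 ds2 k2 assume "(ds1, k1) \<in> Rset t1" "(ds2, k2) \<in> Rset t2"
    then obtain d1 d2 where d: "(d1, k1) \<in> R' E c t1" "(d2, k2) \<in> R' E c t2"
      "ds1 = map (\<lambda>v. the (d1 v)) (bagl X)" "ds2 = map (\<lambda>v. the (d2 v)) (bagl X)"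
      using X by (auto simp: in_Rset_iff)
    define d where "d = (\<lambda>u. if u \<in> X then Some (the (d1 u) + the (d2 u)) else None)"
    have "dom d = X" by (auto simp: d_def dom_def)
    moreover have "\<forall>u\<in>X. the (d u) = the (d1 u) + the (d2 u)" by (simp add: d_def)
    ultimately have "(d, k1 + k2) \<in> R' E c (Node X [t1, t2])" unfolding R using d(1,2) by blast
    moreover have "map2 (+) ds1 ds2 = map (\<lambda>v. the (d v)) (bagl X)"
      unfolding d(3,4) m using set_bagl[OF XV] by (simp add: d_def)
    ultimately show "(map2 (+) ds1 ds2, k1 + k2) \<in> Rset (Node X [t1, t2])"
      unfolding in_Rset_iff by (intro exI[of _ d]) simp
  qed
qed

definition mark :: "'v set \<Rightarrow> 'v list \<Rightarrow> nat list" where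
  "mark A us = map (\<lambda>u. if u \<in> A then 1 else 0) us"

text \<open>The bounds on \<open>A\<close> are restated without subtraction, hence in natural
  numbers, and the decrements of \<open>d\<close> on \<Delta> become the addition of a
  characteristic vector to the row of the child. In this form the rule is a sum of exponent
  vectors.\<close>

lemma Rset_forget:
  assumes sep: "all_separated V E (Node X [t1])" and v: "forgets v X (bag t1)"
    and l: "bagl (bag t1) = pre @ v # post" "bagl X = pre @ post"
    and B: "B = card (neighbours E v \<inter> Yset (Node X [t1]))"
  shows "Rset (Node X [t1]) =
    {(delat (length pre) ds1, k) | ds1 k. (ds1, k) \<in> Rset t1 \<and> ds1 ! length pre = B} \<union>
    {(map2 (+) (delat (length pre) ds1) (mark \<Delta> (bagl X)), Suc k1) | ds1 k1 \<Delta>.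
       (ds1, k1) \<in> Rset t1 \<and> \<Delta> \<subseteq> neighbours E v \<inter> X \<and> ds1 ! length pre \<le> B \<and>
       B + card \<Delta> \<le> c v + ds1 ! length pre}" (is "_ = ?A \<union> ?B")
proof -
  let ?t = "Node X [t1]" and ?p = "length pre"
  have X: "bag t1 = insert v X" "v \<notin> X" using v by (auto simp: forgets_def)
  have XV: "X \<subseteq> V" using bag_subset_V(1)[OF sep] by simp
  have sep1: "all_separated V E t1" using all_separated_child[OF sep] by simp
  have u: "forgets v' X (bag t1) \<longleftrightarrow> v' = v" "\<not> introduces v' X (bag t1)" for v'
    using X by (auto simp: introduces_def forgets_def)
  have R: "(d, k) \<in> R' E c ?t \<longleftrightarrow> dom d = X \<and>
     (\<exists>d1 k1. (d1, k1) \<in> R' E c t1 \<and> forget_rule E c ?t v (bag t1) d k d1 k1)" for d k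
    by (auto simp: u)
  have sX: "set (pre @ post) = X" using set_bagl[OF XV] l by simp
  have nth: "map (\<lambda>v. the (d1 v)) (bagl (bag t1)) ! ?p = the (d1 v)"
    and del: "delat ?p (map (\<lambda>v. the (d1 v)) (bagl (bag t1))) = map (\<lambda>v. the (d1 v)) (pre @ post)" for d1 :: "'v \<rightharpoonup> nat"
    unfolding l by (simp_all add: nth_append delat_def)
  have m: "map2 (+) (map f us) (mark \<Delta> us) = map (\<lambda>u. f u + (if u \<in> \<Delta> then 1 else 0)) us" for f us \<Delta>
    unfolding mark_def by (induction us) auto
  show ?thesis
  proof (intro subset_antisym subsetI)
    fix r assume "r \<in> Rset ?t"
    then obtain ds k where r: "r = (ds, k)" "(ds, k) \<in> Rset ?t" by (cases r) auto
    from r(2) obtain d d1 k1 where d: "dom d = X" "(d1, k1) \<in> R' E c t1" "forget_rule E c ?t v (bag t1) d k d1 k1"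
      "ds = map (\<lambda>v. the (d v)) (pre @ post)"
      by (auto simp: in_Rset_iff R l simp del: R'.simps)
    let ?ds1 = "map (\<lambda>v. the (d1 v)) (bagl (bag t1))"
    have r1: "(?ds1, k1) \<in> Rset t1" using d(2) by (auto simp: in_Rset_iff)
    from d(3) show "r \<in> ?A \<union> ?B"
      unfolding forget_rule_def B[symmetric]
    proof (elim disjE conjE exE)
      assume f: "k1 = k" "d1 v = Some B" "d1 |` (- {v}) = d"
      have "ds = delat ?p ?ds1"
        unfolding d(4) del f(3)[symmetric] using sX X(2) by (auto simp: restrict_map_def)
      moreover have "?ds1 ! ?p = B" using f nth by simp
      ultimately have "(ds, k) \<in> ?A" using r1 f(1) by blast
      then show ?thesis unfolding r(1) by (rule UnI1)
    next
      fix \<Delta> A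
      assume f: "int k1 = int k - 1" "\<Delta> \<subseteq> neighbours E v \<inter> bag ?t"
        "A \<in> {int B - int (c v) + int (card \<Delta>)..int B}" "int (the (d1 v)) = A"
        "\<forall>u\<in>\<Delta>. int (the (d1 u)) = int (the (d u)) - 1"
        "\<forall>u\<in>bag t1 - (\<Delta> \<union> {v}). the (d1 u) = the (d u)"
      have "the (d u) = the (d1 u) + (if u \<in> \<Delta> then 1 else 0)" if "u \<in> X" for u
        using f(5,6) that X by (cases "u \<in> \<Delta>") auto
      then have "ds = map2 (+) (delat ?p ?ds1) (mark \<Delta> (bagl X))"
        unfolding d(4) del unfolding l(2) m using sX by auto
      moreover have "k = Suc k1" "\<Delta> \<subseteq> neighbours E v \<inter> X" using f by auto
      moreover have "?ds1 ! ?p \<le> B" "B + card \<Delta> \<le> c v + ?ds1 ! ?p" using f(3,4) unfolding nth by auto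
      ultimately have "(ds, k) \<in> ?B" using r1 by blast
      then show ?thesis unfolding r(1) by (rule UnI2)
    qed
  next
    fix r assume "r \<in> ?A \<union> ?B"
    then consider ds1 k where "r = (delat ?p ds1, k)" "(ds1, k) \<in> Rset t1" "B = ds1 ! ?p"
      | ds1 k1 \<Delta> where "r = (map2 (+) (delat ?p ds1) (mark \<Delta> (bagl X)), Suc k1)" "(ds1, k1) \<in> Rset t1"
        "\<Delta> \<subseteq> neighbours E v \<inter> X" "ds1 ! ?p \<le> B" "B + card \<Delta> \<le> c v + ds1 ! ?p" by blast
    then show "r \<in> Rset ?t"
    proof cases
    case (1 ds1 k)
    note r = 1(1) and b = 1(3)
    from 1 obtain d1 where d1: "(d1, k) \<in> R' E c t1" "ds1 = map (\<lambda>v. the (d1 v)) (bagl (bag t1))"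
      by (auto simp: in_Rset_iff)
    have dom: "dom d1 = insert v X" using R'_dom[OF sep1 d1(1)] X by simp
    let ?d = "d1 |` (- {v})"
    have dd: "dom ?d = X" using dom X(2) by auto
    obtain z where "d1 v = Some z" using dom by blast
    then have "d1 v = Some B" using b unfolding d1(2) nth by simp
    then have "forget_rule E c ?t v (bag t1) ?d k d1 k" unfolding forget_rule_def B[symmetric] by simp
    with d1(1) dd have "(?d, k) \<in> R' E c ?t" unfolding R by blast
    moreover have "delat ?p ds1 = map (\<lambda>v. the (?d v)) (pre @ post)"
      unfolding d1(2) del using sX X(2) by (auto simp: restrict_map_def)
    ultimately show ?thesis unfolding r in_Rset_iff by (intro exI[of _ ?d]) (simp add: l)
  next
    case (2 ds1 k1 \<Delta>)
    note r = 2(1) and D = 2(3) and b = 2(4,5)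
    from 2 obtain d1 where d1: "(d1, k1) \<in> R' E c t1" "ds1 = map (\<lambda>v. the (d1 v)) (bagl (bag t1))"
      by (auto simp: in_Rset_iff)
    define d where "d = (\<lambda>u. if u \<in> X then Some (the (d1 u) + (if u \<in> \<Delta> then 1 else 0)) else None)"
    have dd: "dom d = X" by (auto simp: d_def dom_def)
    have "forget_rule E c ?t v (bag t1) d (Suc k1) d1 k1"
      unfolding forget_rule_def B[symmetric]
      using D b unfolding d1(2) nth
      by (intro disjI2 conjI exI[of _ \<Delta>] exI[of _ "int (the (d1 v))"]) (auto simp: d_def X)
    with d1(1) dd have "(d, Suc k1) \<in> R' E c ?t" unfolding R by blast
    moreover have "map2 (+) (delat ?p ds1) (mark \<Delta> (bagl X)) = map (\<lambda>v. the (d v)) (pre @ post)"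
      unfolding d1(2) del unfolding l(2) m using sX by (auto simp: d_def)
    ultimately show ?thesis
      unfolding r in_Rset_iff by (intro exI[of _ d]) (simp add: l)
    qed
  qed
qed

end

section \<open>Convolution of tables\<close>

definition char_fun :: "nat list set \<Rightarrow> nat list \<Rightarrow> int" where
  "char_fun P xs = (if xs \<in> P then 1 else 0)"

lemma char_fun_bounds: "0 \<le> char_fun P xs \<and> char_fun P xs \<le> 1"
  by (simp add: char_fun_def)

lemma char_fun_nonzero [simp]: "char_fun P xs \<noteq> 0 \<longleftrightarrow> xs \<in> P"
  by (simp add: char_fun_def)

lemma box_grid:
  assumes "list_all2 (\<le>) xs a" "list_all2 (\<lambda>x y. x + y < N) a b"
  shows "xs \<in> grid N (length a)"
  using assms by (fastforce simp: grid_def list_all2_conv_all_nth in_set_conv_nth)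

lemma list_all2_swap_add: "list_all2 (\<lambda>x y. x + y < N) a b \<Longrightarrow> list_all2 (\<lambda>x y. x + y < (N::nat)) b a"
  by (auto simp: list_all2_conv_all_nth add.commute)

lemma sum_in_grid:
  assumes "list_all2 (\<le>) ys a" "list_all2 (\<le>) zs b" "list_all2 (\<lambda>x y. x + y < N) a b"
  shows "map2 (+) ys zs \<in> grid N (length a)"
proof -
  have l: "length ys = length a" "length zs = length a" using assms by (auto simp: list_all2_lengthD)
  have "map2 (+) ys zs ! i < N" if "i < length a" for i
  proof -
    have "ys ! i \<le> a ! i" "zs ! i \<le> b ! i" "a ! i + b ! i < N"
      using assms that l by (auto simp: list_all2_conv_all_nth)
    then show ?thesis using that l by simp
  qed
  then show ?thesis using l by (fastforce simp: grid_def in_set_conv_nth)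
qed

text \<open>Degree bounds that add up to less than \<open>N\<close> on every axis make the computed
  product exact up to a positive factor. The size bound combines the scaling of \<open>D\<close>
  interpolations with the number of pairs of indices.\<close>

lemma interp_conv_char_fun:
  assumes P: "\<forall>xs\<in>P. list_all2 (\<le>) xs a" and Q: "\<forall>xs\<in>Q. list_all2 (\<le>) xs b"
    and ab: "list_all2 (\<lambda>x y. x + y < N) a b" and D: "length a = D" and xs: "xs \<in> grid N D" and N: "0 < N"
  defines "G \<equiv> interp_conv N (\<lambda>i j. int j ^ i) (interp N) D (char_fun P) (char_fun Q)"
  shows "0 \<le> G xs" "G xs \<noteq> 0 \<longleftrightarrow> (\<exists>ys\<in>P. \<exists>zs\<in>Q. map2 (+) ys zs = xs)"
    "G xs \<le> int N ^ (2 * (N * N) * D + 2 * D)"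
proof -
  have lb: "length b = D" using ab D by (auto simp: list_all2_lengthD)
  have G: "G xs = ((lagr_prod N)\<^sup>2) ^ D * convolution N D (char_fun P) (char_fun Q) xs"
    unfolding G_def
    by (rule interp_conv_eq[OF _ _ D lb ab xs]) (use P Q in \<open>auto simp: supported_below_def\<close>)
  have n: "\<And>ys. 0 \<le> char_fun P ys" "\<And>ys. 0 \<le> char_fun Q ys" by (simp_all add: char_fun_bounds)
  show "0 \<le> G xs" unfolding G using convolution_nonneg[OF n] by simp
  have "P \<subseteq> grid N D" "Q \<subseteq> grid N D"
    using box_grid[OF P[rule_format] ab] box_grid[OF Q[rule_format] list_all2_swap_add[OF ab]] D lb by auto
  then show "G xs \<noteq> 0 \<longleftrightarrow> (\<exists>ys\<in>P. \<exists>zs\<in>Q. map2 (+) ys zs = xs)"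
    unfolding G using convolution_nonzero_iff[OF n, where N = N and D = D and xs = xs] lagr_prod_nz[of N] by auto
  have "G xs \<le> (int N ^ (2 * (N * N))) ^ D * int N ^ (2 * D)"
    unfolding G using lagr_prod_sq_le[OF N] convolution_le[OF char_fun_bounds char_fun_bounds] convolution_nonneg[OF n]
    by (intro mult_mono power_mono) auto
  then show "G xs \<le> int N ^ (2 * (N * N) * D + 2 * D)" by (simp add: power_add power_mult)
qed

text \<open>The crude estimate N \<le> 2^N avoids logarithms at the price of longer words.\<close>

lemma power_le_two_power: "int N ^ e \<le> 2 ^ (N * e)"
proof -
  have "int N \<le> 2 ^ N" using of_nat_mono[OF less_imp_le[OF less_exp[of N]], where 'a = int] by simp
  then have "int N ^ e \<le> (2 ^ N) ^ e" by (rule power_mono) simp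
  then show ?thesis by (simp add: power_mult)
qed

text \<open>The factor \<open>N\<close> and the summand 1 account for a forget node, where up to
  \<open>N\<close> slices of a product are summed and one more 0-1 array is added. The exponent of
  two is at most \<open>2 * N^4 + 2 * N^2 + N + 2\<close>, which the binomial expansion of
  \<open>(N + 1)^5\<close> dominates.\<close>

lemma word_size_suffices:
  assumes "D \<le> N" "0 < N" and x: "0 \<le> x" "x \<le> 1 + int N * int N ^ (2 * (N * N) * D + 2 * D)"
  shows "\<bar>x\<bar> < 2 ^ ((N + 1) ^ 5)"
proof -
  define e where "e = 2 * (N * N) * D + 2 * D"
  have e: "e \<le> 2 * (N * N) * N + 2 * N" unfolding e_def using assms(1) by (intro add_mono mult_le_mono) auto
  have "x \<le> 1 + int N ^ Suc e" using x by (simp add: e_def)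
  also have "\<dots> \<le> 1 + 2 ^ (N * Suc e)" using power_le_two_power[of N "Suc e"] by simp
  also have "\<dots> < 2 ^ (N * Suc e + 2)"
  proof -
    have "(1 :: int) \<le> 2 ^ (N * Suc e)" by (rule one_le_power) simp
    then have "1 + (2 :: int) ^ (N * Suc e) < 4 * 2 ^ (N * Suc e)" by linarith
    then show ?thesis by (simp add: power_add del: mult_Suc_right)
  qed
  also have "\<dots> \<le> 2 ^ ((N + 1) ^ 5)"
  proof (rule power_increasing)
    have "N * Suc e + 2 \<le> N * Suc (2 * (N * N) * N + 2 * N) + 2" using e by simp
    also have "\<dots> = 2 * N ^ 4 + 2 * N ^ 2 + N + 2" by (simp add: eval_nat_numeral algebra_simps)
    also have "\<dots> \<le> N ^ 5 + 5 * N ^ 4 + 10 * N ^ 3 + 10 * N ^ 2 + 5 * N + 1" using assms(2) by simp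
    also have "\<dots> = (N + 1) ^ 5" by (simp add: eval_nat_numeral algebra_simps)
    finally show "N * Suc e + 2 \<le> (N + 1) ^ 5" .
  qed simp
  finally show ?thesis using x(1) by simp
qed

section \<open>Reading a table off an array\<close>

definition rows_of :: "nat \<Rightarrow> nat \<Rightarrow> (nat list \<Rightarrow> int) \<Rightarrow> row list" where
  "rows_of N D f = map (\<lambda>acc. (tl acc, hd acc)) (support_paths N D f [])"

lemma map_erow_rows_of: "map erow (rows_of N D f) = map eacc (support_paths N D f [])"
  by (simp add: rows_of_def erow_def eacc_def comp_def)

lemma length_rows_of: "length (rows_of N D f) \<le> N ^ D"
  by (simp add: rows_of_def length_support_paths)

lemma set_rows_of: "set (rows_of N (Suc m) f) = {(ds, k). rev ds @ [k] \<in> grid N (Suc m) \<and> f (rev ds @ [k]) \<noteq> 0}"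
proof (intro set_eqI iffI)
  fix r assume "r \<in> set (rows_of N (Suc m) f)"
  then obtain xs where xs: "xs \<in> grid N (Suc m)" "f xs \<noteq> 0" "r = (tl (rev xs), hd (rev xs))"
    by (auto simp: rows_of_def set_support_paths simp del: support_paths.simps)
  then have "xs \<noteq> []" by (auto simp: grid_def)
  then obtain ys k where "xs = ys @ [k]" by (metis append_butlast_last_id)
  with xs show "r \<in> {(ds, k). rev ds @ [k] \<in> grid N (Suc m) \<and> f (rev ds @ [k]) \<noteq> 0}" by simp
next
  fix r assume "r \<in> {(ds, k). rev ds @ [k] \<in> grid N (Suc m) \<and> f (rev ds @ [k]) \<noteq> 0}"
  then obtain ds k where "r = (ds, k)" "rev ds @ [k] \<in> grid N (Suc m)" "f (rev ds @ [k]) \<noteq> 0" by auto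
  then have "k # ds \<in> set (support_paths N (Suc m) f [])" unfolding set_support_paths
    by (intro CollectI exI[of _ "rev ds @ [k]"]) simp
  then show "r \<in> set (rows_of N (Suc m) f)" unfolding rows_of_def using \<open>r = (ds, k)\<close> by force
qed

lemma enum_rows_spec:
  assumes "0 < N" "\<And>xs. xs \<in> grid N (Suc m) \<Longrightarrow> \<bar>f xs\<bar> < 2 ^ L"
  shows "computes f_enum [enc_nat (Suc m), int_array N L (Suc m) f, Atom, Atom, Atom]
     (enc_list (map erow (rows_of N (Suc m) f))) (array_cost N L (Suc m))"
  using enum_spec[OF assms(1), of "Suc m" "[]" f L "[]"] assms(2)
  unfolding map_erow_rows_of by (simp del: int_array.simps support_paths.simps enc_nat.simps)

lemma fill_ind_spec:
  assumes "set ps = P" "P \<subseteq> grid N D"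
  shows "computes f_fill [enc_list (map epath ps), int_array N L D (\<lambda>_. 0), bits L 1] (int_array N L D (char_fun P))
     (length ps * (D * (50 * N + 50) + 50) + 10)"
  using fill_spec[of ps N D L "\<lambda>_. 0"] assms by (simp add: char_fun_def[abs_def] del: int_array.simps)

lemma map2_rev: "length xs = length ys \<Longrightarrow> map2 f (rev xs) (rev ys) = rev (map2 f xs ys)"
  by (simp add: zip_rev rev_map)

lemma list_all2_map_same: "list_all2 P (map f xs) (map g xs) \<longleftrightarrow> (\<forall>x\<in>set xs. P (f x) (g x))"
  by (induction xs) auto

lemma elemE_eqs:
  "elemE 1 e = LeftE (RightE e)" "elemE 2 e = LeftE (RightE (RightE e))"
  "elemE 3 e = LeftE (RightE (RightE (RightE e)))"
  "elemE 4 e = LeftE (RightE (RightE (RightE (RightE e))))"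
  "elemE 5 e = LeftE (RightE (RightE (RightE (RightE (RightE e)))))"
  "elemE 6 e = LeftE (RightE (RightE (RightE (RightE (RightE (RightE e))))))"
  by (simp_all add: eval_nat_numeral)

context instance_graph
begin

text \<open>Exponents range over 0, ..., n, so n + 1 points determine the polynomials.\<close>

definition npoints :: nat where "npoints = Suc (length vs)"

definition word_size :: nat where "word_size = (npoints + 1) ^ 5"

definition adjm :: data where
  "adjm = enc_list (map (\<lambda>u. enc_list (map (\<lambda>v. enc_bool ({u, v} \<in> E)) vs)) vs)"

definition capl :: data where
  "capl = enc_list (map (\<lambda>v. enc_nat (c v)) vs)"

definition vmat :: data where "vmat = cols npoints word_size (\<lambda>i j. int j ^ i)"

definition wmat :: data where "wmat = cols npoints word_size (interp npoints)"

definition ctxt :: data where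
  "ctxt = enc_list [adjm, capl, enc_nat npoints, bits word_size 0, bits word_size 1, vmat, wmat]"

lemma ctxt_sel [simp]:
  "left ctxt = adjm" "left (right ctxt) = capl" "left (right (right ctxt)) = enc_nat npoints"
  "left (right (right (right ctxt))) = bits word_size 0"
  "left (right (right (right (right ctxt)))) = bits word_size 1"
  "left (right (right (right (right (right ctxt))))) = vmat"
  "left (right (right (right (right (right (right ctxt)))))) = wmat"
  by (simp_all add: ctxt_def)

lemma npoints_pos: "0 < npoints"
  by (simp add: npoints_def)

lemma card_V: "card V = length vs"
  using distinct_card[OF distinct_vs] set_vs by simp

lemma card_neighbours_less: "card (neighbours E u) < npoints"
  using card_mono[OF finite_V, of "neighbours E u"] neighbours_subset[OF simple, of u] card_V
  by (fastforce simp: npoints_def)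

lemma finite_neighbours: "finite (neighbours E u)"
  using neighbours_subset[OF simple, of u] finite_V by (meson finite_Diff finite_subset)

text \<open>The degree bounds of the two factors on the axis of \<open>u\<close> count neighbours of
  \<open>u\<close> in disjoint sets, so their sum is at most the degree of \<open>u\<close> in the
  graph.\<close>

lemma card_neighbours_disjoint:
  assumes "A \<inter> B = {}"
  shows "card (neighbours E u \<inter> A) + card (neighbours E u \<inter> B) < npoints"
proof -
  have "card (neighbours E u \<inter> A) + card (neighbours E u \<inter> B) = card ((neighbours E u \<inter> A) \<union> (neighbours E u \<inter> B))"
    using assms finite_neighbours by (subst card_Un_disjoint) auto
  also have "\<dots> \<le> card (neighbours E u)" by (rule card_mono[OF finite_neighbours]) auto
  finally show ?thesis using card_neighbours_less[of u] by simp
qed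

lemma card_less_npoints: "A \<subseteq> V \<Longrightarrow> card A < npoints"
  using card_mono[OF finite_V, of A] card_V by (simp add: npoints_def)

abbreviation prodf :: "nat \<Rightarrow> nat list set \<Rightarrow> nat list set \<Rightarrow> nat list \<Rightarrow> int" where
  "prodf D P Q \<equiv> interp_conv npoints (\<lambda>i j. int j ^ i) (interp npoints) D (char_fun P) (char_fun Q)"

lemma conv_ctxt_spec:
  "computes f_conv [enc_nat D, int_array npoints word_size D (char_fun P), int_array npoints word_size D (char_fun Q), vmat, wmat]
     (int_array npoints word_size D (prodf D P Q)) (conv_cost npoints word_size D)"
  unfolding vmat_def wmat_def by (rule conv_spec[OF npoints_pos])

text \<open>Degree bounds for the polynomial of a table, in the axis order of
  \<open>jpath\<close>.\<close>

definition jbox :: "'v rtree \<Rightarrow> nat list" where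
  "jbox t = rev (map (\<lambda>u. card (neighbours E u \<inter> Yset t)) (bagl (bag t))) @ [card (Yset t)]"

lemma jpath_box: "all_separated V E t \<Longrightarrow> r \<in> Rset t \<Longrightarrow> list_all2 (\<le>) (jpath r) (jbox t)"
  using Rset_bounds[of t "fst r" "snd r"] unfolding jpath_def jbox_def
  by (auto intro!: list_all2_appendI simp del: rev_map simp: list_all2_rev)

text \<open>The forgotten parts of the children are disjoint, so the degrees add up to at most the
  number of neighbours of \<open>u\<close> on the axis of \<open>u\<close>, and to at most n on the
  last axis. The support of the product is then the sumset of the two tables, as the join rule
  demands.\<close>

lemma join_sem:
  assumes sep: "all_separated V E (Node X [t1, t2])" and X: "bag t1 = X" "bag t2 = X"
    and m: "m = length (bagl X)"
  defines "G \<equiv> prodf (Suc m) (jpath ` Rset t1) (jpath ` Rset t2)"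
  shows "jpath ` Rset t1 \<subseteq> grid npoints (Suc m)" "jpath ` Rset t2 \<subseteq> grid npoints (Suc m)"
    "xs \<in> grid npoints (Suc m) \<Longrightarrow> \<bar>G xs\<bar> < 2 ^ word_size"
    "set (rows_of npoints (Suc m) G) = Rset (Node X [t1, t2])"
proof -
  let ?t = "Node X [t1, t2]"
  have s1: "all_separated V E t1" and s2: "all_separated V E t2"
    using all_separated_child[OF sep] by simp_all
  have "separated V E ?t" by (rule all_separated_root[OF sep])
  then have VV: "Vset t1 \<inter> Vset t2 \<subseteq> X" by (auto simp: separated_def less_Suc_eq)
  then have Yd: "Yset t1 \<inter> Yset t2 = {}" using X by (auto simp: Yset_def)
  have YV: "Yset t1 \<subseteq> V" "Yset t2 \<subseteq> V" using bag_subset_V(3) s1 s2 by auto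
  have fin: "finite (Yset t1)" "finite (Yset t2)" using YV finite_V finite_subset by auto
  have "card (Yset t1) + card (Yset t2) < npoints"
    using card_Un_disjoint[OF fin Yd] card_less_npoints[of "Yset t1 \<union> Yset t2"] YV by simp
  then have ab: "list_all2 (\<lambda>x y. x + y < npoints) (jbox t1) (jbox t2)"
    unfolding jbox_def X using card_neighbours_disjoint[OF Yd]
    by (intro list_all2_appendI) (simp_all add: list_all2_rev list_all2_map_same)
  have P: "\<forall>ys\<in>jpath ` Rset t1. list_all2 (\<le>) ys (jbox t1)" using jpath_box[OF s1] by blast
  have Q: "\<forall>ys\<in>jpath ` Rset t2. list_all2 (\<le>) ys (jbox t2)" using jpath_box[OF s2] by blast
  have l: "length (jbox t1) = Suc m" "length (jbox t2) = Suc m" using m X by (simp_all add: jbox_def)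
  show "jpath ` Rset t1 \<subseteq> grid npoints (Suc m)" using box_grid[OF P[rule_format] ab] l by auto
  show "jpath ` Rset t2 \<subseteq> grid npoints (Suc m)" using box_grid[OF Q[rule_format] list_all2_swap_add[OF ab]] l by auto
  note interp_conv = interp_conv_char_fun[OF P Q ab l(1) _ npoints_pos, folded G_def]
  have XV: "X \<subseteq> V" using bag_subset_V(1)[OF sep] by simp
  have mn: "Suc m \<le> npoints" using m length_bagl[OF XV] card_less_npoints[OF XV] by simp
  show "\<bar>G xs\<bar> < 2 ^ word_size" if xs: "xs \<in> grid npoints (Suc m)"
    unfolding word_size_def
  proof (rule word_size_suffices[OF mn npoints_pos interp_conv(1)[OF xs]])
    have "int npoints ^ (2 * (npoints * npoints) * Suc m + 2 * Suc m) \<le> int npoints * int npoints ^ (2 * (npoints * npoints) * Suc m + 2 * Suc m)"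
      using npoints_pos by simp
    with interp_conv(3)[OF xs] show "G xs \<le> 1 + int npoints * int npoints ^ (2 * (npoints * npoints) * Suc m + 2 * Suc m)" by linarith
  qed
  have len: "length ds = m" if "(ds, k) \<in> Rset t1 \<or> (ds, k) \<in> Rset t2" for ds k
    using Rset_length X m that by metis
  have jp: "map2 (+) (jpath (ds1, k1)) (jpath (ds2, k2)) = rev (map2 (+) ds1 ds2) @ [k1 + k2]"
    if "(ds1, k1) \<in> Rset t1" "(ds2, k2) \<in> Rset t2" for ds1 k1 ds2 k2
  proof -
    have "length ds1 = length ds2" using len that by metis
    then show ?thesis by (simp add: jpath_def map2_rev zip_append del: rev_map)
  qed
  have inj: "rev ds @ [k] = rev ds' @ [k'] \<longleftrightarrow> ds = ds' \<and> k = k'" for ds ds' and k k' :: nat by simp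
  show "set (rows_of npoints (Suc m) G) = Rset ?t"
    unfolding set_rows_of Rset_join[OF sep X]
  proof (intro subset_antisym subsetI)
    fix r assume "r \<in> {(ds, k). rev ds @ [k] \<in> grid npoints (Suc m) \<and> G (rev ds @ [k]) \<noteq> 0}"
    then obtain ds k where r: "r = (ds, k)" and g: "rev ds @ [k] \<in> grid npoints (Suc m)" "G (rev ds @ [k]) \<noteq> 0" by auto
    from g(2) interp_conv(2)[OF g(1)] obtain r1 r2 where rr: "r1 \<in> Rset t1" "r2 \<in> Rset t2"
      "map2 (+) (jpath r1) (jpath r2) = rev ds @ [k]" by blast
    obtain ds1 k1 ds2 k2 where e: "r1 = (ds1, k1)" "r2 = (ds2, k2)" by (cases r1; cases r2) auto
    with rr jp[of ds1 k1 ds2 k2] inj have "ds = map2 (+) ds1 ds2" "k = k1 + k2" by metis+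
    with rr e r show "r \<in> {(map2 (+) ds1 ds2, k1 + k2) | ds1 k1 ds2 k2. (ds1, k1) \<in> Rset t1 \<and> (ds2, k2) \<in> Rset t2}"
      by blast
  next
    fix r assume "r \<in> {(map2 (+) ds1 ds2, k1 + k2) | ds1 k1 ds2 k2. (ds1, k1) \<in> Rset t1 \<and> (ds2, k2) \<in> Rset t2}"
    then obtain ds1 k1 ds2 k2 where r: "r = (map2 (+) ds1 ds2, k1 + k2)"
      and rr: "(ds1, k1) \<in> Rset t1" "(ds2, k2) \<in> Rset t2" by blast
    have g: "rev (map2 (+) ds1 ds2) @ [k1 + k2] \<in> grid npoints (Suc m)"
      using sum_in_grid[OF P[rule_format] Q[rule_format] ab, of "jpath (ds1, k1)" "jpath (ds2, k2)"] rr unfolding jp[OF rr] l(1) by blast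
    with interp_conv(2)[OF g] rr jp[OF rr] have "G (rev (map2 (+) ds1 ds2) @ [k1 + k2]) \<noteq> 0" by blast
    with g r show "r \<in> {(ds, k). rev ds @ [k] \<in> grid npoints (Suc m) \<and> G (rev ds @ [k]) \<noteq> 0}" by simp
  qed
qed

end

section \<open>The product at a forget node\<close>

lemma list_all2_delat: "list_all2 P xs ys \<Longrightarrow> list_all2 P (delat j xs) (delat j ys)"
  unfolding delat_def by (intro list_all2_appendI list_all2_takeI list_all2_dropI)

lemma length_subset_paths: "length (subset_paths bs acc k) \<le> 2 ^ length bs"
proof (induction bs arbitrary: acc k)
  case (Cons b bs)
  have "length (subset_paths bs (1 # acc) (Suc k)) \<le> 2 ^ length bs" "length (subset_paths bs (0 # acc) k) \<le> 2 ^ length bs"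
    by (rule Cons)+
  then show ?case by auto
qed simp

lemma take_upt_0: "take k [0..<n] = [0..<min k n]"
  by (cases "k \<le> n") (simp_all add: min_def)

context instance_graph
begin

lemma mark_simps [simp]: "mark A [] = []" "mark A (u # us) = (if u \<in> A then 1 else 0) # mark A us"
  by (simp_all add: mark_def)

lemma length_mark [simp]: "length (mark A us) = length us"
  by (simp add: mark_def)

lemma mark_cong: "(\<And>u. u \<in> set us \<Longrightarrow> u \<in> A \<longleftrightarrow> u \<in> B) \<Longrightarrow> mark A us = mark B us"
  by (simp add: mark_def)

text \<open>The head of a path accumulates |\<Delta>| and the marks are stacked on
  \<open>acc\<close>, whence the reversal. Distinctness makes the number of marks equal to the
  cardinality.\<close>

lemma set_subset_paths:
  "distinct us \<Longrightarrow> set (subset_paths (map (\<lambda>u. u \<in> A) us) acc k) =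
     {(k + card \<Delta>) # rev (mark \<Delta> us) @ acc | \<Delta>. \<Delta> \<subseteq> A \<inter> set us}"
proof (induction us arbitrary: acc k)
  case Nil
  then show ?case by auto
next
  case (Cons u us)
  have fin: "finite \<Delta>" if "\<Delta> \<subseteq> A \<inter> set us" for \<Delta> using that finite_subset by fastforce
  note IH = Cons.IH[OF distinct.simps(2)[THEN iffD1, OF Cons.prems, THEN conjunct2]]
  have u: "u \<notin> set us" using Cons.prems by simp
  show ?case
  proof (intro subset_antisym subsetI)
    fix xs assume "xs \<in> set (subset_paths (map (\<lambda>u. u \<in> A) (u # us)) acc k)"
    then consider "u \<in> A" "xs \<in> set (subset_paths (map (\<lambda>u. u \<in> A) us) (1 # acc) (Suc k))"
      | "xs \<in> set (subset_paths (map (\<lambda>u. u \<in> A) us) (0 # acc) k)" by (auto split: if_splits)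
    then show "xs \<in> {(k + card \<Delta>) # rev (mark \<Delta> (u # us)) @ acc | \<Delta>. \<Delta> \<subseteq> A \<inter> set (u # us)}"
    proof cases
      case 1
      then obtain \<Delta> where D: "\<Delta> \<subseteq> A \<inter> set us" "xs = (Suc k + card \<Delta>) # rev (mark \<Delta> us) @ 1 # acc"
        unfolding IH by blast
      have "mark (insert u \<Delta>) us = mark \<Delta> us" using u by (intro mark_cong) auto
      moreover have "card (insert u \<Delta>) = Suc (card \<Delta>)" using D u fin by (subst card_insert_disjoint) auto
      ultimately show ?thesis using D 1 by (intro CollectI exI[of _ "insert u \<Delta>"]) auto
    next
      case 2
      then obtain \<Delta> where D: "\<Delta> \<subseteq> A \<inter> set us" "xs = (k + card \<Delta>) # rev (mark \<Delta> us) @ 0 # acc"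
        unfolding IH by blast
      then show ?thesis using u by (intro CollectI exI[of _ \<Delta>]) auto
    qed
  next
    fix xs assume "xs \<in> {(k + card \<Delta>) # rev (mark \<Delta> (u # us)) @ acc | \<Delta>. \<Delta> \<subseteq> A \<inter> set (u # us)}"
    then obtain \<Delta> where D: "\<Delta> \<subseteq> A \<inter> set (u # us)" "xs = (k + card \<Delta>) # rev (mark \<Delta> (u # us)) @ acc" by blast
    show "xs \<in> set (subset_paths (map (\<lambda>u. u \<in> A) (u # us)) acc k)"
    proof (cases "u \<in> \<Delta>")
      case True
      have "mark (\<Delta> - {u}) us = mark \<Delta> us" using u by (intro mark_cong) auto
      moreover have "finite \<Delta>" using D(1) finite_subset by fastforce
      then have "card \<Delta> = Suc (card (\<Delta> - {u}))" using True by (metis card_Suc_Diff1)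
      moreover have "\<Delta> - {u} \<subseteq> A \<inter> set us" using D(1) by auto
      ultimately have "xs \<in> set (subset_paths (map (\<lambda>u. u \<in> A) us) (1 # acc) (Suc k))"
        unfolding IH using D(2) True by (intro CollectI exI[of _ "\<Delta> - {u}"]) auto
      then show ?thesis using True D(1) by auto
    next
      case False
      then have "\<Delta> \<subseteq> A \<inter> set us" using D(1) by auto
      then have "xs \<in> set (subset_paths (map (\<lambda>u. u \<in> A) us) (0 # acc) k)"
        unfolding IH using D(2) False by (intro CollectI exI[of _ \<Delta>]) auto
      then show ?thesis by auto
    qed
  qed
qed

text \<open>Exponent vectors of the second factor in the axis order of \<open>fpath\<close>:
  |\<Delta>| for \<open>v\<close>, the marks for the bag, 1 for \<open>k\<close>.\<close>

definition gpaths :: "'v \<Rightarrow> 'v set \<Rightarrow> nat list set" where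
  "gpaths v X = {card \<Delta> # rev (mark \<Delta> (bagl X)) @ [1] | \<Delta>. \<Delta> \<subseteq> neighbours E v \<inter> X}"

text \<open>The first summand is alternative (i), the sum of slices alternative (ii). As the indices
  stop at \<open>npoints\<close>, a larger capacity does not add slices.\<close>

definition fsum :: "'v \<Rightarrow> nat list set \<Rightarrow> (nat list \<Rightarrow> int) \<Rightarrow> nat list \<Rightarrow> int" where
  "fsum v P G xs = char_fun P (0 # xs) + (\<Sum>r\<leftarrow>take (Suc (c v)) [0..<npoints]. G (r # xs))"

text \<open>After the multiplication the index \<open>r\<close> on the first axis is the in-degree
  of \<open>v\<close>: the arcs from \<open>Y\<close>, in number \<open>B\<close> minus the
  out-degree, and those from \<Delta>. Hence \<open>r \<le> c v\<close> restates the lower bound on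
  \<open>A\<close>.\<close>

lemma forget_sem:
  assumes sep: "all_separated V E (Node X [t1])" and v: "forgets v X (bag t1)"
    and l: "bagl (bag t1) = pre @ v # post" "bagl X = pre @ post"
    and B: "B = card (neighbours E v \<inter> Yset t1)" and m: "m = length (bagl X)"
  defines "P \<equiv> fpath (length pre) B ` Rset t1"
  defines "G \<equiv> prodf (Suc (Suc m)) P (gpaths v X)"
  shows "P \<subseteq> grid npoints (Suc (Suc m))" "gpaths v X \<subseteq> grid npoints (Suc (Suc m))"
    "xs \<in> grid npoints (Suc m) \<Longrightarrow> \<bar>fsum v P G xs\<bar> < 2 ^ word_size"
    "set (rows_of npoints (Suc m) (fsum v P G)) = Rset (Node X [t1])"
proof -
  let ?t = "Node X [t1]" and ?p = "length pre" and ?N = "neighbours E v"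
  have X: "bag t1 = insert v X" "v \<notin> X" using v by (auto simp: forgets_def)
  have XV: "X \<subseteq> V" using bag_subset_V(1)[OF sep] by simp
  have sX: "set (bagl X) = X" by (rule set_bagl[OF XV])
  have s1: "all_separated V E t1" using all_separated_child[OF sep] by simp
  have Y: "Yset ?t = insert v (Yset t1)" using X bag_subset_Vset[of t1] by (auto simp: Yset_def)
  have vN: "v \<notin> ?N" using neighbours_subset[OF simple, of v] by auto
  \<comment> \<open>At this node \<open>v\<close> itself joins \<open>Y\<close>, but it is not its
    own neighbour, so \<open>B\<close> can be counted from the forgotten vertices of the
    child.\<close>
  have B': "B = card (?N \<inter> Yset ?t)" unfolding B Y using vN by (metis Int_insert_right)
  have Yd: "Yset t1 \<inter> X = {}" "v \<notin> Yset t1" using X by (auto simp: Yset_def)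
  have YV: "insert v (Yset t1) \<subseteq> V" using bag_subset_V(3)[OF sep] Y by simp
  have finY: "finite (Yset t1)" using YV finite_V finite_subset by auto
  have mn: "Suc (Suc m) \<le> npoints"
    using m length_bagl[OF XV] card_less_npoints[of "insert v X"] X(2) XV YV finite_subset[OF XV finite_V] by auto
  \<comment> \<open>Degree bounds of the two factors. Their sums count the neighbours of
    \<open>v\<close> in \<open>Yset t1\<close> and \<open>X\<close>, the neighbours of
    \<open>u\<close> in \<open>Yset t1\<close> and possibly \<open>v\<close>, and the vertices of
    \<open>Yset t1\<close> and \<open>v\<close>; all are at most n.\<close>
  define a where "a = B # rev (map (\<lambda>u. card (neighbours E u \<inter> Yset t1)) (bagl X)) @ [card (Yset t1)]"
  define b where "b = card (?N \<inter> X) # rev (mark ?N (bagl X)) @ [1]"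
  have la: "length a = Suc (Suc m)" using m by (simp add: a_def)
  have nb: "card (neighbours E u \<inter> Yset t1) + (if u \<in> ?N then 1 else 0) < npoints" for u
  proof (cases "u \<in> ?N")
    case True
    then have "neighbours E u \<inter> {v} = {v}" by (auto simp: neighbours_def insert_commute)
    then show ?thesis using card_neighbours_disjoint[of "Yset t1" "{v}" u] Yd(2) True by simp
  next
    case False
    then show ?thesis using card_neighbours_disjoint[of "Yset t1" "{}" u] by simp
  qed
  have "card (Yset t1) + 1 < npoints" using card_less_npoints[OF YV] finY Yd(2) by simp
  moreover have "B + card (?N \<inter> X) < npoints" unfolding B by (rule card_neighbours_disjoint[OF Yd(1)])
  ultimately have ab: "list_all2 (\<lambda>x y. x + y < npoints) a b"
    unfolding a_def b_def mark_def using nb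
    by (simp add: list_all2_append list_all2_rev list_all2_map_same)
  have len: "length ds = Suc m" if "(ds, k) \<in> Rset t1" for ds k
    using Rset_length[OF that] l m by simp
  have nthB: "ds ! ?p \<le> B" and delB: "list_all2 (\<le>) (delat ?p ds) (map (\<lambda>u. card (neighbours E u \<inter> Yset t1)) (bagl X))"
    if "(ds, k) \<in> Rset t1" for ds k
  proof -
    note h = Rset_bounds(2)[OF s1 that, unfolded l]
    show "ds ! ?p \<le> B" using list_all2_nthD2[OF h, of ?p] by (simp add: nth_append B)
    have "delat ?p (map (\<lambda>u. card (neighbours E u \<inter> Yset t1)) (pre @ v # post)) =
       map (\<lambda>u. card (neighbours E u \<inter> Yset t1)) (bagl X)" unfolding l by (simp add: delat_def)
    with list_all2_delat[OF h, of ?p]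
    show "list_all2 (\<le>) (delat ?p ds) (map (\<lambda>u. card (neighbours E u \<inter> Yset t1)) (bagl X))" by simp
  qed
  have PB: "\<forall>ys\<in>P. list_all2 (\<le>) ys a"
  proof
    fix ys assume "ys \<in> P"
    then obtain ds k where r: "(ds, k) \<in> Rset t1" "ys = fpath ?p B (ds, k)" by (auto simp: P_def)
    show "list_all2 (\<le>) ys a"
      unfolding r(2) fpath_def a_def using delB[OF r(1)] Rset_bounds(1)[OF s1 r(1)]
      by (auto intro!: list_all2_appendI simp: list_all2_rev simp del: rev_map)
  qed
  have QB: "\<forall>ys\<in>gpaths v X. list_all2 (\<le>) ys b"
  proof
    fix ys assume "ys \<in> gpaths v X"
    then obtain \<Delta> where D: "\<Delta> \<subseteq> ?N \<inter> X" "ys = card \<Delta> # rev (mark \<Delta> (bagl X)) @ [1]" by (auto simp: gpaths_def)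
    have "card \<Delta> \<le> card (?N \<inter> X)" using D(1) finite_neighbours by (intro card_mono) auto
    moreover have "list_all2 (\<le>) (mark \<Delta> (bagl X)) (mark ?N (bagl X))"
      unfolding mark_def list_all2_map_same using D(1) by auto
    ultimately show "list_all2 (\<le>) ys b"
      unfolding D(2) b_def by (auto intro!: list_all2_appendI simp: list_all2_rev)
  qed
  have lb: "length b = Suc (Suc m)" using m by (simp add: b_def)
  show Pg: "P \<subseteq> grid npoints (Suc (Suc m))" using box_grid[OF PB[rule_format] ab] la by auto
  show Qg: "gpaths v X \<subseteq> grid npoints (Suc (Suc m))"
    using box_grid[OF QB[rule_format] list_all2_swap_add[OF ab]] lb by auto
  note interp_conv = interp_conv_char_fun[OF PB QB ab la _ npoints_pos, folded G_def]
  let ?e = "2 * (npoints * npoints) * Suc (Suc m) + 2 * Suc (Suc m)"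
  have rs: "set (take (Suc (c v)) [0..<npoints]) = {r. r < npoints \<and> r \<le> c v}" by (auto simp: take_upt_0)
  have gr: "r # xs \<in> grid npoints (Suc (Suc m))" if "xs \<in> grid npoints (Suc m)" "r \<in> set (take (Suc (c v)) [0..<npoints])" for r xs
    using that rs by simp
  have S0: "0 \<le> (\<Sum>r\<leftarrow>take (Suc (c v)) [0..<npoints]. G (r # xs))" if "xs \<in> grid npoints (Suc m)" for xs
    by (rule sum_list_nonneg) (use interp_conv(1)[OF gr[OF that]] in auto)
  have nz: "fsum v P G xs \<noteq> 0 \<longleftrightarrow> 0 # xs \<in> P \<or> (\<exists>r. r < npoints \<and> r \<le> c v \<and> (\<exists>ys\<in>P. \<exists>zs\<in>gpaths v X. map2 (+) ys zs = r # xs))"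
    if xs: "xs \<in> grid npoints (Suc m)" for xs
  proof -
    have "(\<Sum>r\<leftarrow>take (Suc (c v)) [0..<npoints]. G (r # xs)) \<noteq> 0 \<longleftrightarrow> (\<exists>r\<in>set (take (Suc (c v)) [0..<npoints]). G (r # xs) \<noteq> 0)"
      by (subst sum_list_nonneg_eq_0_iff) (use interp_conv(1)[OF gr[OF xs]] in auto)
    also have "\<dots> \<longleftrightarrow> (\<exists>r. r < npoints \<and> r \<le> c v \<and> (\<exists>ys\<in>P. \<exists>zs\<in>gpaths v X. map2 (+) ys zs = r # xs))"
      using interp_conv(2)[OF gr[OF xs]] rs by auto
    finally show ?thesis using S0[OF xs] unfolding fsum_def
      by (cases "0 # xs \<in> P") (simp_all add: char_fun_def)
  qed
  show "\<bar>fsum v P G xs\<bar> < 2 ^ word_size" if xs: "xs \<in> grid npoints (Suc m)"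
    unfolding word_size_def
  proof (rule word_size_suffices[OF mn npoints_pos])
    show "0 \<le> fsum v P G xs" using S0[OF xs] char_fun_bounds[of P "0 # xs"] by (simp add: fsum_def)
    have "(\<Sum>r\<leftarrow>take (Suc (c v)) [0..<npoints]. G (r # xs)) \<le> (\<Sum>r\<leftarrow>take (Suc (c v)) [0..<npoints]. int npoints ^ ?e)"
      by (rule sum_list_mono) (rule interp_conv(3)[OF gr[OF xs]])
    also have "\<dots> = int (length (take (Suc (c v)) [0..<npoints])) * int npoints ^ ?e" by (simp add: sum_list_triv)
    also have "\<dots> \<le> int npoints * int npoints ^ ?e" by (intro mult_right_mono) auto
    finally show "fsum v P G xs \<le> 1 + int npoints * int npoints ^ ?e"
      using char_fun_bounds[of P "0 # xs"] by (simp add: fsum_def)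
  qed
  have fp: "map2 (+) (fpath ?p B (ds, k)) (card \<Delta> # rev (mark \<Delta> (bagl X)) @ [1]) =
      (B - ds ! ?p + card \<Delta>) # rev (map2 (+) (delat ?p ds) (mark \<Delta> (bagl X))) @ [Suc k]"
    if "(ds, k) \<in> Rset t1" for ds k \<Delta>
  proof -
    have "length (delat ?p ds) = length (mark \<Delta> (bagl X))" using len[OF that] l m by simp
    then show ?thesis by (simp add: fpath_def map2_rev zip_append del: rev_map)
  qed
  have inj: "rev ds @ [k] = rev ds' @ [k'] \<longleftrightarrow> ds = ds' \<and> k = k'" for ds ds' and k k' :: nat by simp
  show "set (rows_of npoints (Suc m) (fsum v P G)) = Rset ?t"
    unfolding set_rows_of Rset_forget[OF sep v l B']
  proof (intro subset_antisym subsetI)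
    fix r assume "r \<in> {(ds, k). rev ds @ [k] \<in> grid npoints (Suc m) \<and> fsum v P G (rev ds @ [k]) \<noteq> 0}"
    then obtain ds k where r: "r = (ds, k)" and g: "rev ds @ [k] \<in> grid npoints (Suc m)" "fsum v P G (rev ds @ [k]) \<noteq> 0" by auto
    from iffD1[OF nz[OF g(1)] g(2)] show "r \<in> {(delat ?p ds1, k) | ds1 k. (ds1, k) \<in> Rset t1 \<and> ds1 ! ?p = B} \<union>
      {(map2 (+) (delat ?p ds1) (mark \<Delta> (bagl X)), Suc k1) | ds1 k1 \<Delta>.
       (ds1, k1) \<in> Rset t1 \<and> \<Delta> \<subseteq> ?N \<inter> X \<and> ds1 ! ?p \<le> B \<and> B + card \<Delta> \<le> c v + ds1 ! ?p}"
    proof (elim disjE exE conjE bexE)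
      assume "0 # rev ds @ [k] \<in> P"
      then obtain ds1 k1 where r1: "(ds1, k1) \<in> Rset t1" "0 # rev ds @ [k] = fpath ?p B (ds1, k1)" by (auto simp: P_def)
      then have "ds = delat ?p ds1" "k = k1" "B - ds1 ! ?p = 0" by (auto simp: fpath_def)
      with nthB[OF r1(1)] r1(1) r show ?thesis by (intro UnI1) auto
    next
      fix s ys zs
      assume 2: "s \<le> c v" "ys \<in> P" "zs \<in> gpaths v X" "map2 (+) ys zs = s # rev ds @ [k]"
      then obtain ds1 k1 where r1: "(ds1, k1) \<in> Rset t1" "ys = fpath ?p B (ds1, k1)" by (auto simp: P_def)
      from 2 obtain \<Delta> where D: "\<Delta> \<subseteq> ?N \<inter> X" "zs = card \<Delta> # rev (mark \<Delta> (bagl X)) @ [1]" by (auto simp: gpaths_def)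
      from 2(4)[unfolded r1(2) D(2) fp[OF r1(1)]]
      have "ds = map2 (+) (delat ?p ds1) (mark \<Delta> (bagl X))" "k = Suc k1" "s = B - ds1 ! ?p + card \<Delta>"
        using inj by auto
      moreover from this(3) 2(1) nthB[OF r1(1)] have "B + card \<Delta> \<le> c v + ds1 ! ?p" by simp
      ultimately show ?thesis using r r1(1) D(1) nthB[OF r1(1)] by blast
    qed
  next
    fix r assume "r \<in> {(delat ?p ds1, k) | ds1 k. (ds1, k) \<in> Rset t1 \<and> ds1 ! ?p = B} \<union>
      {(map2 (+) (delat ?p ds1) (mark \<Delta> (bagl X)), Suc k1) | ds1 k1 \<Delta>.
       (ds1, k1) \<in> Rset t1 \<and> \<Delta> \<subseteq> ?N \<inter> X \<and> ds1 ! ?p \<le> B \<and> B + card \<Delta> \<le> c v + ds1 ! ?p}"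
    then consider ds1 k where "r = (delat ?p ds1, k)" "(ds1, k) \<in> Rset t1" "ds1 ! ?p = B"
      | ds1 k1 \<Delta> where "r = (map2 (+) (delat ?p ds1) (mark \<Delta> (bagl X)), Suc k1)" "(ds1, k1) \<in> Rset t1"
        "\<Delta> \<subseteq> ?N \<inter> X" "ds1 ! ?p \<le> B" "B + card \<Delta> \<le> c v + ds1 ! ?p" by blast
    then show "r \<in> {(ds, k). rev ds @ [k] \<in> grid npoints (Suc m) \<and> fsum v P G (rev ds @ [k]) \<noteq> 0}"
    proof cases
      case (1 ds1 k)
      have "fpath ?p B (ds1, k) = 0 # rev (delat ?p ds1) @ [k]" using 1 by (simp add: fpath_def)
      then have p: "0 # rev (delat ?p ds1) @ [k] \<in> P" using 1 by (force simp: P_def)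
      with Pg have g: "rev (delat ?p ds1) @ [k] \<in> grid npoints (Suc m)" by auto
      from nz[OF g] p g 1(1) show ?thesis by simp
    next
      case (2 ds1 k1 \<Delta>)
      let ?ys = "fpath ?p B (ds1, k1)" and ?zs = "card \<Delta> # rev (mark \<Delta> (bagl X)) @ [1]"
      let ?xs = "rev (map2 (+) (delat ?p ds1) (mark \<Delta> (bagl X))) @ [Suc k1]"
      have yz: "?ys \<in> P" "?zs \<in> gpaths v X" using 2 by (auto simp: P_def gpaths_def)
      note e = fp[OF 2(2), of \<Delta>]
      have "(B - ds1 ! ?p + card \<Delta>) # ?xs \<in> grid npoints (Suc (Suc m))"
        using sum_in_grid[OF PB[rule_format, OF yz(1)] QB[rule_format, OF yz(2)] ab] la unfolding e by simp
      then have g: "?xs \<in> grid npoints (Suc m)" "B - ds1 ! ?p + card \<Delta> < npoints" by (auto simp del: map2_rev)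
      have r: "B - ds1 ! ?p + card \<Delta> \<le> c v" using 2 by simp
      have "fsum v P G ?xs \<noteq> 0"
        unfolding nz[OF g(1)] by (intro disjI2 exI conjI bexI) (rule g(2), rule r, rule e, rule yz(2), rule yz(1))
      with g 2(1) show ?thesis by simp
    qed
  qed
qed

end

section \<open>The program on a tree decomposition\<close>

text \<open>The unit for the work at a node, with \<open>Z\<close> a bound on rows and array cells.
  In \<open>(N + 1)^3\<close> one factor is the \<open>D + 1\<close> of an array operation; such an
  operation is repeated for \<open>N\<close> columns on each of the axes.\<close>

definition node_cost :: "nat \<Rightarrow> nat \<Rightarrow> nat \<Rightarrow> nat" where
  "node_cost N L Z = (N + 1) * ((N + 1) * ((N + 1) * ((scalar_cost L + 100) * Z)))"

lemma node_cost_poly: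
  assumes "x \<le> 200 * ((N + 1) * ((N + 1) * Z))"
  shows "x \<le> node_cost N L Z"
proof -
  have "200 * Z \<le> (N + 1) * ((scalar_cost L + 100) * Z)"
    using mult_le_mono[of 1 "N + 1" "200 * Z" "(scalar_cost L + 100) * Z"] scalar_cost_ge(2)[of L] by simp
  then have "(N + 1) * ((N + 1) * (200 * Z)) \<le> node_cost N L Z" unfolding node_cost_def by (intro mult_le_mono2)
  moreover have "200 * ((N + 1) * ((N + 1) * Z)) = (N + 1) * ((N + 1) * (200 * Z))" by (simp only: mult_ac)
  ultimately show ?thesis using assms by (metis order.trans)
qed

lemma node_cost_rows:
  assumes "r \<le> Z" "1 \<le> Z" "s + 10 \<le> 200 * ((N + 1) * (N + 1))"
  shows "r * s + 10 \<le> node_cost N L Z"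
proof (rule node_cost_poly)
  have "r * s + 10 \<le> Z * s + 10 * Z" using assms(1,2) by (intro add_mono mult_le_mono1) auto
  also have "\<dots> = Z * (s + 10)" by (simp add: algebra_simps)
  also have "\<dots> \<le> Z * (200 * ((N + 1) * (N + 1)))" using assms(3) by (rule mult_le_mono2)
  finally show "r * s + 10 \<le> 200 * ((N + 1) * ((N + 1) * Z))" by (simp only: mult_ac)
qed

lemma node_cost_const:
  assumes "1 \<le> Z" "x \<le> 200 * ((N + 1) * (N + 1))"
  shows "x \<le> node_cost N L Z"
proof (rule node_cost_poly)
  have "200 * ((N + 1) * (N + 1)) * 1 \<le> 200 * ((N + 1) * (N + 1)) * Z" using assms(1) by (rule mult_le_mono2)
  then have "200 * ((N + 1) * (N + 1)) \<le> 200 * ((N + 1) * ((N + 1) * Z))" by (simp only: mult_ac mult_1_right)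
  with assms(2) show "x \<le> 200 * ((N + 1) * ((N + 1) * Z))" by (rule order.trans)
qed

lemma array_cost_le:
  assumes "D \<le> N" "N ^ D \<le> Z"
  shows "array_cost N L D \<le> (scalar_cost L + 100) * ((N + 1) * Z)"
  unfolding array_cost_def using assms by (intro mult_le_mono) auto

lemma node_cost_array:
  assumes "D \<le> N" "N ^ D \<le> Z"
  shows "(N + 1) * array_cost N L D \<le> node_cost N L Z"
proof -
  have "(N + 1) * array_cost N L D \<le> (N + 1) * ((N + 1) * ((scalar_cost L + 100) * Z))"
    using mult_le_mono2[OF array_cost_le[OF assms], of "N + 1" L] by (simp only: mult_ac)
  also have "\<dots> \<le> node_cost N L Z"
    unfolding node_cost_def by (intro mult_le_mono2) simp
  finally show ?thesis .
qed

lemma node_cost_array1: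
  assumes "D \<le> N" "N ^ D \<le> Z"
  shows "array_cost N L D \<le> node_cost N L Z"
  using node_cost_array[OF assms, of L] by simp

lemma node_cost_conv:
  assumes "D \<le> N" "N ^ D \<le> Z"
  shows "conv_cost N L D \<le> 12 * node_cost N L Z"
proof -
  have "conv_cost N L D \<le> (N + 1) * (12 * ((N + 1) * ((scalar_cost L + 100) * ((N + 1) * Z))))"
    unfolding conv_cost_def using assms by (intro mult_le_mono array_cost_le) auto
  then show ?thesis unfolding node_cost_def by (simp only: mult_ac)
qed

lemma quad_le:
  fixes m :: nat
  assumes "m \<le> N + 1" "1 \<le> N"
  shows "m * (50 * N + 50) + 60 \<le> 200 * ((N + 1) * (N + 1))" "m * (20 * N + 60) + 70 + 20 * N \<le> 200 * ((N + 1) * (N + 1))"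
    "100 * N + 200 \<le> 200 * ((N + 1) * (N + 1))" "m * (20 * N + 50) + 10 \<le> 200 * ((N + 1) * (N + 1))"
proof -
  have "m * (50 * N + 50) \<le> (N + 1) * (50 * N + 50)" "m * (20 * N + 60) \<le> (N + 1) * (20 * N + 60)"
    "m * (20 * N + 50) \<le> (N + 1) * (20 * N + 50)"
    using assms(1) by (rule mult_le_mono1)+
  then show "m * (50 * N + 50) + 60 \<le> 200 * ((N + 1) * (N + 1))" "m * (20 * N + 60) + 70 + 20 * N \<le> 200 * ((N + 1) * (N + 1))"
    "100 * N + 200 \<le> 200 * ((N + 1) * (N + 1))" "m * (20 * N + 50) + 10 \<le> 200 * ((N + 1) * (N + 1))"
    by (simp_all add: algebra_simps)
qed

lemma left_int_array: "0 < N \<Longrightarrow> left (int_array N L (Suc D) f) = int_array N L D (\<lambda>xs. f (0 # xs))"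
  by (simp add: upt_conv_Cons)

section \<open>The work at a join node and at a forget node\<close>

context instance_graph
begin

lemma len_bag_spec: "computes f_len [epath (map (idx vs) (bagl X))] (enc_nat (length (bagl X))) (10 * length (bagl X) + 5)"
  using len_spec[of "map enc_nat (map (idx vs) (bagl X))"] by simp

lemma app_path_spec: "computes f_app [epath xs, epath ys] (epath (xs @ ys)) (20 * length xs + 10)"
  using app_spec[of "map enc_nat xs" "map enc_nat ys"] by simp

text \<open>The row lists of the children may be as long as \<open>Z\<close>. The new list has at
  most one row per cell of its own array, so the bound does not grow along the tree, even though the
  order of the rows and the way they were found are arbitrary.\<close>

lemma join_spec:
  assumes sep: "all_separated V E (Node X [t1, t2])" and X: "bag t1 = X" "bag t2 = X"
    and rows: "set rows1 = Rset t1" "length rows1 \<le> Z" "set rows2 = Rset t2" "length rows2 \<le> Z"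
    and Z: "npoints ^ Suc (card X) \<le> Z" and ys: "length ys1 \<le> npoints"
  shows "\<exists>rows. set rows = Rset (Node X [t1, t2]) \<and> length rows \<le> npoints ^ Suc (card X) \<and>
    computes f_join [epath (map (idx vs) (bagl X)),
        Pair (epath ys1) (Pair (enc_list (map erow rows1)) z1),
        Pair (epath ys2) (Pair (enc_list (map erow rows2)) z2), ctxt]
      (Pair (epath (ys1 @ ys2)) (Pair (enc_list (map erow rows)) (Pair (enc_list (map erow rows1)) z1)))
      (60 * node_cost npoints word_size Z)"
proof -
  define m where "m = length (bagl X)"
  define H where "H = node_cost npoints word_size Z"
  have XV: "X \<subseteq> V" using bag_subset_V(1)[OF sep] by simp
  have m: "m = card X" using length_bagl[OF XV] by (simp add: m_def)
  have mn: "Suc m \<le> npoints" using card_less_npoints[OF XV] m by simp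
  have n1: "1 \<le> npoints" using npoints_pos by simp
  have Zm: "npoints ^ Suc m \<le> Z" using Z m by simp
  have "1 \<le> npoints ^ Suc m" using n1 by (rule one_le_power)
  then have Z1: "1 \<le> Z" using Zm by (rule order.trans)
  note q = quad_le[OF trans_le_add1[OF mn] n1]
  note sem = join_sem[OF sep X m_def]
  let ?P = "jpath ` Rset t1" and ?Q = "jpath ` Rset t2"
  let ?G = "prodf (Suc m) ?P ?Q"
  have H: "200 \<le> H" unfolding H_def using n1 by (intro node_cost_const[OF Z1]) simp
  have s_len: "computes f_len [epath (map (idx vs) (bagl X))] (enc_nat m) H"
    unfolding H_def by (rule computes_mono[OF len_bag_spec[of X, folded m_def]], rule node_cost_const[OF Z1]) (use q(3) mn in simp)
  have s_zero: "computes f_zeros [Pair Atom (enc_nat m), enc_nat npoints, bits word_size 0] (int_array npoints word_size (Suc m) (\<lambda>_. 0)) H"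
    using zeros_spec[of "Suc m" npoints word_size] unfolding H_def enc_nat.simps
    by (rule computes_mono) (rule node_cost_const[OF Z1], rule q(4))
  have s_app: "computes f_app [epath ys1, epath ys2] (epath (ys1 @ ys2)) H"
    unfolding H_def by (rule computes_mono[OF app_path_spec], rule node_cost_const[OF Z1]) (use q(3) ys in simp)
  have s_jp: "computes f_jpaths [enc_list (map erow rs)] (enc_list (map epath (map jpath rs))) H"
    if "set rs = Rset s" "length rs \<le> Z" "bag s = X" for rs s
  proof -
    have "\<forall>r\<in>set rs. length (fst r) = m"
      using that Rset_length[of _ _ s] by (force simp: m_def)
    from jpaths_spec[OF this] show ?thesis
      unfolding H_def map_map comp_def
      by (rule computes_mono) (rule node_cost_rows[OF that(2) Z1], use q(3) mn in simp)
  qed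
  have s_fill: "computes f_fill [enc_list (map epath (map jpath rs)), int_array npoints word_size (Suc m) (\<lambda>_. 0), bits word_size 1]
      (int_array npoints word_size (Suc m) (char_fun (jpath ` Rset s))) H"
    if "set rs = Rset s" "length rs \<le> Z" "jpath ` Rset s \<subseteq> grid npoints (Suc m)" for rs s
  proof -
    have "set (map jpath rs) = jpath ` Rset s" using that by simp
    from fill_ind_spec[OF this that(3)] show ?thesis unfolding H_def
      by (rule computes_mono) (rule node_cost_rows[OF _ Z1], use q(1) that in simp_all)
  qed
  have s_conv: "computes f_conv [Pair Atom (enc_nat m), int_array npoints word_size (Suc m) (char_fun ?P), int_array npoints word_size (Suc m) (char_fun ?Q), vmat, wmat]
     (int_array npoints word_size (Suc m) ?G) (12 * H)"
    using conv_ctxt_spec[of "Suc m"] unfolding H_def enc_nat.simps by (rule computes_mono) (rule node_cost_conv[OF mn Zm])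
  have s_enum: "computes f_enum [Pair Atom (enc_nat m), int_array npoints word_size (Suc m) ?G, Atom, Atom, Atom]
     (enc_list (map erow (rows_of npoints (Suc m) ?G))) H"
  proof -
    have "computes f_enum [enc_nat (Suc m), int_array npoints word_size (Suc m) ?G, Atom, Atom, Atom]
       (enc_list (map erow (rows_of npoints (Suc m) ?G))) (array_cost npoints word_size (Suc m))"
      by (rule enum_rows_spec[OF npoints_pos]) (rule sem(3))
    then show ?thesis unfolding H_def enc_nat.simps by (rule computes_mono) (rule node_cost_array1[OF mn Zm])
  qed
  have "computes f_join [epath (map (idx vs) (bagl X)),
        Pair (epath ys1) (Pair (enc_list (map erow rows1)) z1),
        Pair (epath ys2) (Pair (enc_list (map erow rows2)) z2), ctxt]
      (Pair (epath (ys1 @ ys2)) (Pair (enc_list (map erow (rows_of npoints (Suc m) ?G))) (Pair (enc_list (map erow rows1)) z1)))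
      (60 * H)"
    apply (rule computesI)
     apply (simp add: prog_nth join_body_def elemE_eqs del: map_map map_append int_array.simps)
     apply (rule callI[OF s_len])
     apply (rule callI[OF s_zero])
     apply (rule callI[OF s_app])
     apply (rule callI[OF s_jp[OF rows(1,2) X(1)]])
     apply (rule callI[OF s_fill[OF rows(1,2) sem(1)]])
     apply (rule callI[OF s_jp[OF rows(3,4) X(2)]])
     apply (rule callI[OF s_fill[OF rows(3,4) sem(2)]])
     apply (rule callI[OF s_conv])
     apply (rule callI[OF s_enum])
    using H apply (simp del: map_map map_append)
    apply simp
    done
  then show ?thesis
    unfolding H_def using sem(4) length_rows_of[of npoints "Suc m" ?G] m by blast
qed

lemma inj_on_idx_subset: "A \<subseteq> V \<Longrightarrow> inj_on (idx vs) A"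
  using inj_on_idx set_vs by (metis inj_on_subset)

lemma idx_less_length: "v \<in> V \<Longrightarrow> idx vs v < length vs"
  using idx_less set_vs by metis

lemma adjacency_row_spec:
  assumes "v \<in> V"
  shows "computes f_nth [enc_nat (idx vs v), adjm] (enc_list (map enc_bool (map (\<lambda>w. {v, w} \<in> E) vs))) (20 * idx vs v + 10)"
  using nth_spec[of "idx vs v" "map (\<lambda>u. enc_list (map (\<lambda>v. enc_bool ({u, v} \<in> E)) vs)) vs"]
    idx_less_length[OF assms] nth_idx[of v vs] assms set_vs
  by (simp add: adjm_def comp_def)

lemma capacity_spec:
  assumes "v \<in> V"
  shows "computes f_nth [enc_nat (idx vs v), capl] (enc_nat (c v)) (20 * idx vs v + 10)"
  using nth_spec[of "idx vs v" "map (\<lambda>v. enc_nat (c v)) vs"] idx_less_length[OF assms] nth_idx[of v vs] assms set_vs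
  by (simp add: capl_def)

lemma adjacency_nth: "u \<in> V \<Longrightarrow> map (\<lambda>w. {v, w} \<in> E) vs ! idx vs u \<longleftrightarrow> u \<in> neighbours E v"
  using idx_less_length[of u] nth_idx[of u vs] set_vs by (simp add: neighbours_def insert_commute)

text \<open>Counting list entries gives a cardinality since the positions are distinct and
  \<open>idx\<close> is injective on the vertices.\<close>

lemma count_neighbours:
  assumes "distinct ys" "set ys = idx vs ` Y" "Y \<subseteq> V"
  shows "length (filter (\<lambda>y. map (\<lambda>w. {v, w} \<in> E) vs ! y) ys) = card (neighbours E v \<inter> Y)"
proof -
  have "length (filter (\<lambda>y. map (\<lambda>w. {v, w} \<in> E) vs ! y) ys) =
      card (set (filter (\<lambda>y. map (\<lambda>w. {v, w} \<in> E) vs ! y) ys))"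
    using assms(1) by (simp only: distinct_card distinct_filter)
  also have "set (filter (\<lambda>y. map (\<lambda>w. {v, w} \<in> E) vs ! y) ys) = idx vs ` (neighbours E v \<inter> Y)"
    unfolding set_filter assms(2) using adjacency_nth assms(3) by blast
  also have "card \<dots> = card (neighbours E v \<inter> Y)"
    using assms(3) by (intro card_image inj_on_idx_subset) auto
  finally show ?thesis .
qed

text \<open>The arrays have an axis for each vertex of the child's bag and one for \<open>k\<close>,
  hence the exponent \<open>Suc (card (bag t1))\<close>, one more than for the resulting
  table.\<close>

lemma forget_spec:
  assumes sep: "all_separated V E (Node X [t1])" and v: "forgets v X (bag t1)"
    and rows: "set rows1 = Rset t1" "length rows1 \<le> Z"
    and Z: "npoints ^ Suc (card (bag t1)) \<le> Z" and ys: "distinct ys" "set ys = idx vs ` Yset t1"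
  shows "\<exists>rows. set rows = Rset (Node X [t1]) \<and> length rows \<le> npoints ^ Suc (card X) \<and>
    computes f_forget [epath (map (idx vs) (bagl X)), epath (map (idx vs) (bagl (bag t1))),
        Pair (epath ys) (Pair (enc_list (map erow rows1)) z), ctxt]
      (Pair (epath (idx vs v # ys)) (Pair (enc_list (map erow rows)) (Pair (enc_list (map erow rows1)) z)))
      (80 * node_cost npoints word_size Z)"
proof -
  define m where "m = length (bagl X)"
  define H where "H = node_cost npoints word_size Z"
  have X: "bag t1 = insert v X" "v \<notin> X" using v by (auto simp: forgets_def)
  have s1: "all_separated V E t1" using all_separated_child[OF sep] by simp
  have vXV: "insert v X \<subseteq> V" using bag_subset_V(1)[OF s1] X by simp
  then have XV: "X \<subseteq> V" and vV: "v \<in> V" by auto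
  obtain pre post where l': "bagl (insert v X) = pre @ v # post" "bagl X = pre @ post"
    using bagl_insert[OF vXV X(2)] by blast
  then have l: "bagl (bag t1) = pre @ v # post" "bagl X = pre @ post" using X by simp_all
  let ?p = "length pre"
  have m: "m = card X" using length_bagl[OF XV] by (simp add: m_def)
  have cb: "card (bag t1) = Suc m" using X m finite_subset[OF XV finite_V] by simp
  have pm: "?p \<le> m" using l m_def by simp
  have mn: "Suc (Suc m) \<le> npoints" using card_less_npoints[OF vXV] cb X by simp
  have mn1: "Suc m \<le> npoints" using mn by simp
  have n1: "1 \<le> npoints" using npoints_pos by simp
  have Z2: "npoints ^ Suc (Suc m) \<le> Z" using Z unfolding cb .
  have "npoints ^ Suc m \<le> npoints ^ Suc (Suc m)" "npoints ^ m \<le> npoints ^ Suc (Suc m)" using n1 by (intro power_increasing; simp)+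
  then have Zm: "npoints ^ Suc m \<le> Z" and Z0: "npoints ^ m \<le> Z" using Z2 by (meson order.trans)+
  have "1 \<le> npoints ^ Suc m" using n1 by (rule one_le_power)
  then have Z1: "1 \<le> Z" using Zm by (rule order.trans)
  \<comment> \<open>The sets \<Delta> are listed once per node and not once per row, so
    \<open>2 ^ m\<close> of them fit into \<open>Z\<close>; there are at least two points since
    \<open>v\<close> is a vertex.\<close>
  have "2 ^ m \<le> npoints ^ m" using mn by (intro power_mono) auto
  then have Zg: "2 ^ m \<le> Z" using Z0 by (rule order.trans)
  note q = quad_le[OF trans_le_add1[OF mn] n1]
  have iv: "idx vs v < npoints" using idx_less_length[OF vV] by (simp add: npoints_def)
  have YV: "Yset t1 \<subseteq> V" by (rule bag_subset_V(3)[OF s1])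
  define B where "B = card (neighbours E v \<inter> Yset t1)"
  define bs where "bs = map (\<lambda>w. {v, w} \<in> E) vs"
  have lbs: "length bs = length vs" by (simp add: bs_def)
  have lys: "length ys \<le> npoints"
    using distinct_card[OF ys(1)] ys(2) card_image[OF inj_on_idx_subset[OF YV]] card_less_npoints[OF YV] by simp
  let ?P = "fpath ?p B ` Rset t1" and ?Q = "gpaths v X"
  let ?G = "prodf (Suc (Suc m)) ?P ?Q"
  let ?F = "fsum v ?P ?G"
  note sem = forget_sem[OF sep v l B_def m_def]
  have H: "200 \<le> H" unfolding H_def using n1 by (intro node_cost_const[OF Z1]) simp
  have s_pos: "computes f_pos [epath (map (idx vs) (bagl (bag t1))), epath (map (idx vs) (bagl X))] (enc_nat ?p) H"
  proof -
    have d: "distinct (pre @ v # post)" using distinct_bagl[of "bag t1"] l by simp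
    have sb: "set (pre @ v # post) \<subseteq> V" using set_bagl[OF vXV] l' vXV by simp
    have "idx vs v \<notin> set (map (idx vs) post)"
      using d sb inj_onD[OF inj_on_idx_subset[OF sb], of v] by auto
    moreover have "set (map (idx vs) pre) \<subseteq> {..<length vs}" using sb idx_less_length by auto
    ultimately have "computes f_pos [epath (map (idx vs) pre @ idx vs v # map (idx vs) post), epath (map (idx vs) pre @ map (idx vs) post)]
       (enc_nat (length (map (idx vs) pre)))
       (length (map (idx vs) pre) * (20 * length vs + 60) + 20 * length vs + 60)"
      using idx_less_length[OF vV] by (rule pos_spec)
    then have "computes f_pos [epath (map (idx vs) (bagl (bag t1))), epath (map (idx vs) (bagl X))] (enc_nat ?p)
       (?p * (20 * length vs + 60) + 20 * length vs + 60)" unfolding l by simp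
    then show ?thesis unfolding H_def
    proof (rule computes_mono, intro node_cost_const[OF Z1])
      have "?p * (20 * length vs + 60) \<le> Suc (Suc m) * (20 * npoints + 60)" using pm by (intro mult_le_mono) (auto simp: npoints_def)
      then show "?p * (20 * length vs + 60) + 20 * length vs + 60 \<le> 200 * ((npoints + 1) * (npoints + 1))"
        using q(2) by (simp add: npoints_def)
    qed
  qed
  have s_nthv: "computes f_nth [enc_nat ?p, epath (map (idx vs) (bagl (bag t1)))] (enc_nat (idx vs v)) H"
  proof -
    have "computes f_nth [enc_nat ?p, epath (map (idx vs) (bagl (bag t1)))] (enc_nat (idx vs v)) (20 * ?p + 10)"
      using nth_spec[of ?p "map enc_nat (map (idx vs) (bagl (bag t1)))"] l by (simp add: nth_append)
    then show ?thesis unfolding H_def by (rule computes_mono) (rule node_cost_const[OF Z1], use q(3) pm mn in simp)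
  qed
  have s_row: "computes f_nth [enc_nat (idx vs v), adjm] (enc_list (map enc_bool bs)) H"
    using adjacency_row_spec[OF vV, folded bs_def] unfolding H_def
    by (rule computes_mono) (rule node_cost_const[OF Z1], use q(3) iv in simp)
  have s_len: "computes f_len [epath (map (idx vs) (bagl X))] (enc_nat m) H"
    unfolding H_def by (rule computes_mono[OF len_bag_spec[of X, folded m_def]], rule node_cost_const[OF Z1]) (use q(3) mn in simp)
  have s_zero: "computes f_zeros [Pair Atom (Pair Atom (enc_nat m)), enc_nat npoints, bits word_size 0] (int_array npoints word_size (Suc (Suc m)) (\<lambda>_. 0)) H"
    using zeros_spec[of "Suc (Suc m)" npoints word_size] unfolding H_def enc_nat.simps
    by (rule computes_mono) (rule node_cost_const[OF Z1], rule q(4))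
  have s_count: "computes f_count [enc_list (map enc_bool bs), epath ys] (enc_nat B) H"
  proof -
    have "set ys \<subseteq> {..<length bs}" using ys(2) YV idx_less_length lbs by auto
    from count_spec[OF this] have "computes f_count [enc_list (map enc_bool bs), epath ys] (enc_nat B)
       (length ys * (20 * length bs + 60) + 10)"
      unfolding bs_def count_neighbours[OF ys YV] B_def .
    then show ?thesis unfolding H_def
    proof (rule computes_mono, intro node_cost_const[OF Z1])
      have "length ys * (20 * length bs + 60) \<le> (npoints + 1) * (20 * npoints + 60)"
        using lys lbs by (intro mult_le_mono) (auto simp: npoints_def)
      then show "length ys * (20 * length bs + 60) + 10 \<le> 200 * ((npoints + 1) * (npoints + 1))"
        using quad_le(2)[OF order.refl n1] by simp
    qed
  qed
  have s_fp: "computes f_fpaths [enc_nat ?p, enc_nat B, enc_list (map erow rows1)] (enc_list (map epath (map (fpath ?p B) rows1))) H"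
  proof -
    have "\<forall>r\<in>set rows1. length (fst r) = Suc m \<and> fst r ! ?p \<le> npoints"
    proof
      fix r assume r: "r \<in> set rows1"
      obtain ds k where r': "r = (ds, k)" by (cases r)
      with r rows have d: "(ds, k) \<in> Rset t1" by simp
      have ln: "length ds = Suc m" using Rset_length[OF d] l m_def by simp
      have "ds ! ?p \<le> card (neighbours E (bagl (bag t1) ! ?p) \<inter> Yset t1)"
        using list_all2_nthD[OF Rset_bounds(2)[OF s1 d], of ?p] ln pm l by (simp add: nth_append)
      also have "\<dots> \<le> npoints"
        using card_mono[OF finite_neighbours, of "neighbours E (bagl (bag t1) ! ?p) \<inter> Yset t1"]
          card_neighbours_less[of "bagl (bag t1) ! ?p"] by (meson Int_lower1 le_trans less_imp_le)
      finally show "length (fst r) = Suc m \<and> fst r ! ?p \<le> npoints" using ln r' by simp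
    qed
    from fpaths_spec[OF this, of B] pm have "computes f_fpaths [enc_nat ?p, enc_nat B, enc_list (map erow rows1)]
      (enc_list (map epath (map (fpath ?p B) rows1))) (length rows1 * (20 * npoints + 60 * Suc m + 200) + 10)"
      by (simp add: comp_def)
    then show ?thesis unfolding H_def
      by (rule computes_mono) (rule node_cost_rows[OF rows(2) Z1], use q(3) mn n1 in simp)
  qed
  have s_fill: "computes f_fill [enc_list (map epath (map (fpath ?p B) rows1)), int_array npoints word_size (Suc (Suc m)) (\<lambda>_. 0), bits word_size 1]
      (int_array npoints word_size (Suc (Suc m)) (char_fun ?P)) H"
  proof -
    have "set (map (fpath ?p B) rows1) = ?P" using rows by simp
    from fill_ind_spec[OF this sem(1)] show ?thesis unfolding H_def
      by (rule computes_mono) (rule node_cost_rows[OF _ Z1], use q(1) rows in simp_all)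
  qed
  have s_cap: "computes f_nth [enc_nat (idx vs v), capl] (enc_nat (c v)) H"
    using capacity_spec[OF vV] unfolding H_def
    by (rule computes_mono) (rule node_cost_const[OF Z1], use q(3) iv in simp)
  let ?fl = "map (\<lambda>u. u \<in> neighbours E v) (bagl X)"
  have s_flags: "computes f_flags [enc_list (map enc_bool bs), epath (map (idx vs) (bagl X))] (enc_list (map enc_bool ?fl)) H"
  proof -
    have "set (map (idx vs) (bagl X)) \<subseteq> {..<length bs}" using set_bagl[OF XV] XV idx_less_length lbs by auto
    from flags_spec[OF this] have "computes f_flags [enc_list (map enc_bool bs), epath (map (idx vs) (bagl X))]
      (enc_list (map enc_bool (map (\<lambda>y. bs ! y) (map (idx vs) (bagl X))))) (m * (20 * length bs + 60) + 10)"
      by (simp add: m_def)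
    moreover have "map (\<lambda>y. bs ! y) (map (idx vs) (bagl X)) = ?fl"
      using adjacency_nth set_bagl[OF XV] XV by (auto simp: bs_def)
    ultimately have "computes f_flags [enc_list (map enc_bool bs), epath (map (idx vs) (bagl X))]
      (enc_list (map enc_bool ?fl)) (m * (20 * length bs + 60) + 10)" by metis
    then show ?thesis unfolding H_def
    proof (rule computes_mono, intro node_cost_const[OF Z1])
      have "m * (20 * length bs + 60) \<le> Suc (Suc m) * (20 * npoints + 60)"
        using lbs by (intro mult_le_mono) (auto simp: npoints_def)
      then show "m * (20 * length bs + 60) + 10 \<le> 200 * ((npoints + 1) * (npoints + 1))" using q(2) by simp
    qed
  qed
  have s_gen: "computes f_gen [enc_list (map enc_bool ?fl), Pair (Pair Atom Atom) Atom, Atom, Atom]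
     (enc_list (map epath (subset_paths ?fl [1] 0))) H"
  proof -
    have "computes f_gen [enc_list (map enc_bool ?fl), Pair (Pair Atom Atom) Atom, Atom, Atom]
     (enc_list (map epath (subset_paths ?fl [1] 0))) ((m + 1) * (60 * 2 ^ m))"
      using gen_spec[of ?fl "[1]" 0 "[]"] by (simp add: m_def)
    moreover have "(m + 1) * (60 * 2 ^ m) \<le> node_cost npoints word_size Z"
    proof (rule node_cost_poly)
      have "(m + 1) * (60 * 2 ^ m) \<le> (npoints + 1) * (60 * Z)" using mn Zg by (intro mult_le_mono) auto
      also have "\<dots> \<le> (npoints + 1) * (200 * ((npoints + 1) * Z))" by (intro mult_le_mono) auto
      finally show "(m + 1) * (60 * 2 ^ m) \<le> 200 * ((npoints + 1) * ((npoints + 1) * Z))" by (simp only: mult_ac)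
    qed
    ultimately show ?thesis unfolding H_def by (rule computes_mono)
  qed
  have s_fillg: "computes f_fill [enc_list (map epath (subset_paths ?fl [1] 0)), int_array npoints word_size (Suc (Suc m)) (\<lambda>_. 0), bits word_size 1]
      (int_array npoints word_size (Suc (Suc m)) (char_fun ?Q)) H"
  proof -
    have g: "set (subset_paths ?fl [1] 0) = ?Q"
      unfolding set_subset_paths[OF distinct_bagl] gpaths_def set_bagl[OF XV] by simp
    have gl: "length (subset_paths ?fl [1] 0) \<le> Z" using length_subset_paths[of ?fl "[1]" 0] Zg by (simp add: m_def)
    from fill_ind_spec[OF g sem(2)] show ?thesis unfolding H_def
      by (rule computes_mono) (rule node_cost_rows[OF gl Z1], use q(1) in simp)
  qed
  have s_conv: "computes f_conv [Pair Atom (Pair Atom (enc_nat m)), int_array npoints word_size (Suc (Suc m)) (char_fun ?P),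
       int_array npoints word_size (Suc (Suc m)) (char_fun ?Q), vmat, wmat]
     (int_array npoints word_size (Suc (Suc m)) ?G) (12 * H)"
    using conv_ctxt_spec[of "Suc (Suc m)"] unfolding H_def enc_nat.simps by (rule computes_mono) (rule node_cost_conv[OF mn Z2])
  have s_sum: "computes f_sumfirst [Pair Atom (enc_nat m), enc_nat (c v), int_array npoints word_size (Suc (Suc m)) ?G]
     (int_array npoints word_size (Suc m) (\<lambda>xs. \<Sum>r\<leftarrow>take (Suc (c v)) [0..<npoints]. ?G (r # xs))) (2 * H)"
  proof -
    have "computes f_sumfirst [enc_nat (Suc m), enc_nat (c v), enc_list (map (\<lambda>j. int_array npoints word_size (Suc m) (\<lambda>xs. ?G (j # xs))) [0..<npoints])]
     (int_array npoints word_size (Suc m) (\<lambda>xs. \<Sum>r\<leftarrow>take (Suc (c v)) [0..<npoints]. ?G (r # xs))) (length [0..<npoints] * (array_cost npoints word_size (Suc m) + 50) + 20)"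
      by (rule sumfirst_spec[OF npoints_pos]) (use npoints_pos in simp)
    moreover have "length [0..<npoints] * (array_cost npoints word_size (Suc m) + 50) + 20 \<le> 2 * node_cost npoints word_size Z"
    proof -
      have "50 * npoints + 20 \<le> node_cost npoints word_size Z" by (rule node_cost_const[OF Z1]) (use q(3) in simp)
      moreover have "npoints * array_cost npoints word_size (Suc m) \<le> node_cost npoints word_size Z" using node_cost_array[OF mn1 Zm, of word_size] by simp
      ultimately show ?thesis by (simp add: algebra_simps)
    qed
    ultimately show ?thesis unfolding H_def int_array.simps(2)[of _ _ "Suc m" ?G] enc_nat.simps by (rule computes_mono)
  qed
  have s_aadd: "computes f_aadd [Pair Atom (enc_nat m), int_array npoints word_size (Suc m) (\<lambda>xs. char_fun ?P (0 # xs)),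
      int_array npoints word_size (Suc m) (\<lambda>xs. \<Sum>r\<leftarrow>take (Suc (c v)) [0..<npoints]. ?G (r # xs))] (int_array npoints word_size (Suc m) ?F) H"
    using aadd_spec[OF npoints_pos, of "Suc m"] unfolding H_def enc_nat.simps fsum_def[abs_def]
    by (rule computes_mono) (rule node_cost_array1[OF mn1 Zm])
  have s_enum: "computes f_enum [Pair Atom (enc_nat m), int_array npoints word_size (Suc m) ?F, Atom, Atom, Atom]
     (enc_list (map erow (rows_of npoints (Suc m) ?F))) H"
  proof -
    have "computes f_enum [enc_nat (Suc m), int_array npoints word_size (Suc m) ?F, Atom, Atom, Atom]
       (enc_list (map erow (rows_of npoints (Suc m) ?F))) (array_cost npoints word_size (Suc m))"
      by (rule enum_rows_spec[OF npoints_pos]) (rule sem(3))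
    then show ?thesis unfolding H_def enc_nat.simps by (rule computes_mono) (rule node_cost_array1[OF mn1 Zm])
  qed
  have "computes f_forget [epath (map (idx vs) (bagl X)), epath (map (idx vs) (bagl (bag t1))),
        Pair (epath ys) (Pair (enc_list (map erow rows1)) z), ctxt]
      (Pair (epath (idx vs v # ys)) (Pair (enc_list (map erow (rows_of npoints (Suc m) ?F))) (Pair (enc_list (map erow rows1)) z)))
      (80 * H)"
    apply (rule computesI)
     apply (simp add: prog_nth forget_body_def elemE_eqs del: map_map map_append int_array.simps)
     apply (rule callI[OF s_pos])
     apply (rule callI[OF s_nthv])
     apply (rule callI[OF s_row])
     apply (rule callI[OF s_len])
     apply (rule callI[OF s_zero])
     apply (rule callI[OF s_count])
     apply (rule callI[OF s_fp])
     apply (rule callI[OF s_fill])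
    unfolding left_int_array[OF npoints_pos]
     apply (rule callI[OF s_cap])
     apply (rule callI[OF s_flags])
     apply (rule callI[OF s_gen])
     apply (rule callI[OF s_fillg])
     apply (rule callI[OF s_conv])
     apply (rule callI[OF s_sum])
     apply (rule callI[OF s_aadd])
     apply (rule callI[OF s_enum])
    using H apply (simp del: map_map map_append)
    apply simp
    done
  then show ?thesis
    unfolding H_def using sem(4) length_rows_of[of npoints "Suc m" ?F] m by blast
qed

end

section \<open>Recursion over the tree\<close>

lemma nodes_Cons: "nodes t = [] # tl (nodes t)"
  by (cases t) simp

lemma enc_vertex_idx: "enc_vertex vs = (\<lambda>v. enc_nat (idx vs v))"
  by (simp add: enc_vertex_def idx_def fun_eq_iff)

lemma enc_tree_eq:
  "enc_tree vs (Node X ts) = Pair (epath (map (idx vs) (enum_bag vs X))) (enc_list (map (enc_tree vs) ts))"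
  by (simp add: enc_vertex_idx comp_def)

lemma left_enc_tree: "left (enc_tree vs t) = epath (map (idx vs) (enum_bag vs (bag t)))"
  by (cases t) (simp add: enc_vertex_idx comp_def)

context instance_graph
begin

lemma node_cost_ge:
  assumes "1 \<le> Z"
  shows "200 \<le> node_cost npoints word_size Z"
  using node_cost_const[OF assms, of 200 npoints word_size] npoints_pos by simp

lemma power_npoints_ge: "1 \<le> npoints ^ k"
  using npoints_pos by simp

lemma unary_forget_spec:
  assumes sep: "all_separated V E (Node X [t1])" and v: "forgets v X (bag t1)"
    and rows: "set rows1 = Rset t1" "length rows1 \<le> Z"
    and Z: "npoints ^ Suc (card (bag t1)) \<le> Z" and ys: "distinct ys" "set ys = idx vs ` Yset t1"
  shows "\<exists>ys' rows. distinct ys' \<and> set ys' = idx vs ` Yset (Node X [t1]) \<and>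
    set rows = Rset (Node X [t1]) \<and> length rows \<le> npoints ^ Suc (card X) \<and>
    computes f_unary [epath (map (idx vs) (bagl X)), epath (map (idx vs) (bagl (bag t1))),
        Pair (epath ys) (Pair (enc_list (map erow rows1)) z), ctxt]
      (Pair (epath ys') (Pair (enc_list (map erow rows)) (Pair (enc_list (map erow rows1)) z)))
      (90 * node_cost npoints word_size Z)"
proof -
  define H where "H = node_cost npoints word_size Z"
  have X: "bag t1 = insert v X" "v \<notin> X" using v by (auto simp: forgets_def)
  have s1: "all_separated V E t1" using all_separated_child[OF sep] by simp
  have vXV: "insert v X \<subseteq> V" using bag_subset_V(1)[OF s1] X by simp
  then have XV: "X \<subseteq> V" and vV: "v \<in> V" by auto
  have Y: "Yset (Node X [t1]) = insert v (Yset t1)" using X bag_subset_Vset[of t1] by (auto simp: Yset_def)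
  have Z1: "1 \<le> Z" using power_npoints_ge Z by (rule order.trans)
  have H: "200 \<le> H" unfolding H_def by (rule node_cost_ge[OF Z1])
  have n1: "1 \<le> npoints" using npoints_pos by simp
  from forget_spec[OF sep v rows Z ys, of z] obtain rws where r: "set rws = Rset (Node X [t1])"
    "length rws \<le> npoints ^ Suc (card X)"
    and f: "computes f_forget [epath (map (idx vs) (bagl X)), epath (map (idx vs) (bagl (bag t1))),
        Pair (epath ys) (Pair (enc_list (map erow rows1)) z), ctxt]
      (Pair (epath (idx vs v # ys)) (Pair (enc_list (map erow rws)) (Pair (enc_list (map erow rows1)) z)))
      (80 * H)" unfolding H_def by blast
  have lX: "length (bagl X) = card X" "length (bagl (bag t1)) = card (bag t1)"
    using length_bagl XV vXV X(1) by simp_all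
  have c: "card X < card (bag t1)" using X finite_subset[OF XV finite_V] by simp
  have "card (bag t1) < npoints" using card_less_npoints[OF vXV] X by simp
  have s: "computes f_shorter [epath (map (idx vs) (bagl (bag t1))), epath (map (idx vs) (bagl X))] Atom H"
  proof -
    have "computes f_shorter [epath (map (idx vs) (bagl (bag t1))), epath (map (idx vs) (bagl X))] Atom (20 * card (bag t1) + 20)"
      using shorter_spec[of "map enc_nat (map (idx vs) (bagl (bag t1)))" "map enc_nat (map (idx vs) (bagl X))"] c lX
      by simp
    then show ?thesis unfolding H_def
      by (rule computes_mono) (rule node_cost_const[OF Z1], use quad_le(3)[OF le0 n1] \<open>card (bag t1) < npoints\<close> in simp)
  qed
  have "computes f_unary [epath (map (idx vs) (bagl X)), epath (map (idx vs) (bagl (bag t1))),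
        Pair (epath ys) (Pair (enc_list (map erow rows1)) z), ctxt]
      (Pair (epath (idx vs v # ys)) (Pair (enc_list (map erow rws)) (Pair (enc_list (map erow rows1)) z)))
      (90 * H)"
    apply (rule computesI)
     apply (simp add: prog_nth unary_body_def del: map_map list.map(2) enc_list.simps(2))
     apply (rule callI[OF s])
     apply (simp del: map_map list.map(2) enc_list.simps(2))
     apply (rule callI[OF f])
    using H apply (simp del: map_map)
    apply simp
    done
  \<comment> \<open>\<open>v\<close> lies in the child's bag and so is not yet among the forgotten
    vertices; the list stays free of repetitions, as counting requires.\<close>
  moreover have "idx vs v \<notin> idx vs ` Yset t1"
    using inj_on_idx_subset[of V] bag_subset_V(3)[OF s1] vV X by (auto simp: inj_on_def Yset_def)
  then have "distinct (idx vs v # ys)" "set (idx vs v # ys) = idx vs ` Yset (Node X [t1])"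
    using ys Y by auto
  ultimately show ?thesis using r unfolding H_def by blast
qed

text \<open>Each row receives the entry 0 at the position of \<open>v\<close>, so the number of rows
  is unchanged and the bound for the child's bag is more than enough for the larger bag.\<close>

lemma unary_introduce_spec:
  assumes sep: "all_separated V E (Node X [t1])" and v: "introduces v X (bag t1)"
    and rows: "set rows1 = Rset t1" "length rows1 \<le> npoints ^ Suc (card (bag t1))"
    and Z: "npoints ^ Suc (card X) \<le> Z" and ys: "distinct ys" "set ys = idx vs ` Yset t1"
  shows "\<exists>ys' rows. distinct ys' \<and> set ys' = idx vs ` Yset (Node X [t1]) \<and>
    set rows = Rset (Node X [t1]) \<and> length rows \<le> npoints ^ Suc (card X) \<and>
    computes f_unary [epath (map (idx vs) (bagl X)), epath (map (idx vs) (bagl (bag t1))),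
        Pair (epath ys) (Pair (enc_list (map erow rows1)) z), ctxt]
      (Pair (epath ys') (Pair (enc_list (map erow rows)) (Pair (enc_list (map erow rows1)) z)))
      (90 * node_cost npoints word_size Z)"
proof -
  define H where "H = node_cost npoints word_size Z"
  have X: "X = insert v (bag t1)" "v \<notin> bag t1" using v by (auto simp: introduces_def)
  have XV: "X \<subseteq> V" using bag_subset_V(1)[OF sep] by simp
  then have vXV: "insert v (bag t1) \<subseteq> V" and vV: "v \<in> V" and BV: "bag t1 \<subseteq> V" using X by auto
  have "separated V E (Node X [t1])" by (rule all_separated_root[OF sep])
  then have "Vset t1 \<inter> X \<subseteq> bag t1" by (auto simp: separated_def)
  then have Y: "Yset (Node X [t1]) = Yset t1" using X bag_subset_Vset[of t1] by (auto simp: Yset_def)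
  obtain pre post where l': "bagl (insert v (bag t1)) = pre @ v # post" "bagl (bag t1) = pre @ post"
    using bagl_insert[OF vXV X(2)] by blast
  then have l: "bagl X = pre @ v # post" "bagl (bag t1) = pre @ post" using X by simp_all
  have Z1: "1 \<le> Z" using power_npoints_ge Z by (rule order.trans)
  have H: "200 \<le> H" unfolding H_def by (rule node_cost_ge[OF Z1])
  have n1: "1 \<le> npoints" using npoints_pos by simp
  have lX: "length (bagl X) = card X" "length (bagl (bag t1)) = card (bag t1)"
    using length_bagl XV BV by simp_all
  have c: "card X = Suc (card (bag t1))" using X finite_subset[OF BV finite_V] by simp
  have cn: "card X < npoints" using card_less_npoints[OF XV] .
  have pc: "length pre \<le> card (bag t1)" using l lX by simp
  have rl: "length rows1 \<le> npoints ^ Suc (card X)"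
  proof -
    have "npoints ^ Suc (card (bag t1)) \<le> npoints ^ Suc (card X)" using n1 c by (intro power_increasing) auto
    with rows(2) show ?thesis by (rule order.trans)
  qed
  have rZ: "length rows1 \<le> Z" using rl Z by simp
  note q = quad_le[OF trans_le_add1[OF less_imp_le[OF cn]] n1]
  have s: "computes f_shorter [epath (map (idx vs) (bagl (bag t1))), epath (map (idx vs) (bagl X))] (Pair Atom Atom) H"
  proof -
    have "computes f_shorter [epath (map (idx vs) (bagl (bag t1))), epath (map (idx vs) (bagl X))] (Pair Atom Atom) (20 * card (bag t1) + 20)"
      using shorter_spec[of "map enc_nat (map (idx vs) (bagl (bag t1)))" "map enc_nat (map (idx vs) (bagl X))"] c lX
      by simp
    then show ?thesis unfolding H_def
      by (rule computes_mono) (rule node_cost_const[OF Z1], use q(3) cn c in simp)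
  qed
  have s_pos: "computes f_pos [epath (map (idx vs) (bagl X)), epath (map (idx vs) (bagl (bag t1)))] (enc_nat (length pre)) H"
  proof -
    have d: "distinct (pre @ v # post)" using distinct_bagl[of X] l by simp
    have sb: "set (pre @ v # post) \<subseteq> V" using set_bagl[OF vXV] l' vXV by simp
    have "idx vs v \<notin> set (map (idx vs) post)"
      using d sb inj_onD[OF inj_on_idx_subset[OF sb], of v] by auto
    moreover have "set (map (idx vs) pre) \<subseteq> {..<length vs}" using sb idx_less_length by auto
    ultimately have "computes f_pos [epath (map (idx vs) pre @ idx vs v # map (idx vs) post), epath (map (idx vs) pre @ map (idx vs) post)]
       (enc_nat (length (map (idx vs) pre)))
       (length (map (idx vs) pre) * (20 * length vs + 60) + 20 * length vs + 60)"
      using idx_less_length[OF vV] by (rule pos_spec)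
    then have "computes f_pos [epath (map (idx vs) (bagl X)), epath (map (idx vs) (bagl (bag t1)))] (enc_nat (length pre))
       (length pre * (20 * length vs + 60) + 20 * length vs + 60)" unfolding l by simp
    then show ?thesis unfolding H_def
    proof (rule computes_mono, intro node_cost_const[OF Z1])
      have "length pre * (20 * length vs + 60) \<le> card X * (20 * npoints + 60)" using pc c by (intro mult_le_mono) (auto simp: npoints_def)
      then show "length pre * (20 * length vs + 60) + 20 * length vs + 60 \<le> 200 * ((npoints + 1) * (npoints + 1))"
        using q(2) by (simp add: npoints_def)
    qed
  qed
  let ?rows = "map (irow (length pre)) rows1"
  have s_int: "computes f_introt [enc_nat (length pre), enc_list (map erow rows1)] (enc_list (map erow ?rows)) H"
  proof -
    have "\<forall>r\<in>set rows1. length (fst r) = card (bag t1)"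
      using rows(1) Rset_length[of _ _ t1] lX by force
    from introt_spec[OF this pc] show ?thesis
      unfolding H_def map_map comp_def
      by (rule computes_mono) (rule node_cost_rows[OF rZ Z1], use q(3) cn c in simp)
  qed
  have "computes f_unary [epath (map (idx vs) (bagl X)), epath (map (idx vs) (bagl (bag t1))),
        Pair (epath ys) (Pair (enc_list (map erow rows1)) z), ctxt]
      (Pair (epath ys) (Pair (enc_list (map erow ?rows)) (Pair (enc_list (map erow rows1)) z)))
      (90 * H)"
    apply (rule computesI)
     apply (simp add: prog_nth unary_body_def del: map_map)
     apply (rule callI[OF s])
     apply (simp del: map_map)
     apply (rule callI[OF s_pos])
     apply (rule callI[OF s_int])
    using H apply (simp del: map_map)
    apply simp
    done
  moreover have "set ?rows = Rset (Node X [t1])"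
    unfolding Rset_introduce[OF sep v l] using rows(1) by simp
  ultimately show ?thesis using ys rl unfolding H_def Y by (metis length_map)
qed

text \<open>The forgotten vertices are listed without repetition because a forget node counts
  neighbours among them. The head of the list of tables belongs to the root of the subtree, so a
  parent finds its child's table there. The bound on \<open>rw []\<close> restores the hypotheses of
  the node lemmas.\<close>

lemma solve_spec:
  assumes "all_separated V E t" and "\<And>\<alpha>. \<alpha> \<in> set (nodes t) \<Longrightarrow> card (bag_at t \<alpha>) \<le> w1"
  shows "\<exists>ys rw. distinct ys \<and> set ys = idx vs ` Yset t \<and>
    (\<forall>\<alpha>\<in>set (nodes t). set (rw \<alpha>) = Rset (subtree_at t \<alpha>)) \<and> length (rw []) \<le> npoints ^ Suc (card (bag t)) \<and>
    computes f_solve [enc_tree vs t, enc_list acc, ctxt]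
      (Pair (epath ys) (enc_list (map (\<lambda>\<alpha>. enc_list (map erow (rw \<alpha>))) (nodes t) @ acc)))
      (length (nodes t) * (100 * node_cost npoints word_size (npoints ^ Suc w1)))"
  using assms
proof (induction t arbitrary: acc)
  case (Node X ts)
  define Z where "Z = npoints ^ Suc w1"
  define H where "H = node_cost npoints word_size Z"
  note sep = Node.prems(1)
  have n1: "1 \<le> npoints" using npoints_pos by simp
  have Z1: "1 \<le> Z" unfolding Z_def by (rule power_npoints_ge)
  have H: "200 \<le> H" unfolding H_def by (rule node_cost_ge[OF Z1])
  have IH: "\<exists>ys rw. distinct ys \<and> set ys = idx vs ` Yset s \<and>
      (\<forall>\<alpha>\<in>set (nodes s). set (rw \<alpha>) = Rset (subtree_at s \<alpha>)) \<and> length (rw []) \<le> npoints ^ Suc (card (bag s)) \<and>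
      computes f_solve [enc_tree vs s, enc_list acc, ctxt]
       (Pair (epath ys) (enc_list (map (\<lambda>\<alpha>. enc_list (map erow (rw \<alpha>))) (nodes s) @ acc)))
       (length (nodes s) * (100 * H))"
    if s: "s \<in> set ts" for s acc
    unfolding H_def Z_def
  proof (rule Node.IH[OF s all_separated_child[OF sep s]])
    fix \<alpha> assume a: "\<alpha> \<in> set (nodes s)"
    from s obtain i where i: "i < length ts" "ts ! i = s" by (auto simp: in_set_conv_nth)
    then have "i # \<alpha> \<in> set (nodes (Node X ts))" using a by (simp add: in_nodes_iff del: nodes.simps)
    from Node.prems(2)[OF this] show "card (bag_at s \<alpha>) \<le> w1" using i by simp
  qed
  have Zle: "npoints ^ Suc (card (bag s)) \<le> Z" if "s \<in> set (Node X ts # ts)" for s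
  proof -
    have "card (bag s) \<le> w1"
    proof (cases "s = Node X ts")
      case True
      then show ?thesis using Node.prems(2)[of "[]"] by simp
    next
      case False
      with that obtain i where i: "i < length ts" "ts ! i = s" by (auto simp: in_set_conv_nth)
      then have "[i] \<in> set (nodes (Node X ts))" by (simp add: in_nodes_iff del: nodes.simps)
      from Node.prems(2)[OF this] show ?thesis using i by simp
    qed
    then show ?thesis unfolding Z_def using n1 by (intro power_increasing) auto
  qed
  have nice: "nice_node (Node X ts)" using all_separated_root[OF sep] by (simp add: separated_def)
  consider "ts = []" | t1 where "ts = [t1]" | t1 t2 where "ts = [t1, t2]" | t1 t2 t3 us where "ts = t1 # t2 # t3 # us"
    by (metis list.exhaust)
  then show ?case
  proof cases
    case 1
    with nice have X: "X = {}" by simp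
    have e: "enc_tree vs (Node X ts) = Pair Atom Atom" using 1 X by (simp add: enum_bag_def)
    have "computes f_solve [enc_tree vs (Node X ts), enc_list acc, ctxt]
      (Pair (epath []) (enc_list (map (\<lambda>\<alpha>. enc_list (map erow [([], 0)])) (nodes (Node X ts)) @ acc)))
      (length (nodes (Node X ts)) * (100 * H))"
      unfolding e
      apply (rule computesI)
      using H apply (simp add: prog_nth solve_body_def 1 erow_def)
      apply simp
      done
    moreover have "idx vs ` Yset (Node X ts) = {}" using X 1 by (simp add: Yset_def)
    ultimately show ?thesis
      unfolding Z_def[symmetric] H_def[symmetric] using 1 X Rset_leaf n1
      by (intro exI[of _ "[]"] exI[of _ "\<lambda>\<alpha>. [([], 0)]"]) simp
  next
    case 2
    have t1: "t1 \<in> set ts" using 2 by simp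
    from IH[OF t1, of acc] obtain ys1 rw1 where i: "distinct ys1" "set ys1 = idx vs ` Yset t1"
      "\<forall>\<alpha>\<in>set (nodes t1). set (rw1 \<alpha>) = Rset (subtree_at t1 \<alpha>)" "length (rw1 []) \<le> npoints ^ Suc (card (bag t1))"
      and sp: "computes f_solve [enc_tree vs t1, enc_list acc, ctxt]
       (Pair (epath ys1) (enc_list (map (\<lambda>\<alpha>. enc_list (map erow (rw1 \<alpha>))) (nodes t1) @ acc)))
       (length (nodes t1) * (100 * H))" by blast
    let ?T = "\<lambda>rw. map (\<lambda>\<alpha>. enc_list (map erow (rw \<alpha>)))"
    let ?z = "enc_list (?T rw1 (tl (nodes t1)) @ acc)"
    have out: "enc_list (?T rw1 (nodes t1) @ acc) = Pair (enc_list (map erow (rw1 []))) ?z"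
      by (subst nodes_Cons) simp
    have r0: "set (rw1 []) = Rset t1" using i(3)[rule_format, of "[]"] by simp
    have rZ: "length (rw1 []) \<le> Z" using i(4) Zle[of t1] 2 by simp
    have "\<exists>ys' rows. distinct ys' \<and> set ys' = idx vs ` Yset (Node X [t1]) \<and>
      set rows = Rset (Node X [t1]) \<and> length rows \<le> npoints ^ Suc (card X) \<and>
      computes f_unary [epath (map (idx vs) (bagl X)), epath (map (idx vs) (bagl (bag t1))),
        Pair (epath ys1) (Pair (enc_list (map erow (rw1 []))) ?z), ctxt]
      (Pair (epath ys') (Pair (enc_list (map erow rows)) (Pair (enc_list (map erow (rw1 []))) ?z)))
      (90 * H)"
    proof -
      from nice 2 obtain v where "introduces v X (bag t1) \<or> forgets v X (bag t1)" by auto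
      then show ?thesis
      proof
        assume "introduces v X (bag t1)"
        then show ?thesis unfolding H_def
          using Zle[of "Node X ts"] by (intro unary_introduce_spec[OF sep[unfolded 2] _ r0 i(4) _ i(1,2)]) simp_all
      next
        assume "forgets v X (bag t1)"
        then show ?thesis unfolding H_def
          using Zle[of t1] 2 by (intro unary_forget_spec[OF sep[unfolded 2] _ r0 rZ _ i(1,2)]) simp_all
      qed
    qed
    then obtain ys' rws where u: "distinct ys'" "set ys' = idx vs ` Yset (Node X [t1])"
      "set rws = Rset (Node X [t1])" "length rws \<le> npoints ^ Suc (card X)"
      and us: "computes f_unary [epath (map (idx vs) (bagl X)), epath (map (idx vs) (bagl (bag t1))),
        Pair (epath ys1) (Pair (enc_list (map erow (rw1 []))) ?z), ctxt]
      (Pair (epath ys') (Pair (enc_list (map erow rws)) (Pair (enc_list (map erow (rw1 []))) ?z)))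
      (90 * H)" by blast
    define rw where "rw \<alpha> = (case \<alpha> of [] \<Rightarrow> rws | i # q \<Rightarrow> rw1 q)" for \<alpha> :: "nat list"
    have nd: "nodes (Node X [t1]) = [] # map ((#) 0) (nodes t1)" by simp
    have out': "enc_list (?T rw (nodes (Node X [t1])) @ acc) =
       Pair (enc_list (map erow rws)) (Pair (enc_list (map erow (rw1 []))) ?z)"
      unfolding nd by (simp add: rw_def comp_def out del: nodes.simps)
    have "computes f_solve [enc_tree vs (Node X [t1]), enc_list acc, ctxt]
      (Pair (epath ys') (enc_list (?T rw (nodes (Node X [t1])) @ acc)))
      (length (nodes (Node X [t1])) * (100 * H))"
      unfolding out' unfolding enc_tree_eq nd
      apply (rule computesI)
       apply (simp add: prog_nth solve_body_def left_enc_tree del: map_map)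
       apply (rule callI[OF sp[unfolded out]])
       apply (rule callI[OF us])
      using H apply (simp del: map_map)
      apply simp
      done
    moreover have "\<forall>\<alpha>\<in>set (nodes (Node X [t1])). set (rw \<alpha>) = Rset (subtree_at (Node X [t1]) \<alpha>)"
      unfolding nd using u(3) i(3) by (auto simp: rw_def simp del: nodes.simps)
    moreover have "length (rw []) \<le> npoints ^ Suc (card (bag (Node X [t1])))" using u(4) by (simp add: rw_def)
    ultimately show ?thesis using u(1,2) unfolding 2 Z_def[symmetric] H_def[symmetric] by blast
  next
    case 3
    with nice have X: "bag t1 = X" "bag t2 = X" by auto
    have t1: "t1 \<in> set ts" and t2: "t2 \<in> set ts" using 3 by simp_all
    let ?T = "\<lambda>rw. map (\<lambda>\<alpha>. enc_list (map erow (rw \<alpha>)))"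
    from IH[OF t2, of acc] obtain ys2 rw2 where i2: "distinct ys2" "set ys2 = idx vs ` Yset t2"
      "\<forall>\<alpha>\<in>set (nodes t2). set (rw2 \<alpha>) = Rset (subtree_at t2 \<alpha>)" "length (rw2 []) \<le> npoints ^ Suc (card (bag t2))"
      and sp2: "computes f_solve [enc_tree vs t2, enc_list acc, ctxt]
       (Pair (epath ys2) (enc_list (?T rw2 (nodes t2) @ acc))) (length (nodes t2) * (100 * H))" by blast
    let ?acc = "?T rw2 (nodes t2) @ acc"
    from IH[OF t1, of ?acc] obtain ys1 rw1 where i1: "distinct ys1" "set ys1 = idx vs ` Yset t1"
      "\<forall>\<alpha>\<in>set (nodes t1). set (rw1 \<alpha>) = Rset (subtree_at t1 \<alpha>)" "length (rw1 []) \<le> npoints ^ Suc (card (bag t1))"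
      and sp1: "computes f_solve [enc_tree vs t1, enc_list ?acc, ctxt]
       (Pair (epath ys1) (enc_list (?T rw1 (nodes t1) @ ?acc))) (length (nodes t1) * (100 * H))" by blast
    let ?z1 = "enc_list (?T rw1 (tl (nodes t1)) @ ?acc)" and ?z2 = "enc_list (?T rw2 (tl (nodes t2)) @ acc)"
    have out1: "enc_list (?T rw1 (nodes t1) @ ?acc) = Pair (enc_list (map erow (rw1 []))) ?z1"
      by (subst nodes_Cons) simp
    have out2: "enc_list ?acc = Pair (enc_list (map erow (rw2 []))) ?z2"
      by (subst nodes_Cons) simp
    have r1: "set (rw1 []) = Rset t1" "length (rw1 []) \<le> Z" and r2: "set (rw2 []) = Rset t2" "length (rw2 []) \<le> Z"
      using i1(3)[rule_format, of "[]"] i2(3)[rule_format, of "[]"] i1(4) i2(4) Zle[of t1] Zle[of t2] 3 by simp_all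
    have s1: "all_separated V E t1" and s2: "all_separated V E t2"
      using all_separated_child[OF sep] t1 t2 by auto
    have YV: "Yset t1 \<subseteq> V" "Yset t2 \<subseteq> V" using bag_subset_V(3) s1 s2 by auto
    have ly: "length ys1 \<le> npoints"
      using distinct_card[OF i1(1)] i1(2) card_image[OF inj_on_idx_subset[OF YV(1)]] card_less_npoints[OF YV(1)] by simp
    have "npoints ^ Suc (card X) \<le> Z" using Zle[of t1] 3 X by simp
    from join_spec[OF sep[unfolded 3] X r1 r2 this ly, of ?z1 ys2 ?z2] obtain rws where
      u: "set rws = Rset (Node X [t1, t2])" "length rws \<le> npoints ^ Suc (card X)"
      and us: "computes f_join [epath (map (idx vs) (bagl X)), Pair (epath ys1) (Pair (enc_list (map erow (rw1 []))) ?z1),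
        Pair (epath ys2) (Pair (enc_list (map erow (rw2 []))) ?z2), ctxt]
      (Pair (epath (ys1 @ ys2)) (Pair (enc_list (map erow rws)) (Pair (enc_list (map erow (rw1 []))) ?z1)))
      (60 * H)" unfolding H_def by blast
    define rw where "rw \<alpha> = (case \<alpha> of [] \<Rightarrow> rws | i # q \<Rightarrow> if i = 0 then rw1 q else rw2 q)" for \<alpha> :: "nat list"
    have nd: "nodes (Node X [t1, t2]) = [] # map ((#) 0) (nodes t1) @ map ((#) (Suc 0)) (nodes t2)" by simp
    have out': "enc_list (?T rw (nodes (Node X [t1, t2])) @ acc) =
       Pair (enc_list (map erow rws)) (Pair (enc_list (map erow (rw1 []))) ?z1)"
      unfolding nd by (simp add: rw_def comp_def out1 del: nodes.simps)
    have "computes f_solve [enc_tree vs (Node X [t1, t2]), enc_list acc, ctxt]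
      (Pair (epath (ys1 @ ys2)) (enc_list (?T rw (nodes (Node X [t1, t2])) @ acc)))
      (length (nodes (Node X [t1, t2])) * (100 * H))"
      unfolding out' unfolding enc_tree_eq nd
      apply (rule computesI)
       apply (simp add: prog_nth solve_body_def del: map_map map_append)
       apply (rule callI[OF sp2])
       apply (simp only: right.simps)
       apply (rule callI[OF sp1[unfolded out1]])
       apply (subst out2)
       apply (rule callI[OF us])
      using H apply (simp del: map_map map_append add: algebra_simps)
      apply simp
      done
    moreover have "\<forall>\<alpha>\<in>set (nodes (Node X [t1, t2])). set (rw \<alpha>) = Rset (subtree_at (Node X [t1, t2]) \<alpha>)"
      unfolding nd using u(1) i1(3) i2(3) by (auto simp: rw_def simp del: nodes.simps)
    moreover have "length (rw []) \<le> npoints ^ Suc (card (bag (Node X [t1, t2])))" using u(2) by (simp add: rw_def)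
    moreover have "separated V E (Node X [t1, t2])" using all_separated_root[OF sep] 3 by simp
    then have VV: "Vset t1 \<inter> Vset t2 \<subseteq> X" by (auto simp: separated_def less_Suc_eq)
    then have Yd: "Yset t1 \<inter> Yset t2 = {}" using X by (auto simp: Yset_def)
    have Y: "Yset (Node X [t1, t2]) = Yset t1 \<union> Yset t2" using X bag_subset_Vset[of t1] by (auto simp: Yset_def)
    have "distinct (ys1 @ ys2)"
      using i1(1,2) i2(1,2) Yd inj_on_image_Int[OF inj_on_idx_subset[OF order.refl] YV] by simp
    moreover have "set (ys1 @ ys2) = idx vs ` Yset (Node X [t1, t2])" using i1(2) i2(2) Y by auto
    ultimately show ?thesis unfolding 3 Z_def[symmetric] H_def[symmetric] by blast
  next
    case 4
    with nice show ?thesis by simp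
  qed
qed

end

section \<open>From rows back to the encoded family\<close>

context instance_graph
begin

lemma inj_on_row_of:
  assumes "all_separated V E t"
  shows "inj_on (row_of (bag t)) (R' E c t)"
proof (rule inj_onI, clarify)
  fix d k d' k' assume a: "(d, k) \<in> R' E c t" "(d', k') \<in> R' E c t" "row_of (bag t) (d, k) = row_of (bag t) (d', k')"
  have "d u = d' u" for u
  proof (cases "u \<in> bag t")
    case True
    then have "the (d u) = the (d' u)" using a(3) set_bagl[OF bag_subset_V(1)[OF assms]] by (auto simp: row_of_def)
    moreover have "u \<in> dom d" "u \<in> dom d'" using True R'_dom[OF assms] a by auto
    ultimately show ?thesis by auto
  next
    case False
    then have "u \<notin> dom d" "u \<notin> dom d'" using R'_dom[OF assms] a by auto
    then show ?thesis by (simp add: domIff)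
  qed
  then show "d = d' \<and> k = k'" using a(3) by (auto simp: row_of_def)
qed

text \<open>The encoding asks for a list of pairs of a map and a number, while the program yields
  rows. A pair is determined by its row because the domain of the map is the bag, so the preimages
  of the rows serve as \<open>tab\<close>.\<close>

lemma rows_table:
  assumes sep: "all_separated V E t" and rows: "set rows = Rset t"
  obtains tab where "set tab = R' E c t" "map (enc_entry vs (bag t)) tab = map erow rows"
proof
  let ?f = "row_of (bag t)" and ?g = "inv_into (R' E c t) (row_of (bag t))"
  show "set (map ?g rows) = R' E c t"
    using rows inv_into_image_cancel[OF inj_on_row_of[OF sep] order.refl] by (simp add: Rset_def)
  have "?f (?g r) = r" if "r \<in> set rows" for r
    using that rows by (simp add: Rset_def f_inv_into_f)
  then show "map (enc_entry vs (bag t)) (map ?g rows) = map erow rows"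
    by (simp add: enc_entry_eq comp_def)
qed

lemma main_spec:
  assumes sep: "all_separated V E T" and w: "\<And>\<alpha>. \<alpha> \<in> set (nodes T) \<Longrightarrow> card (bag_at T \<alpha>) \<le> w1"
  shows "\<exists>y. encodes_family vs T (\<lambda>\<alpha>. R' E c (subtree_at T \<alpha>)) y \<and>
    computes f_main [enc_instance vs E c T] y (length (nodes T) * (300 * node_cost npoints word_size (npoints ^ Suc w1)))"
proof -
  define Z where "Z = npoints ^ Suc w1"
  define H where "H = node_cost npoints word_size Z"
  define q where "q = Suc npoints"
  have Z1: "1 \<le> Z" unfolding Z_def by (rule power_npoints_ge)
  have H: "200 \<le> H" unfolding H_def by (rule node_cost_ge[OF Z1])
  have "\<exists>ys rw. distinct ys \<and> set ys = idx vs ` Yset T \<and>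
    (\<forall>\<alpha>\<in>set (nodes T). set (rw \<alpha>) = Rset (subtree_at T \<alpha>)) \<and> length (rw []) \<le> npoints ^ Suc (card (bag T)) \<and>
    computes f_solve [enc_tree vs T, enc_list [], ctxt]
      (Pair (epath ys) (enc_list (map (\<lambda>\<alpha>. enc_list (map erow (rw \<alpha>))) (nodes T) @ [])))
      (length (nodes T) * (100 * H))"
    unfolding H_def Z_def by (rule solve_spec[OF sep]) (rule w)
  then obtain ys rw where
    r: "\<forall>\<alpha>\<in>set (nodes T). set (rw \<alpha>) = Rset (subtree_at T \<alpha>)"
    and s_solve: "computes f_solve [enc_tree vs T, Atom, ctxt]
      (Pair (epath ys) (enc_list (map (\<lambda>\<alpha>. enc_list (map erow (rw \<alpha>))) (nodes T)))) (length (nodes T) * (100 * H))"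
    unfolding append_Nil2 enc_list.simps(1) by (elim exE conjE) (rule that; assumption)
  let ?y = "enc_list (map (\<lambda>\<alpha>. enc_list (map erow (rw \<alpha>))) (nodes T))"
  have "\<forall>\<alpha>\<in>set (nodes T). \<exists>tab. set tab = R' E c (subtree_at T \<alpha>) \<and>
      map (enc_entry vs (bag_at T \<alpha>)) tab = map erow (rw \<alpha>)"
  proof
    fix \<alpha> assume a: "\<alpha> \<in> set (nodes T)"
    have "set (rw \<alpha>) = Rset (subtree_at T \<alpha>)" using r a by blast
    from rows_table[OF all_separated_subtree[OF sep a] this] obtain tab where
      "set tab = R' E c (subtree_at T \<alpha>)" "map (enc_entry vs (bag_at T \<alpha>)) tab = map erow (rw \<alpha>)" .
    then show "\<exists>tab. set tab = R' E c (subtree_at T \<alpha>) \<and> map (enc_entry vs (bag_at T \<alpha>)) tab = map erow (rw \<alpha>)"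
      by blast
  qed
  then obtain tab where tab: "\<forall>\<alpha>\<in>set (nodes T). set (tab \<alpha>) = R' E c (subtree_at T \<alpha>) \<and>
      map (enc_entry vs (bag_at T \<alpha>)) (tab \<alpha>) = map erow (rw \<alpha>)" by metis
  have enc: "encodes_family vs T (\<lambda>\<alpha>. R' E c (subtree_at T \<alpha>)) ?y"
    unfolding encodes_family_def
    by (rule exI[of _ tab]) (use tab in \<open>auto intro!: arg_cong[where f = enc_list]\<close>)
  have inst: "enc_instance vs E c T = Pair adjm (Pair capl (Pair (enc_tree vs T) Atom))"
    by (simp add: enc_instance_def adjm_def capl_def)
  have q1: "1 \<le> q" by (simp add: q_def)
  have word_size: "word_size = q ^ 5" by (simp add: word_size_def q_def)
  have le: "q \<le> q ^ 5" "q ^ 2 \<le> q ^ 5" "q ^ 4 \<le> q ^ 5" "1 \<le> q ^ 5"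
    using q1 power_increasing[of 1 5 q] by (auto intro: power_increasing)
  have llH: "100 * word_size + 100 \<le> H"
  proof -
    have "scalar_cost word_size * 1 \<le> (scalar_cost word_size + 100) * Z" using Z1 by (intro mult_le_mono) auto
    also have "\<dots> \<le> H"
      unfolding H_def node_cost_def by (simp add: le_add1)
    finally show ?thesis using scalar_cost_ge(1)[of word_size] by simp
  qed
  have s_len: "computes f_len [adjm] (enc_nat (length vs)) H"
  proof -
    have "computes f_len [adjm] (enc_nat (length vs)) (10 * length vs + 5)"
      using len_spec[of "map (\<lambda>u. enc_list (map (\<lambda>v. enc_bool ({u, v} \<in> E)) vs)) vs"] by (simp add: adjm_def)
    then show ?thesis
      by (rule computes_mono) (use llH le(1) in \<open>simp add: word_size q_def npoints_def\<close>)
  qed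
  have s1: "computes f_umul [enc_nat q, enc_nat q] (enc_nat (q ^ 2)) H"
    using umul_spec[of q q] unfolding power2_eq_square[symmetric]
    by (rule computes_mono) (use llH le in \<open>simp add: word_size algebra_simps power2_eq_square\<close>)
  have s2: "computes f_umul [enc_nat (q ^ 2), enc_nat (q ^ 2)] (enc_nat (q ^ 4)) H"
  proof -
    have "q ^ 2 * q ^ 2 = q ^ 4" by (simp flip: power_add)
    then show ?thesis
      using umul_spec[of "q ^ 2" "q ^ 2"] llH le by (auto simp: word_size algebra_simps elim!: computes_mono)
  qed
  have s3: "computes f_umul [enc_nat q, enc_nat (q ^ 4)] (bits word_size 0) H"
  proof -
    have "q * q ^ 4 = q ^ 5" by (simp flip: power_Suc)
    then show ?thesis
      using umul_spec[of q "q ^ 4"] llH le by (auto simp: bits_zero word_size algebra_simps elim!: computes_mono)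
  qed
  have s_ctx: "computes f_ctx [adjm, capl, enc_nat npoints, bits word_size 0] ctxt (100 * H)"
  proof -
    have "word_size \<noteq> 0" using q1 word_size by simp
    then obtain l where l: "word_size = Suc l" using not0_implies_Suc by blast
    have "computes f_ctx [adjm, capl, enc_nat npoints, bits word_size 0] ctxt (100 * (npoints * (npoints * (npoints * scalar_cost word_size))))"
      unfolding ctxt_def vmat_def wmat_def l by (rule ctx_spec[OF npoints_pos])
    moreover have "100 * (npoints * (npoints * (npoints * scalar_cost word_size))) \<le> 100 * H"
      unfolding H_def node_cost_def
    proof (intro mult_le_mono order.refl)
      have "scalar_cost word_size * 1 \<le> (scalar_cost word_size + 100) * Z" using Z1 by (intro mult_le_mono) auto
      then show "scalar_cost word_size \<le> (scalar_cost word_size + 100) * Z" by simp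
    qed auto
    ultimately show ?thesis by (rule computes_mono)
  qed
  have len: "1 \<le> length (nodes T)" by (subst nodes_Cons) simp
  have "computes f_main [enc_instance vs E c T] ?y (length (nodes T) * (100 * H) + 200 * H)"
    unfolding inst
    apply (rule computesI)
     apply (simp add: prog_nth main_body_def elemE_eqs del: map_map)
     apply (rule callI[OF s_len])
     apply (simp only: enc_nat.simps(2)[symmetric] npoints_def[symmetric] q_def[symmetric])
     apply (rule callI[OF s1])
     apply (rule callI[OF s2])
     apply (rule callI[OF s3])
     apply (rule callI[OF s_ctx])
     apply (rule callI[OF s_solve])
    using H apply simp
    apply simp
    done
  \<comment> \<open>The cost of preparing the word length and the matrices is charged to one node;
    every tree has a root.\<close>
  moreover have "length (nodes T) * (100 * H) + 200 * H \<le> length (nodes T) * (300 * H)"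
    using mult_le_mono1[OF len, of "200 * H"] by (simp add: algebra_simps)
  ultimately have "computes f_main [enc_instance vs E c T] ?y (length (nodes T) * (300 * H))"
    by (rule computes_mono)
  with enc show ?thesis unfolding H_def Z_def by blast
qed

end

section \<open>From the step count to a power of n\<close>

lemma runs_if_spec_main:
  assumes "computes f_main [x] y b"
  shows "\<exists>t. runs prog x y t \<and> t \<le> b + 2"
proof -
  from assms obtain t where t: "eval prog [x] (prog ! f_main) y t" "t \<le> b"
    by (auto simp: computes_def call_def)
  have "evals prog [x] [Var 0] [x] (1 + 0)"
    by (intro evals_Cons evals_Nil) (use eval_Var[of 0 "[x]" prog] in simp)
  then have "eval prog [x] (CallE f_main [Var 0]) y (1 + 0 + t + 1)"
    using t(1) by (intro eval_Call) (simp_all add: length_prog)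
  then show ?thesis using t(2) unfolding runs_def by (intro exI[of _ "1 + 0 + t + 1"]) simp
qed

text \<open>The quotient of the powers is at most (1 + 1/n)^n and therefore at most exp 1. The width
  enters the exponent, so a constant factor is affordable here while one exponential in the width
  would not be.\<close>

lemma Suc_power_le:
  assumes "1 \<le> n" "w \<le> n"
  shows "(n + 1) ^ w \<le> 3 * n ^ w"
proof -
  let ?x = "1 + 1 / real n"
  have "?x ^ w \<le> ?x ^ n" using assms by (intro power_increasing) auto
  also have "\<dots> \<le> exp (1 / real n) ^ n" by (intro power_mono exp_ge_add_one_self) auto
  also have "\<dots> = exp 1" using assms by (simp flip: exp_of_nat_mult)
  also have "\<dots> \<le> 3" by (rule exp_le)
  finally have "?x ^ w * real n ^ w \<le> 3 * real n ^ w" by (rule mult_right_mono) simp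
  moreover have "?x * real n = real (n + 1)" using assms by (simp add: field_simps)
  ultimately have "real ((n + 1) ^ w) \<le> real (3 * n ^ w)" by (simp add: power_mult_distrib[symmetric])
  then show ?thesis by (simp only: of_nat_le_iff)
qed

text \<open>The 15 is 3 + 10 + 2: the cube in \<open>node_cost\<close>, the square of the word
  length \<open>q^5\<close>, and two axes beyond the width, one because a bag has up to w + 1
  vertices and one for \<open>k\<close>. The constants come from \<open>q \<le> 3 * n\<close>, from
  \<open>(n + 1)^2 \<le> 4 * n^2\<close> together with \<open>Suc_power_le\<close>, and from 400 +
  100 for the word operations.\<close>

lemma node_cost_le:
  assumes n: "1 \<le> n" and w: "w \<le> n"
  shows "node_cost (Suc n) ((Suc n + 1) ^ 5) (Suc n ^ Suc (Suc w)) \<le> (500 * 3 ^ 13 * 12) * n ^ (w + 15)"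
proof -
  define q where "q = n + 2"
  have q: "q \<le> 3 * n" "1 \<le> q" using n by (auto simp: q_def)
  have q5: "1 \<le> q ^ 5" using q(2) by (rule one_le_power)
  have "scalar_cost (q ^ 5) + 100 \<le> 100 * (2 * q ^ 5) * (2 * q ^ 5) + 100 * (q ^ 5 * q ^ 5)"
    unfolding scalar_cost_def using q5 mult_le_mono[OF q5 q5] by (intro add_mono mult_le_mono) auto
  also have "\<dots> = 500 * q ^ 10" by (simp add: power_add[symmetric])
  finally have k: "scalar_cost (q ^ 5) + 100 \<le> 500 * q ^ 10" .
  have "Suc n ^ Suc (Suc w) = (n + 1) ^ 2 * (n + 1) ^ w"
    by (simp add: power2_eq_square algebra_simps)
  also have "\<dots> \<le> (2 * n) ^ 2 * (3 * n ^ w)"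
    using n by (intro mult_le_mono power_mono Suc_power_le[OF n w]) auto
  also have "\<dots> = 12 * n ^ (w + 2)" by (simp add: power_add power2_eq_square)
  finally have z: "Suc n ^ Suc (Suc w) \<le> 12 * n ^ (w + 2)" .
  have "node_cost (Suc n) ((Suc n + 1) ^ 5) (Suc n ^ Suc (Suc w)) = q * (q * (q * ((scalar_cost (q ^ 5) + 100) * Suc n ^ Suc (Suc w))))"
    by (simp add: node_cost_def q_def)
  also have "\<dots> \<le> q * (q * (q * ((500 * q ^ 10) * (12 * n ^ (w + 2)))))"
    by (intro mult_le_mono order.refl k z)
  also have "\<dots> = 500 * 12 * (q ^ 13 * n ^ (w + 2))"
  proof -
    have "q ^ 13 = q ^ 3 * q ^ 10" by (simp flip: power_add)
    also have "\<dots> = q * (q * (q * q ^ 10))" by (simp only: power3_eq_cube mult_ac)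
    finally show ?thesis by (simp only: mult_ac)
  qed
  also have "\<dots> \<le> 500 * 12 * ((3 * n) ^ 13 * n ^ (w + 2))"
    using q(1) by (intro mult_le_mono order.refl power_mono) auto
  also have "\<dots> = (500 * 3 ^ 13 * 12) * n ^ (w + 15)"
  proof -
    have "w + 15 = 13 + (w + 2)" by simp
    then have "n ^ (w + 15) = n ^ 13 * n ^ (w + 2)" by (simp only: power_add)
    then show ?thesis by (simp only: power_mult_distrib mult_ac)
  qed
  finally show ?thesis .
qed

text \<open>The number of nodes occurs in the bound because a nice tree decomposition can be
  arbitrarily large compared with the graph. One constant serves as factor and as additive term of
  the exponent. For the empty graph the right-hand side would be 0.\<close>

theorem theorem4:
  shows
    "(\<exists>(p :: program) (b :: nat).
        \<forall>(V :: 'v set) (E :: 'v set set) (c :: 'v \<Rightarrow> nat) (T :: 'v rtree) (vs :: 'v list).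
          simple_graph V E \<longrightarrow> nice_tree_decomposition V E T \<longrightarrow> distinct vs \<longrightarrow> set vs = V \<longrightarrow>
          (\<exists>y t. runs p (enc_instance vs E c T) y t \<and>
             encodes_family vs T (\<lambda>\<alpha>. R' E c (subtree_at T \<alpha>)) y \<and>
             (V \<noteq> {} \<longrightarrow> t \<le> b * length (nodes T) * card V ^ (width T + b)))) \<and>
     (\<forall>(V :: 'v set) (E :: 'v set set) (c :: 'v \<Rightarrow> nat) (T :: 'v rtree).
        simple_graph V E \<longrightarrow> nice_tree_decomposition V E T \<longrightarrow>
        (\<forall>\<alpha>\<in>set (nodes T). R' E c (subtree_at T \<alpha>) = R E c (subtree_at T \<alpha>)))"
proof (intro conjI allI impI ballI)
  define K :: nat where "K = 500 * 3 ^ 13 * 12"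
  \<comment> \<open>300 is the constant of \<open>main_spec\<close> and 1 absorbs the steps of the
    initial call; being at least 15, the same number also serves in the exponent.\<close>
  define b where "b = 301 * K"
  have "\<exists>y t. runs prog (enc_instance vs E c T) y t \<and>
             encodes_family vs T (\<lambda>\<alpha>. R' E c (subtree_at T \<alpha>)) y \<and>
             (V \<noteq> {} \<longrightarrow> t \<le> b * length (nodes T) * card V ^ (width T + b))"
    if V: "simple_graph V E" and T: "nice_tree_decomposition V E T" and vs: "distinct vs" "set vs = V"
    for V :: "'v set" and E c T vs
  proof -
    interpret instance_graph V E c vs by unfold_locales fact+
    have sep: "all_separated V E T" by (rule all_separatedI[OF T])
    let ?S = "(\<lambda>\<alpha>. card (bag_at T \<alpha>)) ` set (nodes T)"
    have w: "card (bag_at T \<alpha>) \<le> Suc (width T)" if "\<alpha> \<in> set (nodes T)" for \<alpha>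
    proof -
      have "card (bag_at T \<alpha>) \<le> Max ?S" using that by (intro Max_ge) auto
      then show ?thesis unfolding width_def by arith
    qed
    have "\<exists>y. encodes_family vs T (\<lambda>\<alpha>. R' E c (subtree_at T \<alpha>)) y \<and>
        computes f_main [enc_instance vs E c T] y (length (nodes T) * (300 * node_cost npoints word_size (npoints ^ Suc (Suc (width T)))))"
      by (rule main_spec[OF sep]) (rule w)
    then obtain y where y: "encodes_family vs T (\<lambda>\<alpha>. R' E c (subtree_at T \<alpha>)) y"
      and s: "computes f_main [enc_instance vs E c T] y (length (nodes T) * (300 * node_cost npoints word_size (npoints ^ Suc (Suc (width T)))))"
      by blast
    from runs_if_spec_main[OF s] obtain t where t: "runs prog (enc_instance vs E c T) y t"
      "t \<le> length (nodes T) * (300 * node_cost npoints word_size (npoints ^ Suc (Suc (width T)))) + 2" by blast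
    have "t \<le> b * length (nodes T) * card V ^ (width T + b)" if ne: "V \<noteq> {}"
    proof -
      define n where "n = card V"
      have n: "1 \<le> n" using ne finite_V by (simp add: n_def Suc_le_eq card_gt_0_iff)
      have "nodes T \<noteq> []" by (cases T) simp
      then have "Max ?S \<in> ?S" by (intro Max_in) auto
      then obtain \<alpha> where "\<alpha> \<in> set (nodes T)" "Max ?S = card (bag_at T \<alpha>)" by blast
      then have "Max ?S \<le> n"
        using bag_subset_V(1)[OF all_separated_subtree[OF sep]] finite_V by (auto simp: n_def intro!: card_mono)
      \<comment> \<open>This is the condition under which \<open>Suc_power_le\<close> passes from
        powers of n + 1 to powers of n.\<close>
      then have wn: "width T \<le> n" unfolding width_def by simp
      have npoints: "npoints = Suc n" and word_size: "word_size = (Suc n + 1) ^ 5" by (simp_all add: npoints_def word_size_def n_def card_V)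
      have h: "node_cost npoints word_size (npoints ^ Suc (Suc (width T))) \<le> K * n ^ (width T + 15)"
        unfolding npoints word_size K_def by (rule node_cost_le[OF n wn])
      have K: "2 \<le> K" "15 \<le> b" by (simp_all add: K_def b_def)
      have l1: "1 \<le> length (nodes T)" by (subst nodes_Cons) simp
      have p1: "1 \<le> n ^ (width T + 15)" using n by (rule one_le_power)
      have "t \<le> length (nodes T) * (300 * (K * n ^ (width T + 15))) + 2"
        using t(2) mult_le_mono2[OF mult_le_mono2[OF h, of 300], of "length (nodes T)"] by linarith
      also have "\<dots> \<le> length (nodes T) * (300 * (K * n ^ (width T + 15))) + length (nodes T) * (K * n ^ (width T + 15))"
        by (rule add_left_mono) (use mult_le_mono[OF l1 mult_le_mono[OF K(1) p1]] in simp)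
      also have "\<dots> = b * length (nodes T) * n ^ (width T + 15)" by (simp add: b_def algebra_simps)
      also have "\<dots> \<le> b * length (nodes T) * n ^ (width T + b)"
        using n K(2) by (intro mult_le_mono2 power_increasing) auto
      finally show ?thesis by (simp only: n_def)
    qed
    with t(1) y show ?thesis by blast
  qed
  then show "\<exists>(p :: program) (b :: nat).
        \<forall>(V :: 'v set) (E :: 'v set set) (c :: 'v \<Rightarrow> nat) (T :: 'v rtree) (vs :: 'v list).
          simple_graph V E \<longrightarrow> nice_tree_decomposition V E T \<longrightarrow> distinct vs \<longrightarrow> set vs = V \<longrightarrow>
          (\<exists>y t. runs p (enc_instance vs E c T) y t \<and>
             encodes_family vs T (\<lambda>\<alpha>. R' E c (subtree_at T \<alpha>)) y \<and>
             (V \<noteq> {} \<longrightarrow> t \<le> b * length (nodes T) * card V ^ (width T + b)))"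
    by (intro exI[of _ prog] exI[of _ b] allI impI) blast
next
  fix V :: "'v set" and E c T \<alpha>
  assume "simple_graph V E" "nice_tree_decomposition V E T" "\<alpha> \<in> set (nodes T)"
  then show "R' E c (subtree_at T \<alpha>) = R E c (subtree_at T \<alpha>)"
    using R'_eq_R all_separated_subtree[OF all_separatedI] by blast
qed

end
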